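(* Assume (A1) convexity, (A2) smoothness, (A3) sub-Gaussian noise, (A4) local strong convexity and (A5) mixing gossip, as specified in the context. Let $p=2\log d$, $\tau=\max\left\{\frac{\log 4M}{2\log(1/\sigma_2(U))},1\right\}$, $\eta\lesssim\frac{1}{\tau LK}$, and $\hat w^m:=\frac1R\sum_{r=0}^{R-1}w_{r,0}^m$, where $w_{r,0}^m$ are the iterates of the DFedDA algorithm described in the context (no gradient tracking). Then $$\frac1M\sum_{m=1}^M\mathbb{E}\{f(\hat w^m)-f(w^* )\}\lesssim\frac{h(w^* )}{RK\eta}+\tau(\log d)^4\sigma^2\eta+\tau^2LK^2\mathcal{E}_M^*\eta^2.$$ Furthermore, if $\eta=\min\left\{\frac{1}{\tau LK},\ \frac{h(w^* )^{1/3}}{(\tau^2LR\,\mathcal{E}_M^* )^{1/3}K},\ \frac{h(w^* )^{1/2}}{(\tau RK)^{1/2}(\log d)^2\sigma}\right\}$, then $$\frac1M\sum_{m=1}^M\mathbb{E}\{f(\hat w^m)-f(w^* )\}\lesssim\frac{\tau Lh(w^* )}{R}+\frac{(\tau^2L\,\mathcal{E}_M^*h(w^* )^2)^{1/3}}{R^{2/3}}+\frac{(\tau h(w^* ))^{1/2}(\log d)^2\sigma}{(RK)^{1/2}}.$$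
   Context: Problem. There are $M$ clients, $[M]=\{1,\dots,M\}$, communicating over an undirected connected graph. Client $m$ has a data distribution $\mathcal{D}_m$ and local objective $f_m(w)=\mathbb{E}_{\xi\sim\mathcal{D}_m}F(w;\xi)$, $w\in\mathbb{R}^d$. The global objective is $f=\frac1M\sum_{m=1}^Mf_m$ and $w^*=\arg\min_{w\in\mathbb{R}^d}f(w)$, which is assumed $s$-sparse (at most $s$ nonzero coordinates). The stochastic gradient $\nabla F(w;\xi)$, $\xi\sim\mathcal{D}_m$, is an unbiased estimator of $\nabla f_m(w)$. The notation $a\lesssim b$ means $a\le Cb$ for some universal constant $C>0$. (A1) Each $f_m$ is convex: $f_m(w)+\langle\nabla f_m(w),v-w\rangle\le f_m(v)$ for all $w,v\in\mathbb{R}^d$. (A2) For each $m$: $\|\nabla f_m(w)-\nabla f_m(v)\|_\infty\le L\|w-v\|_1$ for all $w,v\in\mathbb{R}^d$. (A3) For every $m\in[M]$, $i\in[d]$, $w\in\mathbb{R}^d$, the $i$-th coordinate $\zeta_i^m(w)$ of $\nabla F(w;\xi_m)-\nabla f_m(w)$ satisfies $\mathbb{E}_{\xi_m\sim\mathcal{D}_m}\exp\{\lambda\zeta_i^m(w)\}\le\exp\{\lambda^2\sigma^2/2\}$ for all $\lambda\in\mathbb{R}$. (A4) Each $f_m$ satisfies a $Q$-local form of strong convexity: there is a constant $\mu(Q)>0$ such that $f_m(v)\ge f_m(w)+\langle\nabla f_m(w),v-w\rangle+\frac{\mu(Q)}{2}\|v-w\|_2^2$ for any $w,v\in\mathbb{R}^d$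 with $\|w\|_1^2\le Q$ and $\|v\|_1^2\le Q$. (A5) The gossip matrix $U=[u_{ij}]\in\mathbb{R}^{M\times M}$, which is symmetric, has $u_{ij}\ge0$ for all $i\ne j$ and is doubly stochastic ($U\mathbf 1=\mathbf 1$, $\mathbf 1^\top U=\mathbf 1^\top$), satisfies $0\le\sigma_2(U)<1$, where $\sigma_2(U)$ is its second-largest eigenvalue in terms of absolute value. Mirror map: with $p\ge2$ and $1/p+1/q=1$, $h(w)=\frac{1}{2(q-1)}\|w\|_q^2$; $\nabla h$ is invertible, with inverse $\nabla^{-1}h=\nabla h^*$, $h^*(z)=\frac1{2(p-1)}\|z\|_p^2$. Heterogeneity: $\mathcal{E}_M^*:=\frac1M\sum_{m=1}^M\|\nabla f_m(w^* )\|_p^2$. DFedDA algorithm (server step size $1$, client step size $\eta$, $K$ local steps, $R$ rounds, initial point $w_0$): initialize $z_{0,0}^m=\nabla h(w_0)$ for all $m$. For $r=0,\dots,R-1$, each client $m$ performs, for $k=0,\dots,K-1$: $w_{r,k}^m=\nabla^{-1}h(z_{r,k}^m)$, $z_{r,k+1}^m=z_{r,k}^m-\eta\nabla F(w_{r,k}^m;\xi_{r,k}^m)$ with a freshly drawn $\xi_{r,k}^m\sim\mathcal{D}_m$; then $z_{r+1,0}^m=\sum_{j=1}^Mu_{jm}z_{r,K}^j$. Also $w_{r,0}^m=\nabla^{-1}h(z_{r,0}^m)$.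
   Formalization: The initial point is assumed to satisfy B_h(w*,w_0) ≤ h(w* ) (e.g. w_0=0); the tuned step size uses c/(τLK) with the small universal c of η≲1/(τLK) instead of 1/(τLK); doubly stochastic includes a nonnegative diagonal. The claim fails for arbitrary w_0 and for c=1. *)

theory Defs
  imports "HOL-Probability.Probability" "Jordan_Normal_Form.Char_Poly"
begin

unbundle no vec_syntax
no_notation inner (infix "\<bullet>" 70)

text \<open>
  Vectors in d-dimensional space are elements of \<open>carrier_vec d\<close> and gossip matrices are elements of
  \<open>carrier_mat M M\<close>, so that the dimension \<open>d\<close> and the number \<open>M\<close> of clients are ordinary
  natural numbers. A constant that is existentially quantified before \<open>d\<close> and \<open>M\<close> is then
  independent of both; with dimensions encoded as types it could depend on them.
\<close>

definition lp_norm :: "real \<Rightarrow> real vec \<Rightarrow> real" where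
  "lp_norm p w = (\<Sum>i<dim_vec w. \<bar>w $ i\<bar> powr p) powr (1 / p)"

definition linf_norm :: "real vec \<Rightarrow> real" where
  "linf_norm w = Max ((\<lambda>i. \<bar>w $ i\<bar>) ` {..<dim_vec w})"

text \<open>Frechet differentiability; \<open>real vec\<close> is not a normed space in the type class sense, so the
  library's \<open>has_derivative\<close> does not apply.\<close>

definition has_gradient :: "nat \<Rightarrow> (real vec \<Rightarrow> real) \<Rightarrow> real vec \<Rightarrow> real vec \<Rightarrow> bool" where
  "has_gradient d \<phi> g w \<longleftrightarrow> g \<in> carrier_vec d \<and>
     (\<forall>e>0. \<exists>\<delta>>0. \<forall>v\<in>carrier_vec d. lp_norm 2 v < \<delta> \<longrightarrow>
        \<bar>\<phi> (w + v) - \<phi> w - g \<bullet> v\<bar> \<le> e * lp_norm 2 v)"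

definition gradient :: "nat \<Rightarrow> (real vec \<Rightarrow> real) \<Rightarrow> real vec \<Rightarrow> real vec" where
  "gradient d \<phi> w = (THE g. has_gradient d \<phi> g w)"

definition differentiable_everywhere :: "nat \<Rightarrow> (real vec \<Rightarrow> real) \<Rightarrow> bool" where
  "differentiable_everywhere d \<phi> \<longleftrightarrow> (\<forall>w\<in>carrier_vec d. \<exists>g. has_gradient d \<phi> g w)"

text \<open>The conjugate exponent of \<open>p\<close> is \<open>q = p / (p - 1)\<close>.\<close>

definition mirror_map :: "real \<Rightarrow> real vec \<Rightarrow> real" where
  "mirror_map p w = (let q = p / (p - 1) in (lp_norm q w)\<^sup>2 / (2 * (q - 1)))"

definition mirror_conj :: "real \<Rightarrow> real vec \<Rightarrow> real" where
  "mirror_conj p z = (lp_norm p z)\<^sup>2 / (2 * (p - 1))"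

definition mirror_inv :: "nat \<Rightarrow> real \<Rightarrow> real vec \<Rightarrow> real vec" where
  "mirror_inv d p z = gradient d (mirror_conj p) z"

definition bregman :: "nat \<Rightarrow> (real vec \<Rightarrow> real) \<Rightarrow> real vec \<Rightarrow> real vec \<Rightarrow> real" where
  "bregman d \<phi> v w = \<phi> v - \<phi> w - gradient d \<phi> w \<bullet> (v - w)"

definition client_obj :: "(nat \<Rightarrow> 'x measure) \<Rightarrow> (real vec \<Rightarrow> 'x \<Rightarrow> real) \<Rightarrow> nat \<Rightarrow> real vec \<Rightarrow> real" where
  "client_obj D F m w = (\<integral>x. F w x \<partial>D m)"

definition global_obj :: "nat \<Rightarrow> (nat \<Rightarrow> 'x measure) \<Rightarrow> (real vec \<Rightarrow> 'x \<Rightarrow> real) \<Rightarrow> real vec \<Rightarrow> real" where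
  "global_obj M D F w = (\<Sum>m<M. client_obj D F m w) / real M"

definition stoch_grad :: "nat \<Rightarrow> (real vec \<Rightarrow> 'x \<Rightarrow> real) \<Rightarrow> real vec \<Rightarrow> 'x \<Rightarrow> real vec" where
  "stoch_grad d F w x = gradient d (\<lambda>v. F v x) w"

definition heterogeneity ::
  "nat \<Rightarrow> nat \<Rightarrow> real \<Rightarrow> (nat \<Rightarrow> 'x measure) \<Rightarrow> (real vec \<Rightarrow> 'x \<Rightarrow> real) \<Rightarrow> real vec \<Rightarrow> real" where
  "heterogeneity d M p D F w = (\<Sum>m<M. (lp_norm p (gradient d (client_obj D F m) w))\<^sup>2) / real M"

text \<open>Eigenvalues are counted with algebraic multiplicity: the eigenvalue 1 occurs for every gossip
  matrix, and \<open>\<sigma>\<^sub>2(U) < 1\<close> says that 1 is simple and -1 is not an eigenvalue. A 1 by 1 matrix has no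
  second eigenvalue; the value is then 0.\<close>

definition second_abs_eigenvalue :: "real mat \<Rightarrow> real" where
  "second_abs_eigenvalue U =
     (let as = rev (sorted_list_of_multiset (image_mset abs (proots (char_poly U))))
      in if 2 \<le> length as then as ! 1 else 0)"

definition doubly_stochastic :: "nat \<Rightarrow> real mat \<Rightarrow> bool" where
  "doubly_stochastic M U \<longleftrightarrow> U \<in> carrier_mat M M \<and>
     (\<forall>i<M. \<forall>j<M. 0 \<le> U $$ (i, j)) \<and>
     (\<forall>i<M. (\<Sum>j<M. U $$ (i, j)) = 1) \<and> (\<forall>j<M. (\<Sum>i<M. U $$ (i, j)) = 1)"

text \<open>If \<open>\<sigma>\<^sub>2(U) = 0\<close>, the logarithm of \<open>1 / \<sigma>\<^sub>2(U)\<close> is infinite and the maximum is 1. The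
  conventions \<open>1 / 0 = 0\<close> and \<open>ln 0 = 0\<close> give the same value.\<close>

definition mixing_time :: "nat \<Rightarrow> real mat \<Rightarrow> real" where
  "mixing_time M U = max (ln (4 * real M) / (2 * ln (1 / second_abs_eigenvalue U))) 1"

text \<open>\<open>xs k\<close> is the sample used in local step \<open>k\<close>, and \<open>x r k m\<close> the one used by client \<open>m\<close> in
  local step \<open>k\<close> of round \<open>r\<close>. The state is the dual variable \<open>z\<close>.\<close>

primrec local_dual ::
  "nat \<Rightarrow> real \<Rightarrow> real \<Rightarrow> (real vec \<Rightarrow> 'x \<Rightarrow> real) \<Rightarrow> (nat \<Rightarrow> 'x) \<Rightarrow> real vec \<Rightarrow> nat \<Rightarrow> real vec" where
  "local_dual d p \<eta> F xs z 0 = z"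
| "local_dual d p \<eta> F xs z (Suc k) =
     local_dual d p \<eta> F xs z k -
       \<eta> \<cdot>\<^sub>v stoch_grad d F (mirror_inv d p (local_dual d p \<eta> F xs z k)) (xs k)"

primrec round_dual ::
  "nat \<Rightarrow> nat \<Rightarrow> nat \<Rightarrow> real \<Rightarrow> real \<Rightarrow> (real vec \<Rightarrow> 'x \<Rightarrow> real) \<Rightarrow> real mat \<Rightarrow> real vec \<Rightarrow>
     (nat \<Rightarrow> nat \<Rightarrow> nat \<Rightarrow> 'x) \<Rightarrow> nat \<Rightarrow> nat \<Rightarrow> real vec" where
  "round_dual d M K p \<eta> F U w0 x 0 = (\<lambda>m. gradient d (mirror_map p) w0)"
| "round_dual d M K p \<eta> F U w0 x (Suc r) =
     (\<lambda>m. vec d (\<lambda>i. \<Sum>j<M. U $$ (j, m) *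
        local_dual d p \<eta> F (\<lambda>k. x r k j) (round_dual d M K p \<eta> F U w0 x r j) K $ i))"

definition avg_iterate ::
  "nat \<Rightarrow> nat \<Rightarrow> nat \<Rightarrow> nat \<Rightarrow> real \<Rightarrow> real \<Rightarrow> (real vec \<Rightarrow> 'x \<Rightarrow> real) \<Rightarrow> real mat \<Rightarrow> real vec \<Rightarrow>
     (nat \<Rightarrow> nat \<Rightarrow> nat \<Rightarrow> 'x) \<Rightarrow> nat \<Rightarrow> real vec" where
  "avg_iterate d M K R p \<eta> F U w0 x m =
     vec d (\<lambda>i. (\<Sum>r<R. mirror_inv d p (round_dual d M K p \<eta> F U w0 x r m) $ i) / real R)"

text \<open>
  Clients are numbered from 0 to \<open>M - 1\<close>; \<open>\<xi> r k m\<close> is the sample drawn by client \<open>m\<close> in local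
  step \<open>k\<close> of round \<open>r\<close>, a random variable on the probability space \<open>P\<close>.

  Dual averaging is started at the minimiser \<open>w0 = 0\<close> of the mirror map, for which
  \<open>bregman d (mirror_map p) wstar w0 = mirror_map p wstar\<close>. Only the inequality is required here. For
  a starting point that violates it, bounds whose initial distance is measured by
  \<open>mirror_map p wstar\<close> fail (for instance for \<open>wstar = 0\<close>).
\<close>

locale dfedda_setting =
  fixes d M K R s :: nat
    and L \<sigma> Q \<mu> p :: real
    and D :: "nat \<Rightarrow> 'x measure"
    and F :: "real vec \<Rightarrow> 'x \<Rightarrow> real"
    and U :: "real mat"
    and P :: "'w measure"
    and \<xi> :: "nat \<Rightarrow> nat \<Rightarrow> nat \<Rightarrow> 'w \<Rightarrow> 'x"
    and w0 wstar :: "real vec"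
  assumes sizes: "1 \<le> M" "1 \<le> K" "1 \<le> R"
    and exponent: "p = 2 * ln (real d)" "2 \<le> p"
    and parameters: "0 < L" "0 \<le> \<sigma>" "0 < Q" "0 < \<mu>"
    and data: "\<And>m. m < M \<Longrightarrow> prob_space (D m)"
    and loss_integrable: "\<And>m w. m < M \<Longrightarrow> w \<in> carrier_vec d \<Longrightarrow> integrable (D m) (F w)"
    and loss_differentiable:
      "\<And>m x. m < M \<Longrightarrow> x \<in> space (D m) \<Longrightarrow> differentiable_everywhere d (\<lambda>w. F w x)"
    and client_differentiable: "\<And>m. m < M \<Longrightarrow> differentiable_everywhere d (client_obj D F m)"
    and unbiased: "\<And>m w i. m < M \<Longrightarrow> w \<in> carrier_vec d \<Longrightarrow> i < d \<Longrightarrow>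
      integrable (D m) (\<lambda>x. stoch_grad d F w x $ i) \<and>
      (\<integral>x. stoch_grad d F w x $ i \<partial>D m) = gradient d (client_obj D F m) w $ i"
    and minimizer: "wstar \<in> carrier_vec d"
      "\<And>w. w \<in> carrier_vec d \<Longrightarrow> global_obj M D F wstar \<le> global_obj M D F w"
    and sparse: "card {i. i < d \<and> wstar $ i \<noteq> 0} \<le> s"
    and convex: "\<And>m w v. m < M \<Longrightarrow> w \<in> carrier_vec d \<Longrightarrow> v \<in> carrier_vec d \<Longrightarrow>
      client_obj D F m w + gradient d (client_obj D F m) w \<bullet> (v - w) \<le> client_obj D F m v"
    and smooth: "\<And>m w v. m < M \<Longrightarrow> w \<in> carrier_vec d \<Longrightarrow> v \<in> carrier_vec d \<Longrightarrow>
      linf_norm (gradient d (client_obj D F m) w - gradient d (client_obj D F m) v)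
        \<le> L * lp_norm 1 (w - v)"
    and sub_gaussian: "\<And>m w i t. m < M \<Longrightarrow> w \<in> carrier_vec d \<Longrightarrow> i < d \<Longrightarrow>
      integrable (D m) (\<lambda>x. exp (t * (stoch_grad d F w x - gradient d (client_obj D F m) w) $ i)) \<and>
      (\<integral>x. exp (t * (stoch_grad d F w x - gradient d (client_obj D F m) w) $ i) \<partial>D m)
        \<le> exp (t\<^sup>2 * \<sigma>\<^sup>2 / 2)"
    and local_strong_convex: "\<And>m w v. m < M \<Longrightarrow> w \<in> carrier_vec d \<Longrightarrow> v \<in> carrier_vec d \<Longrightarrow>
      (lp_norm 1 w)\<^sup>2 \<le> Q \<Longrightarrow> (lp_norm 1 v)\<^sup>2 \<le> Q \<Longrightarrow>
      client_obj D F m w + gradient d (client_obj D F m) w \<bullet> (v - w) + \<mu> / 2 * (lp_norm 2 (v - w))\<^sup>2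
        \<le> client_obj D F m v"
    and gossip: "doubly_stochastic M U" "transpose_mat U = U"
      "0 \<le> second_abs_eigenvalue U" "second_abs_eigenvalue U < 1"
    and start: "w0 \<in> carrier_vec d"
      "bregman d (mirror_map p) wstar w0 \<le> mirror_map p wstar"
    and probability_space: "prob_space P"
    and fresh_samples:
      "prob_space.indep_vars P (\<lambda>(r, k, m). D m) (\<lambda>(r, k, m). \<xi> r k m) ({..<R} \<times> {..<K} \<times> {..<M})"
      "\<And>r k m. r < R \<Longrightarrow> k < K \<Longrightarrow> m < M \<Longrightarrow> distr P (D m) (\<xi> r k m) = D m"

text \<open>The Bochner integral below is 0 for non-integrable functions, so bounds on \<open>expected_gap\<close> should
  be stated together with the integrability of \<open>subopt\<close>.\<close>

definition subopt ::
  "nat \<Rightarrow> nat \<Rightarrow> nat \<Rightarrow> nat \<Rightarrow> real \<Rightarrow> real \<Rightarrow> (nat \<Rightarrow> 'x measure) \<Rightarrow> (real vec \<Rightarrow> 'x \<Rightarrow> real) \<Rightarrow> real mat \<Rightarrow>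
     (nat \<Rightarrow> nat \<Rightarrow> nat \<Rightarrow> 'w \<Rightarrow> 'x) \<Rightarrow> real vec \<Rightarrow> real vec \<Rightarrow> nat \<Rightarrow> 'w \<Rightarrow> real" where
  "subopt d M K R p \<eta> D F U \<xi> w0 wstar m \<omega> =
     global_obj M D F (avg_iterate d M K R p \<eta> F U w0 (\<lambda>r k m. \<xi> r k m \<omega>) m) - global_obj M D F wstar"

definition expected_gap ::
  "nat \<Rightarrow> nat \<Rightarrow> nat \<Rightarrow> nat \<Rightarrow> real \<Rightarrow> real \<Rightarrow> (nat \<Rightarrow> 'x measure) \<Rightarrow> (real vec \<Rightarrow> 'x \<Rightarrow> real) \<Rightarrow> real mat \<Rightarrow>
     'w measure \<Rightarrow> (nat \<Rightarrow> nat \<Rightarrow> nat \<Rightarrow> 'w \<Rightarrow> 'x) \<Rightarrow> real vec \<Rightarrow> real vec \<Rightarrow> real" where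
  "expected_gap d M K R p \<eta> D F U P \<xi> w0 wstar =
     (\<Sum>m<M. \<integral>\<omega>. subopt d M K R p \<eta> D F U \<xi> w0 wstar m \<omega> \<partial>P) / real M"

text \<open>The minimum of three step sizes, where \<open>H\<close> stands for \<open>h(w\<^sup>*)\<close>, \<open>\<tau>\<close> for the mixing time and
  \<open>E\<close> for the heterogeneity. A term whose denominator vanishes is infinite and does not take part in
  the minimum. The factor \<open>c\<close> is the constant in the step size condition
  \<open>\<eta> \<le> c / (\<tau> * L * K)\<close>, which the first term has to satisfy.\<close>

definition tuned_step ::
  "real \<Rightarrow> nat \<Rightarrow> nat \<Rightarrow> nat \<Rightarrow> real \<Rightarrow> real \<Rightarrow> real \<Rightarrow> real \<Rightarrow> real \<Rightarrow> real" where
  "tuned_step c d K R L \<sigma> \<tau> E H = Min (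
     {c / (\<tau> * L * real K)} \<union>
     (if E = 0 then {} else {H powr (1/3) / ((\<tau>\<^sup>2 * L * real R * E) powr (1/3) * real K)}) \<union>
     (if \<sigma> = 0 then {} else {H powr (1/2) / ((\<tau> * real R * real K) powr (1/2) * (ln (real d))\<^sup>2 * \<sigma>)}))"

end

theory Submission
  imports Defs "Jordan_Normal_Form.Schur_Decomposition"
begin

text \<open>
  The map \<open>z \<mapsto> \<parallel>z\<parallel>\<^sub>p\<^sup>2 / (2 (p - 1))\<close> is convex and 1-smooth in the \<open>p\<close>-norm, so its gradient is
  nonexpansive from the dual to the primal norm, and for \<open>p = 2 ln d\<close> the \<open>p\<close>- and \<open>q\<close>-norms agree with the
  maximum norm and the 1-norm up to the factor \<open>exp (1/2)\<close>. The averaged dual iterate \<open>z\<close>, which gossip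
  preserves, therefore performs mirror descent with potential \<open>h(w\<^sup>*) + h\<^sup>*(z) - \<langle>z, w\<^sup>*\<rangle>\<close>, which is
  at most \<open>h(w\<^sup>*)\<close> at the start and never negative. Per round it drops by \<open>\<eta> K\<close> times the gap, up to
  local drift, consensus error and noise.

  The consensus error is a convolution of past local updates with \<open>U\<^sup>t - 1 1\<^sup>T / M\<close>. The trace of
  \<open>U\<^sup>2\<^sup>t\<close>, a sum of powers of eigenvalues, bounds the Frobenius norm of this matrix, so its row sums
  fall by the factor 4 every \<open>2 \<tau>\<close> rounds. The squared gradient deviations that enter drift and
  consensus are paid for by the cocoercivity term of the descent inequality as long as \<open>\<eta> \<tau> L K\<close> is
  small. All of this is pathwise in the noise; expectations are only needed for the
  martingale terms: the noise is orthogonal to the past, and smoothness of the squared \<open>p\<close>-norm makes the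
  second moment of a sum of \<open>K\<close> noise vectors linear in \<open>K\<close>.
\<close>

section \<open>The \<open>p\<close>-norms and their duality map\<close>

text \<open>Vectors are functions on the naturals that are read only below \<open>d\<close> and are
  carried over by \<open>vec d\<close>; pointwise arithmetic is then free of dimension conditions.
  The obstacle of the deterministic part is circularity: drift, consensus error and gradient
  deviations bound one another. None of them is therefore bounded round by round. All are summed
  over the rounds and expressed through one quantity, the total squared deviation of the local
  gradients from their values at the minimiser, whose final coefficient is nonpositive for small
  steps. Measuring deviations from the minimiser is also what confines the heterogeneity to that
  single point. The obstacle of the probabilistic part is regularity: the losses are known to be
  measurable in the sample and differentiable in the point, but not jointly measurable.
  Measurability of gradients at random points has to be derived from continuity, and square
  integrability of every iterate has to be established before an expectation may be split.\<close>

definition ip :: "nat \<Rightarrow> (nat \<Rightarrow> real) \<Rightarrow> (nat \<Rightarrow> real) \<Rightarrow> real" where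
  "ip d x y = (\<Sum>i<d. x i * y i)"

definition nrm :: "nat \<Rightarrow> real \<Rightarrow> (nat \<Rightarrow> real) \<Rightarrow> real" where
  "nrm d p x = (\<Sum>i<d. \<bar>x i\<bar> powr p) powr (1 / p)"

text \<open>The duality map, that is, the gradient of half the squared \<open>r\<close>-norm. At the
  zero vector it is zero, because \<open>0 powr a = 0\<close>.\<close>

definition dualv :: "nat \<Rightarrow> real \<Rightarrow> (nat \<Rightarrow> real) \<Rightarrow> nat \<Rightarrow> real" where
  "dualv d r x i = nrm d r x powr (2 - r) * \<bar>x i\<bar> powr (r - 1) * sgn (x i)"

definition conjugate_exponents :: "real \<Rightarrow> real \<Rightarrow> bool" where
  "conjugate_exponents p q \<longleftrightarrow> 1 < p \<and> 1 < q \<and> 1 / p + 1 / q = 1"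

lemma conjugate_exponents_sym: "conjugate_exponents p q \<Longrightarrow> conjugate_exponents q p"
  by (auto simp: conjugate_exponents_def)

lemma conjugate_exponents_mult: "conjugate_exponents p q \<Longrightarrow> (p - 1) * (q - 1) = 1"
  by (auto simp: conjugate_exponents_def field_simps)

lemma conjugate_exponentsI: "1 < p \<Longrightarrow> conjugate_exponents p (p / (p - 1))"
  by (auto simp: conjugate_exponents_def field_simps)

lemma ip_commute: "ip d x y = ip d y x"
  by (simp add: ip_def mult.commute)

lemma ip_add_left: "ip d (\<lambda>i. x i + y i) z = ip d x z + ip d y z"
  by (simp add: ip_def algebra_simps sum.distrib)

lemma ip_diff_left: "ip d (\<lambda>i. x i - y i) z = ip d x z - ip d y z"
  by (simp add: ip_def algebra_simps sum_subtractf)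

lemma ip_scale_left: "ip d (\<lambda>i. c * x i) z = c * ip d x z"
  by (simp add: ip_def sum_distrib_left mult.assoc)

lemma ip_sum_left: "ip d (\<lambda>i. \<Sum>j\<in>A. x j i) z = (\<Sum>j\<in>A. ip d (x j) z)"
  unfolding ip_def by (simp add: sum_distrib_right) (rule sum.swap)

lemma ip_add_right: "ip d z (\<lambda>i. x i + y i) = ip d z x + ip d z y"
  by (simp add: ip_def algebra_simps sum.distrib)

lemma ip_diff_right: "ip d z (\<lambda>i. x i - y i) = ip d z x - ip d z y"
  by (simp add: ip_def algebra_simps sum_subtractf)

lemma ip_scale_right: "ip d z (\<lambda>i. c * x i) = c * ip d z x"
  by (simp add: ip_def sum_distrib_left algebra_simps)

lemma ip_sum_right: "ip d z (\<lambda>i. \<Sum>j\<in>A. x j i) = (\<Sum>j\<in>A. ip d z (x j))"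
  unfolding ip_def by (simp add: sum_distrib_left) (rule sum.swap)

lemma ip_cong: "(\<And>i. i < d \<Longrightarrow> x i = x' i) \<Longrightarrow> (\<And>i. i < d \<Longrightarrow> y i = y' i) \<Longrightarrow> ip d x y = ip d x' y'"
  unfolding ip_def by (intro sum.cong) auto

lemma nrm_cong: "(\<And>i. i < d \<Longrightarrow> x i = x' i) \<Longrightarrow> nrm d p x = nrm d p x'"
  unfolding nrm_def by (intro arg_cong2[where f="(powr)"] sum.cong) auto

lemma nrm_nonneg [simp]: "0 \<le> nrm d p x"
  by (simp add: nrm_def)

lemma nrm_zero [simp]: "nrm d p (\<lambda>i. 0) = 0"
  by (simp add: nrm_def)

lemma nrm_powr: "0 < p \<Longrightarrow> nrm d p x powr p = (\<Sum>i<d. \<bar>x i\<bar> powr p)"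
  by (simp add: nrm_def powr_powr sum_nonneg)

lemma nrm_eq_0: assumes "nrm d p x = 0" "i < d" shows "x i = 0"
proof -
  have "(\<Sum>i<d. \<bar>x i\<bar> powr p) = 0"
    using assms by (simp add: nrm_def)
  then show ?thesis using assms(2) by (simp add: sum_nonneg_eq_0_iff)
qed

lemma nrm_mono: assumes "0 < p" "\<And>i. i < d \<Longrightarrow> \<bar>x i\<bar> \<le> \<bar>y i\<bar>" shows "nrm d p x \<le> nrm d p y"
  unfolding nrm_def using assms by (intro powr_mono2 sum_mono sum_nonneg) auto

lemma abs_le_nrm: assumes "0 < p" "i < d" shows "\<bar>x i\<bar> \<le> nrm d p x"
proof -
  have "\<bar>x i\<bar> = (\<bar>x i\<bar> powr p) powr (1/p)" using assms by (simp add: powr_powr)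
  also have "\<dots> \<le> nrm d p x" unfolding nrm_def using assms
    by (intro powr_mono2 member_le_sum) auto
  finally show ?thesis .
qed

lemma nrm_scale: assumes "0 < p" shows "nrm d p (\<lambda>i. c * x i) = \<bar>c\<bar> * nrm d p x"
proof -
  have "(\<Sum>i<d. \<bar>c * x i\<bar> powr p) = \<bar>c\<bar> powr p * (\<Sum>i<d. \<bar>x i\<bar> powr p)"
    by (simp add: abs_mult powr_mult sum_distrib_left)
  then show ?thesis using assms by (simp add: nrm_def powr_mult powr_powr sum_nonneg)
qed

lemma nrm_diff_commute: "nrm d p (\<lambda>i. x i - y i) = nrm d p (\<lambda>i. y i - x i)"
  by (simp add: nrm_def abs_minus_commute)

text \<open>Splitting one factor off each power leaves the exponent \<open>p - 1\<close>, under
  which the whole sum dominates each entry. The case \<open>p = 1\<close> is included, which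
  conjugate exponents would exclude.\<close>

lemma nrm_le_sum_abs: assumes "1 \<le> p" shows "nrm d p x \<le> (\<Sum>i<d. \<bar>x i\<bar>)"
proof -
  define s where "s = (\<Sum>i<d. \<bar>x i\<bar>)"
  have s0: "0 \<le> s" by (simp add: s_def sum_nonneg)
  have le: "\<bar>x i\<bar> powr p \<le> \<bar>x i\<bar> * s powr (p - 1)" if "i < d" for i
  proof (cases "x i = 0")
    case False
    have "\<bar>x i\<bar> powr p = \<bar>x i\<bar> powr 1 * \<bar>x i\<bar> powr (p - 1)"
      by (subst powr_add[symmetric]) simp
    also have "\<bar>x i\<bar> powr (p - 1) \<le> s powr (p - 1)"
      using assms that unfolding s_def by (intro powr_mono2 member_le_sum) auto
    finally show ?thesis using False by (simp add: mult_left_mono)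
  qed simp
  have "(\<Sum>i<d. \<bar>x i\<bar> powr p) \<le> (\<Sum>i<d. \<bar>x i\<bar> * s powr (p - 1))"
    using le by (intro sum_mono) auto
  also have "\<dots> = s * s powr (p - 1)" by (simp add: s_def sum_distrib_right)
  also have "\<dots> = s powr p" using s0 assms
    by (cases "s = 0") (auto simp: powr_mult_base)
  finally have "nrm d p x \<le> (s powr p) powr (1/p)" unfolding nrm_def
    using assms by (intro powr_mono2 sum_nonneg) auto
  also have "\<dots> = s" using assms s0 by (simp add: powr_powr)
  finally show ?thesis by (simp add: s_def)
qed

lemma nrm_1: "nrm d 1 x = (\<Sum>i<d. \<bar>x i\<bar>)"
  by (simp add: nrm_def sum_nonneg)

theorem Holder_sum:
  assumes "conjugate_exponents p q"
  shows "\<bar>ip d x y\<bar> \<le> nrm d p x * nrm d q y"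
proof (cases "nrm d p x = 0 \<or> nrm d q y = 0")
  case True
  then have "ip d x y = 0" unfolding ip_def by (intro sum.neutral) (auto dest: nrm_eq_0)
  then show ?thesis by simp
next
  case False
  define A B where "A = nrm d p x" and "B = nrm d q y"
  have pos: "0 < A" "0 < B" using False nrm_nonneg[of d p x] nrm_nonneg[of d q y]
    by (auto simp: A_def B_def less_le)
  have pq: "1 < p" "1 < q" "1/p + 1/q = 1" using assms by (auto simp: conjugate_exponents_def)
  have "(\<Sum>i<d. (\<bar>x i\<bar> / A) * (\<bar>y i\<bar> / B)) \<le>
        (\<Sum>i<d. (\<bar>x i\<bar> / A) powr p / p + (\<bar>y i\<bar> / B) powr q / q)"
    using pq pos by (intro sum_mono Youngs_inequality) auto
  also have "\<dots> = (\<Sum>i<d. \<bar>x i\<bar> powr p) / (A powr p * p) + (\<Sum>i<d. \<bar>y i\<bar> powr q) / (B powr q * q)"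
    using pos by (simp add: sum.distrib powr_divide sum_divide_distrib)
  also have "\<dots> = 1"
    using pq pos nrm_powr[of p d x, symmetric] nrm_powr[of q d y, symmetric] by (simp add: A_def B_def)
  finally have 1: "(\<Sum>i<d. (\<bar>x i\<bar> / A) * (\<bar>y i\<bar> / B)) \<le> 1" .
  have "\<bar>ip d x y\<bar> \<le> (\<Sum>i<d. \<bar>x i\<bar> * \<bar>y i\<bar>)"
    unfolding ip_def by (rule order_trans[OF sum_abs]) (simp add: abs_mult)
  also have "\<dots> = A * B * (\<Sum>i<d. (\<bar>x i\<bar> / A) * (\<bar>y i\<bar> / B))"
    using pos by (simp add: sum_distrib_left)
  also have "\<dots> \<le> A * B * 1" using pos 1 by (intro mult_left_mono) auto
  finally show ?thesis by (simp add: A_def B_def)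
qed

lemma ip_le_nrm: "conjugate_exponents p q \<Longrightarrow> ip d x y \<le> nrm d p x * nrm d q y"
  using Holder_sum[of p q d x y] by simp

lemma ip_dualv:
  assumes "1 < r" shows "ip d (dualv d r x) x = (nrm d r x)\<^sup>2"
proof (cases "nrm d r x = 0")
  case False
  then have N: "0 < nrm d r x" using nrm_nonneg[of d r x] by linarith
  have "ip d (dualv d r x) x = nrm d r x powr (2 - r) * (\<Sum>i<d. \<bar>x i\<bar> powr r)"
    unfolding ip_def dualv_def sum_distrib_left
  proof (intro sum.cong refl)
    fix i
    have "\<bar>x i\<bar> powr (r - 1) * (sgn (x i) * x i) = \<bar>x i\<bar> powr r"
      using powr_add[of "\<bar>x i\<bar>" "r - 1" 1] by (auto simp: sgn_if)
    then show "nrm d r x powr (2 - r) * \<bar>x i\<bar> powr (r - 1) * sgn (x i) * x i =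
         nrm d r x powr (2 - r) * \<bar>x i\<bar> powr r" by (simp add: mult.assoc)
  qed
  also have "\<dots> = nrm d r x powr (2 - r) * nrm d r x powr r" using assms by (simp add: nrm_powr)
  also have "\<dots> = (nrm d r x)\<^sup>2" using N by (simp add: powr_add[symmetric])
  finally show ?thesis .
qed (simp add: ip_def dualv_def)

text \<open>The identity \<open>(r - 1) * r' = r\<close> turns the power sum of the dual vector back
  into that of \<open>x\<close>.\<close>

lemma nrm_dualv:
  assumes "conjugate_exponents r r'" shows "nrm d r' (dualv d r x) = nrm d r x"
proof (cases "nrm d r x = 0")
  case True
  then have "nrm d r' (dualv d r x) = nrm d r' (\<lambda>i. 0)"
    by (intro nrm_cong) (auto simp: dualv_def)
  then show ?thesis using True by simp
next
  case False
  then have N: "0 < nrm d r x" using nrm_nonneg[of d r x] by linarith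
  have r: "1 < r" "1 < r'" "(r - 1) * r' = r" "r / r' = r - 1"
    using assms by (auto simp: conjugate_exponents_def field_simps)
  have eq: "\<bar>dualv d r x i\<bar> powr r' = nrm d r x powr ((2 - r) * r') * \<bar>x i\<bar> powr r" for i
    using r by (cases "x i = 0") (auto simp: dualv_def abs_mult powr_mult powr_powr abs_sgn_eq)
  have "nrm d r' (dualv d r x) = (nrm d r x powr ((2 - r) * r') * nrm d r x powr r) powr (1 / r')"
    unfolding nrm_def[of d r'] eq using r by (simp add: sum_distrib_left[symmetric] nrm_powr)
  also have "\<dots> = nrm d r x powr ((2 - r) + (r - 1))"
    using N r by (simp add: powr_add[symmetric] powr_powr add_divide_distrib)
  also have "\<dots> = nrm d r x" using N by simp
  finally show ?thesis .
qed

text \<open>Minkowski's inequality by duality: the squared norm of the sum is its pairing with its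
  own dual vector, Hoelder's inequality bounds the two halves of the pairing, and one factor of the
  norm cancels.\<close>

lemma nrm_triangle:
  assumes "conjugate_exponents p q"
  shows "nrm d p (\<lambda>i. x i + y i) \<le> nrm d p x + nrm d p y"
proof -
  let ?s = "\<lambda>i. x i + y i"
  have p: "1 < p" using assms by (simp add: conjugate_exponents_def)
  have "(nrm d p ?s)\<^sup>2 = ip d x (dualv d p ?s) + ip d y (dualv d p ?s)"
    using ip_dualv[OF p, of d ?s] by (simp add: ip_add_left ip_commute[of d "dualv d p ?s"])
  also have "\<dots> \<le> nrm d p x * nrm d p ?s + nrm d p y * nrm d p ?s"
    using ip_le_nrm[OF assms, of d x "dualv d p ?s"] ip_le_nrm[OF assms, of d y "dualv d p ?s"]
    by (simp add: nrm_dualv[OF assms])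
  finally have *: "nrm d p ?s * nrm d p ?s \<le> (nrm d p x + nrm d p y) * nrm d p ?s"
    by (simp add: power2_eq_square algebra_simps)
  show ?thesis
  proof (cases "nrm d p ?s = 0")
    case False
    then show ?thesis using * nrm_nonneg[of d p ?s] by (simp add: mult_le_cancel_right less_le)
  qed simp
qed

lemma nrm_sum_le:
  assumes "conjugate_exponents p q"
  shows "nrm d p (\<lambda>i. \<Sum>j\<in>A. x j i) \<le> (\<Sum>j\<in>A. nrm d p (x j))"
proof (induction A rule: infinite_finite_induct)
  case (insert j A)
  have "nrm d p (\<lambda>i. x j i + (\<Sum>j\<in>A. x j i)) \<le> nrm d p (x j) + nrm d p (\<lambda>i. \<Sum>j\<in>A. x j i)"
    by (rule nrm_triangle[OF assms])
  with insert show ?case by simp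
qed simp_all

text \<open>Cauchy-Schwarz after writing each weight as a product of two square roots. Absolute
  values are taken because the gossip deviations, which will serve as weights, have both
  signs.\<close>

lemma nrm_sq_weighted_sum_le:
  assumes "conjugate_exponents p q"
  shows "(nrm d p (\<lambda>i. \<Sum>j\<in>A. a j * x j i))\<^sup>2 \<le> (\<Sum>j\<in>A. \<bar>a j\<bar>) * (\<Sum>j\<in>A. \<bar>a j\<bar> * (nrm d p (x j))\<^sup>2)"
proof -
  have p: "0 < p" using assms by (simp add: conjugate_exponents_def)
  have "nrm d p (\<lambda>i. \<Sum>j\<in>A. a j * x j i) \<le> (\<Sum>j\<in>A. nrm d p (\<lambda>i. a j * x j i))"
    by (rule nrm_sum_le[OF assms])
  also have "\<dots> = (\<Sum>j\<in>A. sqrt \<bar>a j\<bar> * (sqrt \<bar>a j\<bar> * nrm d p (x j)))"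
    using p by (simp add: nrm_scale mult.assoc[symmetric])
  finally have "(nrm d p (\<lambda>i. \<Sum>j\<in>A. a j * x j i))\<^sup>2 \<le> (\<Sum>j\<in>A. sqrt \<bar>a j\<bar> * (sqrt \<bar>a j\<bar> * nrm d p (x j)))\<^sup>2"
    by (intro power_mono) auto
  also have "\<dots> \<le> (\<Sum>j\<in>A. (sqrt \<bar>a j\<bar>)\<^sup>2) * (\<Sum>j\<in>A. (sqrt \<bar>a j\<bar> * nrm d p (x j))\<^sup>2)"
    by (rule Cauchy_Schwarz_ineq_sum)
  finally show ?thesis by (simp add: power_mult_distrib)
qed

lemma nrm_sq_sum_le:
  assumes "conjugate_exponents p q"
  shows "(nrm d p (\<lambda>i. \<Sum>j\<in>A. x j i))\<^sup>2 \<le> real (card A) * (\<Sum>j\<in>A. (nrm d p (x j))\<^sup>2)"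
  using nrm_sq_weighted_sum_le[OF assms, of d "\<lambda>_. 1" x A] by simp

lemma nrm_sq_add_le:
  assumes "conjugate_exponents p q"
  shows "(nrm d p (\<lambda>i. x i + y i))\<^sup>2 \<le> 2 * (nrm d p x)\<^sup>2 + 2 * (nrm d p y)\<^sup>2"
  using nrm_sq_sum_le[OF assms, of d "\<lambda>j. if j then x else y" UNIV] by (simp add: UNIV_bool algebra_simps)

section \<open>Smoothness of the squared \<open>p\<close>-norm\<close>

lemma tendsto_abs_powr_0: "0 < a \<Longrightarrow> ((\<lambda>h::real. \<bar>h\<bar> powr a) \<longlongrightarrow> 0) (at 0)"
  using tendsto_powr'[of "\<lambda>h::real. \<bar>h\<bar>" 0 "at 0" "\<lambda>_. a" a] tendsto_rabs[OF tendsto_ident_at[of "0::real" UNIV]]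
  by simp

lemma has_real_derivative_abs_powr:
  fixes x :: real assumes "1 < p"
  shows "((\<lambda>t. \<bar>t\<bar> powr p) has_real_derivative p * (\<bar>x\<bar> powr (p - 1) * sgn x)) (at x)"
proof -
  consider "0 < x" | "x < 0" | "x = 0" by linarith
  then show ?thesis
  proof cases
    case 1
    have "((\<lambda>t. t powr p) has_real_derivative p * (\<bar>x\<bar> powr (p - 1) * sgn x)) (at x)"
      using 1 by (auto intro!: derivative_eq_intros)
    then show ?thesis
      by (rule has_field_derivative_transform_within_open[where S = "{0<..}"]) (use 1 in auto)
  next
    case 2
    have "((\<lambda>t. (- t) powr p) has_real_derivative p * (\<bar>x\<bar> powr (p - 1) * sgn x)) (at x)"
      using 2 by (auto intro!: derivative_eq_intros)
    then show ?thesis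
      by (rule has_field_derivative_transform_within_open[where S = "{..<0}"]) (use 2 in auto)
  next
    case 3
    have "((\<lambda>h. \<bar>h\<bar> powr p / h) \<longlongrightarrow> 0) (at 0)"
    proof (rule Lim_null_comparison)
      show "\<forall>\<^sub>F h in at (0::real). norm (\<bar>h\<bar> powr p / h) \<le> \<bar>h\<bar> powr (p - 1)"
        by (rule eventually_mono[OF eventually_neq_at_within[of 0]])
           (auto simp: powr_diff)
    qed (use assms tendsto_abs_powr_0 in auto)
    then show ?thesis using 3 by (simp add: DERIV_def)
  qed
qed

text \<open>Serves to differentiate a power a second time, with \<open>a = p - 1\<close>. The
  condition \<open>1 < a\<close> makes the difference quotient at the origin vanish; it translates
  to \<open>2 < p\<close>.\<close>

lemma has_real_derivative_abs_powr_sgn: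
  fixes x :: real assumes "1 < a"
  shows "((\<lambda>t. \<bar>t\<bar> powr a * sgn t) has_real_derivative a * \<bar>x\<bar> powr (a - 1)) (at x)"
proof -
  consider "0 < x" | "x < 0" | "x = 0" by linarith
  then show ?thesis
  proof cases
    case 1
    have "((\<lambda>t. t powr a) has_real_derivative a * \<bar>x\<bar> powr (a - 1)) (at x)"
      using 1 by (auto intro!: derivative_eq_intros)
    then show ?thesis
      by (rule has_field_derivative_transform_within_open[where S = "{0<..}"]) (use 1 in auto)
  next
    case 2
    have "((\<lambda>t. - ((- t) powr a)) has_real_derivative a * \<bar>x\<bar> powr (a - 1)) (at x)"
      using 2 by (auto intro!: derivative_eq_intros)
    then show ?thesis
      by (rule has_field_derivative_transform_within_open[where S = "{..<0}"]) (use 2 in auto)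
  next
    case 3
    have "((\<lambda>h. \<bar>h\<bar> powr a * sgn h / h) \<longlongrightarrow> 0) (at 0)"
    proof (rule Lim_null_comparison)
      show "\<forall>\<^sub>F h in at (0::real). norm (\<bar>h\<bar> powr a * sgn h / h) \<le> \<bar>h\<bar> powr (a - 1)"
        by (rule eventually_mono[OF eventually_neq_at_within[of 0]])
           (auto simp: powr_diff abs_mult abs_sgn_eq)
    qed (use assms tendsto_abs_powr_0 in auto)
    then show ?thesis using 3 assms by (simp add: DERIV_def)
  qed
qed

lemma nrm_sq: "(nrm d p x)\<^sup>2 = (\<Sum>i<d. \<bar>x i\<bar> powr p) powr (2 / p)"
proof -
  have "(nrm d p x)\<^sup>2 = nrm d p x powr 2" by simp
  then show ?thesis by (simp add: nrm_def powr_powr del: powr_numeral)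
qed

text \<open>Hoelder with the exponents \<open>p / (p - 2)\<close> and \<open>p / 2\<close>. Up to
  the factor \<open>p * (p - 1)\<close> the left side is the second derivative of the power sum in
  direction \<open>v\<close>.\<close>

lemma Holder_second_order:
  assumes "2 < p"
  shows "(\<Sum>i<d. \<bar>y i\<bar> powr (p - 2) * (v i)\<^sup>2) \<le> (\<Sum>i<d. \<bar>y i\<bar> powr p) powr ((p - 2) / p) * (nrm d p v)\<^sup>2"
proof -
  have c: "conjugate_exponents (p / (p - 2)) (p / 2)"
    using assms by (auto simp: conjugate_exponents_def field_simps)
  have 1: "nrm d (p / (p - 2)) (\<lambda>i. \<bar>y i\<bar> powr (p - 2)) = (\<Sum>i<d. \<bar>y i\<bar> powr p) powr ((p - 2) / p)"
    using assms by (simp add: nrm_def powr_powr)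
  have "\<bar>(v i)\<^sup>2\<bar> powr (p / 2) = \<bar>v i\<bar> powr p" for i
  proof -
    have "\<bar>(v i)\<^sup>2\<bar> = \<bar>v i\<bar> powr 2" by simp
    then show ?thesis by (simp only: powr_powr) simp
  qed
  then have 2: "nrm d (p / 2) (\<lambda>i. (v i)\<^sup>2) = (nrm d p v)\<^sup>2"
    using assms by (simp add: nrm_sq) (simp add: nrm_def)
  show ?thesis using ip_le_nrm[OF c, of d "\<lambda>i. \<bar>y i\<bar> powr (p - 2)" "\<lambda>i. (v i)\<^sup>2"]
    unfolding 1 2 ip_def .
qed

text \<open>Second-order Taylor expansion of the squared norm along the segment from
  \<open>z\<close> to \<open>z + v\<close>. Positivity keeps the segment away from the origin, where
  the power \<open>2 / p\<close> of the power sum is not differentiable.\<close>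

lemma nrm_sq_smooth_aux:
  assumes p: "2 < p" and pos: "\<And>t. 0 \<le> t \<Longrightarrow> t \<le> 1 \<Longrightarrow> 0 < (\<Sum>i<d. \<bar>z i + t * v i\<bar> powr p)"
  shows "(nrm d p (\<lambda>i. z i + v i))\<^sup>2 \<le> (nrm d p z)\<^sup>2 + 2 * ip d (dualv d p z) v + (p - 1) * (nrm d p v)\<^sup>2"
proof -
  define N where "N t = (\<Sum>i<d. \<bar>z i + t * v i\<bar> powr p)" for t
  define N1 where "N1 t = (\<Sum>i<d. p * (\<bar>z i + t * v i\<bar> powr (p - 1) * sgn (z i + t * v i)) * v i)" for t
  define N2 where "N2 t = (\<Sum>i<d. p * ((p - 1) * \<bar>z i + t * v i\<bar> powr (p - 2) * v i) * v i)" for t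
  define f where "f t = N t powr (2 / p)" for t
  define f1 where "f1 t = 2 / p * N t powr (2 / p - 1) * N1 t" for t
  define f2 where "f2 t = 2 / p * ((2 / p - 1) * N t powr (2 / p - 2) * N1 t * N1 t + N t powr (2 / p - 1) * N2 t)" for t
  have N: "(N has_real_derivative N1 t) (at t)" for t
    unfolding N_def N1_def using p
    by (intro DERIV_sum DERIV_chain2[OF has_real_derivative_abs_powr]) (auto intro!: derivative_eq_intros)
  have N1: "(N1 has_real_derivative N2 t) (at t)" for t
  proof -
    have "((\<lambda>t. \<bar>z i + t * v i\<bar> powr (p - 1) * sgn (z i + t * v i)) has_real_derivative
           (p - 1) * \<bar>z i + t * v i\<bar> powr (p - 1 - 1) * v i) (at t)" for i
      using p by (intro DERIV_chain2[OF has_real_derivative_abs_powr_sgn]) (auto intro!: derivative_eq_intros)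
    then have "((\<lambda>t. \<bar>z i + t * v i\<bar> powr (p - 1) * sgn (z i + t * v i)) has_real_derivative
           (p - 1) * \<bar>z i + t * v i\<bar> powr (p - 2) * v i) (at t)" for i
      by simp
    from DERIV_cmult_right[OF DERIV_cmult[OF this]] show ?thesis
      unfolding N1_def N2_def by (intro DERIV_sum) auto
  qed
  have f: "(f has_real_derivative f1 t) (at t)" if "0 \<le> t" "t \<le> 1" for t
  proof -
    have "0 < N t" using pos[OF that] by (simp add: N_def)
    then show ?thesis unfolding f_def f1_def using N[of t] by (auto intro!: derivative_eq_intros)
  qed
  have f1: "(f1 has_real_derivative f2 t) (at t)" if "0 \<le> t" "t \<le> 1" for t
  proof -
    have "0 < N t" using pos[OF that] by (simp add: N_def)
    then have "((\<lambda>t. N t powr (2 / p - 1)) has_real_derivative (2 / p - 1) * N t powr (2 / p - 2) * N1 t) (at t)"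
      using N[of t] by (auto intro!: derivative_eq_intros)
    from DERIV_mult[OF DERIV_cmult[OF this] N1] show ?thesis
      unfolding f1_def f2_def by (rule back_subst[of "\<lambda>D. DERIV _ _ :> D"]) (simp add: algebra_simps)
  qed
  have f2: "f2 t \<le> 2 * (p - 1) * (nrm d p v)\<^sup>2" if "0 \<le> t" "t \<le> 1" for t
  proof -
    have Npos: "0 < N t" using pos[OF that] by (simp add: N_def)
    have "N2 t = p * (p - 1) * (\<Sum>i<d. \<bar>z i + t * v i\<bar> powr (p - 2) * (v i)\<^sup>2)"
      by (simp add: N2_def sum_distrib_left power2_eq_square mult_ac)
    also have "\<dots> \<le> p * (p - 1) * (N t powr ((p - 2) / p) * (nrm d p v)\<^sup>2)"
      unfolding N_def using p by (intro mult_left_mono Holder_second_order) auto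
    finally have N2: "N2 t \<le> p * (p - 1) * (N t powr ((p - 2) / p) * (nrm d p v)\<^sup>2)" .
    have "(2 / p - 1) * N t powr (2 / p - 2) * N1 t * N1 t \<le> 0"
      using p by (simp add: mult_nonpos_nonneg mult.assoc)
    then have "f2 t \<le> 2 / p * (N t powr (2 / p - 1) * N2 t)"
      unfolding f2_def using p by (intro mult_left_mono) auto
    also have "\<dots> \<le> 2 / p * (N t powr (2 / p - 1) * (p * (p - 1) * (N t powr ((p - 2) / p) * (nrm d p v)\<^sup>2)))"
      using N2 p by (intro mult_left_mono) auto
    also have "\<dots> = 2 * (p - 1) * (N t powr (2 / p - 1) * N t powr ((p - 2) / p)) * (nrm d p v)\<^sup>2"
      using p by (simp add: field_simps)
    also have "N t powr (2 / p - 1) * N t powr ((p - 2) / p) = 1"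
    proof -
      have "2 / p - 1 + (p - 2) / p = 0" using p by (simp add: field_simps)
      then show ?thesis using Npos by (simp add: powr_add[symmetric])
    qed
    finally show ?thesis by simp
  qed
  define diff where "diff m = (if m = 0 then f else if m = 1 then f1 else f2)" for m :: nat
  have "\<exists>t>0. t < 1 \<and> f 1 = (\<Sum>m<2. diff m 0 / fact m * 1 ^ m) + diff 2 t / fact 2 * 1 ^ 2"
    by (rule Maclaurin) (auto simp: diff_def less_2_cases_iff f f1)
  then obtain t where t: "0 < t" "t < 1" and *: "f 1 = f 0 + f1 0 + f2 t / 2"
    by (auto simp: diff_def numeral_2_eq_2)
  have sq: "f 1 = (nrm d p (\<lambda>i. z i + v i))\<^sup>2" "f 0 = (nrm d p z)\<^sup>2"
    by (auto simp: f_def N_def nrm_sq)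
  have "f1 0 = 2 * ip d (dualv d p z) v"
  proof -
    have "nrm d p z powr (2 - p) = N 0 powr (2 / p - 1)"
      using p by (simp add: nrm_def N_def powr_powr diff_divide_distrib)
    then show ?thesis using p
      by (simp add: f1_def N1_def ip_def dualv_def sum_distrib_left mult_ac)
  qed
  then show ?thesis using * f2[of t] t sq by (simp add: algebra_simps)
qed

text \<open>It remains to treat a segment through the origin. There \<open>z\<close> is
  \<open>- t\<close> times \<open>v\<close>, so both sides are multiples of the squared norm of
  \<open>v\<close>, and the claim reduces to \<open>1 \<le> p - 1\<close>.\<close>

lemma nrm_sq_smooth:
  assumes p: "2 < p"
  shows "(nrm d p (\<lambda>i. z i + v i))\<^sup>2 \<le> (nrm d p z)\<^sup>2 + 2 * ip d (dualv d p z) v + (p - 1) * (nrm d p v)\<^sup>2"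
proof (cases "\<exists>t. 0 \<le> t \<and> t \<le> 1 \<and> (\<Sum>i<d. \<bar>z i + t * v i\<bar> powr p) \<le> 0")
  case False
  then show ?thesis by (intro nrm_sq_smooth_aux p) (metis not_le)
next
  case True
  then obtain t where t: "0 \<le> t" "t \<le> 1" "(\<Sum>i<d. \<bar>z i + t * v i\<bar> powr p) \<le> 0" by auto
  then have "(\<Sum>i<d. \<bar>z i + t * v i\<bar> powr p) = 0" by (intro antisym sum_nonneg) auto
  then have z: "z i = - t * v i" if "i < d" for i
    using that by (auto simp: sum_nonneg_eq_0_iff eq_neg_iff_add_eq_0)
  have 1: "nrm d p (\<lambda>i. z i + v i) = (1 - t) * nrm d p v"
  proof -
    have "nrm d p (\<lambda>i. z i + v i) = nrm d p (\<lambda>i. (1 - t) * v i)"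
      by (rule nrm_cong) (simp add: z algebra_simps)
    then show ?thesis using p t by (simp add: nrm_scale)
  qed
  have 2: "nrm d p z = t * nrm d p v"
  proof -
    have "nrm d p z = nrm d p (\<lambda>i. (- t) * v i)" by (rule nrm_cong) (simp add: z)
    also have "\<dots> = \<bar>- t\<bar> * nrm d p v" using p by (intro nrm_scale) simp
    finally show ?thesis using t by simp
  qed
  have 3: "ip d (dualv d p z) v = - t * (nrm d p v)\<^sup>2"
  proof (cases "t = 0")
    case True
    then have "ip d (dualv d p z) v = 0" using z by (auto simp: ip_def dualv_def)
    then show ?thesis using True by simp
  next
    case False
    have "ip d (dualv d p z) z = ip d (dualv d p z) (\<lambda>i. (- t) * v i)"
      by (rule ip_cong) (auto simp: z)
    then have "(nrm d p z)\<^sup>2 = - t * ip d (dualv d p z) v"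
      using p ip_dualv[of p d z] ip_scale_right[of d "dualv d p z" "- t" v] by simp
    then have "t * (t * (nrm d p v)\<^sup>2) = t * - ip d (dualv d p z) v"
      unfolding 2 by (simp add: power2_eq_square mult_ac)
    then have "t * (nrm d p v)\<^sup>2 = - ip d (dualv d p z) v"
      using False by (metis mult_left_cancel)
    then show ?thesis by simp
  qed
  have "(1 - t)\<^sup>2 * (nrm d p v)\<^sup>2 \<le> (t\<^sup>2 - 2 * t + (p - 1)) * (nrm d p v)\<^sup>2"
    using p by (intro mult_right_mono) (auto simp: power2_eq_square algebra_simps)
  then show ?thesis unfolding 1 2 3 power_mult_distrib by (simp add: algebra_simps)
qed

text \<open>The passage from smoothness to a Lipschitz gradient for a pair of dual norms:
  \<open>key\<close> compares the supporting hyperplane at \<open>y\<close> with the quadratic upper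
  bound at \<open>z\<close>, and adding it to its mirror image leaves a pairing for Hoelder's
  inequality.\<close>

lemma nrm_dualv_diff_le:
  assumes p: "2 < p" and pq: "conjugate_exponents p q"
  shows "nrm d q (\<lambda>i. dualv d p z i - dualv d p y i) \<le> (p - 1) * nrm d p (\<lambda>i. z i - y i)"
proof -
  have qp: "conjugate_exponents q p" and q: "1 < q"
    using pq by (auto intro: conjugate_exponents_sym simp: conjugate_exponents_def)
  have convex: "(nrm d p a)\<^sup>2 + 2 * ip d (dualv d p a) (\<lambda>i. b i - a i) \<le> (nrm d p b)\<^sup>2" for a b
  proof -
    have "ip d (dualv d p a) b \<le> nrm d p a * nrm d p b"
      using ip_le_nrm[OF qp, of d "dualv d p a" b] nrm_dualv[OF pq] by simp
    also have "2 * \<dots> \<le> (nrm d p a)\<^sup>2 + (nrm d p b)\<^sup>2"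
      using sum_squares_bound[of "nrm d p a" "nrm d p b"] by simp
    finally show ?thesis using p by (simp add: ip_diff_right ip_dualv)
  qed
  have key: "(nrm d q (\<lambda>i. dualv d p z i - dualv d p y i))\<^sup>2 / (p - 1)
       \<le> (nrm d p z)\<^sup>2 - (nrm d p y)\<^sup>2 - 2 * ip d (dualv d p y) (\<lambda>i. z i - y i)" for z y
  proof -
    define D where "D i = dualv d p z i - dualv d p y i" for i
    \<comment> \<open>This shift minimises
      \<open>2 * ip d D s + (p - 1) * (nrm d p s)\<^sup>2\<close>, the part of the upper bound at
      \<open>z\<close> that depends on it.\<close>
    define s where "s i = - 1 / (p - 1) * dualv d q D i" for i
    have s1: "ip d D s = - (nrm d q D)\<^sup>2 / (p - 1)"
      unfolding s_def ip_scale_right using q by (simp add: ip_commute[of d D] ip_dualv)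
    have "nrm d p s = \<bar>- 1 / (p - 1)\<bar> * nrm d p (dualv d q D)"
      unfolding s_def using p by (intro nrm_scale) simp
    then have s2: "nrm d p s = nrm d q D / (p - 1)"
      using p by (simp add: nrm_dualv[OF qp])
    have "(nrm d p y)\<^sup>2 + 2 * ip d (dualv d p y) (\<lambda>i. (z i + s i) - y i) \<le> (nrm d p (\<lambda>i. z i + s i))\<^sup>2"
      by (rule convex)
    also have "\<dots> \<le> (nrm d p z)\<^sup>2 + 2 * ip d (dualv d p z) s + (p - 1) * (nrm d p s)\<^sup>2"
      by (rule nrm_sq_smooth[OF p])
    finally have "(nrm d p y)\<^sup>2 + 2 * ip d (dualv d p y) (\<lambda>i. z i - y i) \<le>
        (nrm d p z)\<^sup>2 + 2 * ip d D s + (p - 1) * (nrm d p s)\<^sup>2"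
      unfolding D_def ip_diff_left ip_diff_right ip_add_right by simp
    moreover have "(p - 1) * (nrm d p s)\<^sup>2 = (nrm d q D)\<^sup>2 / (p - 1)"
      unfolding s2 using p by (simp add: power2_eq_square)
    ultimately have "(nrm d q D)\<^sup>2 / (p - 1) \<le> (nrm d p z)\<^sup>2 - (nrm d p y)\<^sup>2 - 2 * ip d (dualv d p y) (\<lambda>i. z i - y i)"
      unfolding s1 by simp
    then show ?thesis unfolding D_def .
  qed
  define A where "A = nrm d q (\<lambda>i. dualv d p z i - dualv d p y i)"
  have "A\<^sup>2 / (p - 1) + A\<^sup>2 / (p - 1) \<le> 2 * ip d (\<lambda>i. dualv d p z i - dualv d p y i) (\<lambda>i. z i - y i)"
    using key[of z y] key[of y z] nrm_diff_commute[of d q "dualv d p z"]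
    unfolding A_def ip_diff_left ip_diff_right by simp
  also have "\<dots> \<le> 2 * (A * nrm d p (\<lambda>i. z i - y i))"
    unfolding A_def using ip_le_nrm[OF qp] by simp
  finally have "A * A / (p - 1) \<le> A * nrm d p (\<lambda>i. z i - y i)"
    by (simp add: power2_eq_square)
  then have "A * A \<le> A * ((p - 1) * nrm d p (\<lambda>i. z i - y i))"
    using p by (simp add: pos_divide_le_eq mult_ac)
  moreover have "0 \<le> A" by (simp add: A_def)
  ultimately have "A \<le> (p - 1) * nrm d p (\<lambda>i. z i - y i)"
    using p by (cases "A = 0") (auto simp: mult_le_cancel_left less_le)
  then show ?thesis by (simp add: A_def)
qed

section \<open>Mixing of the gossip matrix\<close>

definition mat_tr :: "'a::comm_ring_1 mat \<Rightarrow> 'a" where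
  "mat_tr A = (\<Sum>i<dim_row A. A $$ (i, i))"

lemma mult_mat_index:
  "A \<in> carrier_mat n m \<Longrightarrow> B \<in> carrier_mat m k \<Longrightarrow> i < n \<Longrightarrow> j < k \<Longrightarrow>
    (A * B) $$ (i, j) = (\<Sum>l<m. A $$ (i, l) * B $$ (l, j))"
  by (auto simp: scalar_prod_def lessThan_atLeast0 intro!: sum.cong)

lemma mat_tr_comm:
  assumes "A \<in> carrier_mat n m" "B \<in> carrier_mat m n"
  shows "mat_tr (A * B) = mat_tr (B * A)"
proof -
  have "mat_tr (A * B) = (\<Sum>i<n. \<Sum>l<m. A $$ (i, l) * B $$ (l, i))"
    unfolding mat_tr_def using assms by (intro sum.cong) (auto simp: mult_mat_index[OF assms] simp del: index_mult_mat(1))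
  also have "\<dots> = (\<Sum>l<m. \<Sum>i<n. B $$ (l, i) * A $$ (i, l))"
    by (subst sum.swap) (simp add: mult.commute)
  also have "\<dots> = mat_tr (B * A)"
    unfolding mat_tr_def using assms by (intro sum.cong) (auto simp: mult_mat_index[OF assms(2,1)] simp del: index_mult_mat(1))
  finally show ?thesis .
qed

lemma mat_tr_similar:
  assumes "A \<in> carrier_mat n n" "similar_mat_wit A B P Q"
  shows "mat_tr A = mat_tr B"
proof -
  note w = similar_mat_witD2[OF assms]
  have "mat_tr A = mat_tr (P * (B * Q))" using w by (simp add: assoc_mult_mat[of P n n B n Q n])
  also have "\<dots> = mat_tr (B * Q * P)" using w by (intro mat_tr_comm) auto
  also have "B * Q * P = B" using w by (simp add: assoc_mult_mat[of B n n Q n P n])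
  finally show ?thesis .
qed

lemma upper_triangular_pow:
  fixes B :: "'a::comm_ring_1 mat"
  assumes B: "B \<in> carrier_mat n n" "upper_triangular B"
  shows "upper_triangular (B ^\<^sub>m k) \<and> (\<forall>i<n. (B ^\<^sub>m k) $$ (i, i) = B $$ (i, i) ^ k)"
proof (induction k)
  case 0
  then show ?case using B by auto
next
  case (Suc k)
  have P: "B ^\<^sub>m k \<in> carrier_mat n n" using B by simp
  have low: "B $$ (i, j) = 0" "(B ^\<^sub>m k) $$ (i, j) = 0" if "j < i" "i < n" for i j
    using that B Suc P by (auto intro: upper_triangularD)
  have ij: "(B ^\<^sub>m Suc k) $$ (i, j) = (\<Sum>l<n. (B ^\<^sub>m k) $$ (i, l) * B $$ (l, j))" if "i < n" "j < n" for i j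
    using mult_mat_index[OF P B(1) that] by simp
  have "upper_triangular (B ^\<^sub>m Suc k)"
  proof (rule upper_triangularI)
    fix i j assume a: "j < i" "i < dim_row (B ^\<^sub>m Suc k)"
    then have "i < n" "j < n" using P by auto
    then have "(B ^\<^sub>m Suc k) $$ (i, j) = (\<Sum>l<n. (B ^\<^sub>m k) $$ (i, l) * B $$ (l, j))" by (rule ij)
    also have "\<dots> = 0"
    proof (intro sum.neutral ballI)
      fix l assume "l \<in> {..<n}"
      then show "(B ^\<^sub>m k) $$ (i, l) * B $$ (l, j) = 0"
        using low(2)[of l i] low(1)[of j l] a \<open>i < n\<close> by (cases "l < i") auto
    qed
    finally show "(B ^\<^sub>m Suc k) $$ (i, j) = 0" .
  qed
  moreover have "(B ^\<^sub>m Suc k) $$ (i, i) = B $$ (i, i) ^ Suc k" if i: "i < n" for i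
  proof -
    have "(B ^\<^sub>m Suc k) $$ (i, i) = (\<Sum>l<n. if l = i then (B ^\<^sub>m k) $$ (i, i) * B $$ (i, i) else 0)"
      unfolding ij[OF i i]
    proof (intro sum.cong refl)
      fix l assume "l \<in> {..<n}"
      then show "(B ^\<^sub>m k) $$ (i, l) * B $$ (l, i) = (if l = i then (B ^\<^sub>m k) $$ (i, i) * B $$ (i, i) else 0)"
        using low(2)[of l i] low(1)[of i l] i by (cases l i rule: linorder_cases) auto
    qed
    also have "\<dots> = B $$ (i, i) ^ Suc k" using i Suc by simp
    finally show ?thesis .
  qed
  ultimately show ?case by blast
qed

text \<open>Similarity to a triangular matrix preserves the trace of every power, and the diagonal
  of the triangular form lists the roots with multiplicity. The splitting hypothesis makes this
  possible over the reals.\<close>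

lemma mat_tr_pow_eq_sum_roots:
  fixes A :: "real mat"
  assumes A: "A \<in> carrier_mat n n" and c: "char_poly A = (\<Prod>e\<leftarrow>es. [:- e, 1:])"
  shows "mat_tr (A ^\<^sub>m k) = (\<Sum>e\<leftarrow>es. e ^ k)"
proof -
  obtain B P Q where s: "schur_decomposition A es = (B, P, Q)" by (cases "schur_decomposition A es") auto
  from schur_decomposition[OF A c s] have w: "similar_mat_wit A B P Q"
    and ut: "upper_triangular B" and d: "diag_mat B = es" by auto
  have B: "B \<in> carrier_mat n n" using similar_mat_witD2[OF A w] by simp
  have "mat_tr (A ^\<^sub>m k) = mat_tr (B ^\<^sub>m k)"
    using similar_mat_wit_pow[OF w] A by (intro mat_tr_similar[where n = n]) auto
  also have "\<dots> = (\<Sum>i<n. B $$ (i, i) ^ k)"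
    unfolding mat_tr_def using upper_triangular_pow[OF B ut] B by (intro sum.cong) auto
  also have "\<dots> = (\<Sum>e\<leftarrow>diag_mat B. e ^ k)"
    using B by (simp add: diag_mat_def sum_list_sum_nth lessThan_atLeast0 o_def)
  finally show ?thesis using d by simp
qed

text \<open>The Hermitian form \<open>S\<close> at an eigenvector is its own conjugate by symmetry
  of \<open>A\<close>, and it is also \<open>e\<close> times the nonzero squared norm of the
  eigenvector.\<close>

lemma symmetric_eigenvalue_real:
  fixes A :: "real mat"
  assumes A: "A \<in> carrier_mat n n" and sym: "A\<^sup>T = A"
    and e: "eigenvalue (map_mat complex_of_real A) e"
  shows "e \<in> \<real>"
proof -
  let ?A = "map_mat complex_of_real A"
  obtain v where v: "v \<in> carrier_vec n" "v \<noteq> 0\<^sub>v n" and ev: "?A *\<^sub>v v = e \<cdot>\<^sub>v v"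
    using e A by (auto simp: eigenvalue_def eigenvector_def)
  have symA: "A $$ (i, j) = A $$ (j, i)" if "i < n" "j < n" for i j
    using that A sym by (metis carrier_matD index_transpose_mat(1))
  have row: "(\<Sum>j<n. complex_of_real (A $$ (i, j)) * v $ j) = e * v $ i" if "i < n" for i
  proof -
    have "(?A *\<^sub>v v) $ i = (\<Sum>j<n. complex_of_real (A $$ (i, j)) * v $ j)"
      using that A v by (auto simp: scalar_prod_def lessThan_atLeast0 intro!: sum.cong)
    then show ?thesis using ev v that by simp
  qed
  define S where "S = (\<Sum>i<n. cnj (v $ i) * (\<Sum>j<n. complex_of_real (A $$ (i, j)) * v $ j))"
  have "cnj S = (\<Sum>i<n. \<Sum>j<n. v $ i * (complex_of_real (A $$ (i, j)) * cnj (v $ j)))"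
    by (simp add: S_def sum_distrib_left)
  also have "\<dots> = (\<Sum>j<n. \<Sum>i<n. v $ i * (complex_of_real (A $$ (i, j)) * cnj (v $ j)))"
    by (rule sum.swap)
  also have "\<dots> = S" unfolding S_def sum_distrib_left
    by (intro sum.cong refl) (auto simp: symA mult_ac)
  finally have SR: "S \<in> \<real>" by (simp add: Reals_cnj_iff)
  define N where "N = (\<Sum>i<n. (cmod (v $ i))\<^sup>2)"
  have "S = (\<Sum>i<n. e * (v $ i * cnj (v $ i)))"
    unfolding S_def by (intro sum.cong refl) (simp only: lessThan_iff row, simp add: mult_ac)
  also have "\<dots> = e * complex_of_real N"
    by (simp add: N_def sum_distrib_left complex_norm_square del: of_real_power)
  finally have SN: "S = e * complex_of_real N" .
  have "N \<noteq> 0"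
  proof
    assume "N = 0"
    then have "v $ i = 0" if "i < n" for i
      using that by (auto simp: N_def sum_nonneg_eq_0_iff)
    then have "v = 0\<^sub>v n" using v by (intro eq_vecI) auto
    with v show False by simp
  qed
  then have "e = S / complex_of_real N" using SN by simp
  then show ?thesis using SR by simp
qed

text \<open>The complex factorisation has only real roots; replacing them by their real parts gives
  a real product that agrees with the characteristic polynomial at every real point.\<close>

lemma symmetric_char_poly_splits:
  fixes A :: "real mat"
  assumes A: "A \<in> carrier_mat n n" and sym: "A\<^sup>T = A"
  obtains rs where "char_poly A = (\<Prod>r\<leftarrow>rs. [:- r, 1:])" "length rs = n"
proof -
  let ?A = "map_mat complex_of_real A"
  have cA: "?A \<in> carrier_mat n n" using A by simp
  obtain es where es: "char_poly ?A = (\<Prod>e\<leftarrow>es. [:- e, 1:])" and len: "length es = n"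
    using char_poly_factorized[OF cA] by blast
  define rs where "rs = map Re es"
  have real: "complex_of_real (Re e) = e" if "e \<in> set es" for e
  proof -
    have "poly (char_poly ?A) e = 0" unfolding es using that
      by (auto simp: poly_prod_list prod_list_zero_iff o_def image_iff intro!: bexI[of _ e])
    then have "eigenvalue ?A e" using eigenvalue_root_char_poly[OF cA] by simp
    then show ?thesis using symmetric_eigenvalue_real[OF A sym] by simp
  qed
  have "poly (char_poly A) x = poly (\<Prod>r\<leftarrow>rs. [:- r, 1:]) x" for x
  proof -
    have "complex_of_real (poly (char_poly A) x) = poly (char_poly ?A) (complex_of_real x)"
      by (simp add: of_real_hom.char_poly_hom[OF A])
    also have "\<dots> = (\<Prod>e\<leftarrow>es. complex_of_real (x - Re e))"
      unfolding es poly_prod_list using real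
      by (auto simp: o_def intro!: arg_cong[where f = prod_list] map_cong)
    also have "\<dots> = complex_of_real (\<Prod>e\<leftarrow>es. x - Re e)"
      by (induction es) auto
    finally have "poly (char_poly A) x = (\<Prod>e\<leftarrow>es. x - Re e)" by (simp only: of_real_eq_iff)
    then show ?thesis by (simp add: rs_def poly_prod_list o_def)
  qed
  then have "char_poly A = (\<Prod>r\<leftarrow>rs. [:- r, 1:])" by (simp add: poly_eq_poly_eq_iff[symmetric] fun_eq_iff)
  then show thesis using that[of rs] len by (simp add: rs_def)
qed

lemma proots_prod_linear: "proots (\<Prod>r\<leftarrow>rs. [:- r, 1:]) = mset (rs :: real list)"
proof (induction rs)
  case (Cons r rs)
  have "(\<Prod>r\<leftarrow>rs. [:- r, 1:]) \<noteq> (0 :: real poly)" by (auto simp: prod_list_zero_iff)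
  with Cons show ?case by (simp add: proots_mult del: mult_pCons_left)
qed simp

lemma mat_pow_add_index:
  assumes A: "(A :: 'a::comm_ring_1 mat) \<in> carrier_mat n n" and "i < n" "j < n"
  shows "(A ^\<^sub>m (s + t)) $$ (i, j) = (\<Sum>l<n. (A ^\<^sub>m s) $$ (i, l) * (A ^\<^sub>m t) $$ (l, j))"
  using assms(3)
proof (induction t arbitrary: j)
  case 0
  have "(\<Sum>l<n. (A ^\<^sub>m s) $$ (i, l) * (A ^\<^sub>m 0) $$ (l, j)) = (\<Sum>l<n. if l = j then (A ^\<^sub>m s) $$ (i, j) else 0)"
    using A 0 by (intro sum.cong) auto
  then show ?case using 0 by simp
next
  case (Suc t)
  have P: "A ^\<^sub>m k \<in> carrier_mat n n" for k using A by simp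
  have "(A ^\<^sub>m (s + Suc t)) $$ (i, j) = (\<Sum>k<n. (A ^\<^sub>m (s + t)) $$ (i, k) * A $$ (k, j))"
    using mult_mat_index[OF P A assms(2) Suc.prems] by simp
  also have "\<dots> = (\<Sum>k<n. \<Sum>l<n. (A ^\<^sub>m s) $$ (i, l) * ((A ^\<^sub>m t) $$ (l, k) * A $$ (k, j)))"
    using Suc.IH by (intro sum.cong refl) (simp add: sum_distrib_right mult.assoc)
  also have "\<dots> = (\<Sum>l<n. \<Sum>k<n. (A ^\<^sub>m s) $$ (i, l) * ((A ^\<^sub>m t) $$ (l, k) * A $$ (k, j)))"
    by (rule sum.swap)
  also have "\<dots> = (\<Sum>l<n. (A ^\<^sub>m s) $$ (i, l) * (A ^\<^sub>m Suc t) $$ (l, j))"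
    using mult_mat_index[OF P A _ Suc.prems] by (intro sum.cong refl) (simp add: sum_distrib_left)
  finally show ?case .
qed

text \<open>The second entry is below 1, so the entry 1 can only be the head, and every other entry
  is at most \<open>s\<close>. For a list of length one the default value of \<open>s\<close> is
  multiplied by zero.\<close>

lemma sum_list_pow_le_second:
  fixes as :: "real list"
  assumes as: "sorted (rev as)" "1 \<in> set as" "\<And>a. a \<in> set as \<Longrightarrow> 0 \<le> a"
    and s: "s = (if 2 \<le> length as then as ! 1 else 0)" "s < 1"
  shows "(\<Sum>a\<leftarrow>as. a ^ k) \<le> 1 + (real (length as) - 1) * s ^ k"
proof -
  obtain b bs where b: "as = b # bs" using as(2) by (cases as) auto
  have le: "a \<le> s" if "a \<in> set bs" for a
  proof -
    obtain c cs where c: "bs = c # cs" using \<open>a \<in> set bs\<close> by (cases bs) auto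
    then have "s = c" using s b by simp
    then show ?thesis using as(1) that b c by (auto simp: sorted_append)
  qed
  have "b = 1" using as(2) b le s(2) by fastforce
  moreover have "(\<Sum>a\<leftarrow>bs. a ^ k) \<le> (\<Sum>a\<leftarrow>bs. s ^ k)"
    using le as(3) b by (intro sum_list_mono power_mono) auto
  ultimately show ?thesis using b by (simp add: sum_list_triv)
qed

section \<open>Deviation of the gossip powers from exact averaging\<close>

locale gossip_matrix =
  fixes M :: nat and U :: "real mat"
  assumes M: "1 \<le> M" and ds: "doubly_stochastic M U" and sym: "U\<^sup>T = U"
    and sigma: "0 \<le> second_abs_eigenvalue U" "second_abs_eigenvalue U < 1"
begin

definition dev :: "nat \<Rightarrow> nat \<Rightarrow> nat \<Rightarrow> real" where
  "dev t i j = (U ^\<^sub>m t) $$ (i, j) - 1 / real M"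

lemma U_carrier: "U \<in> carrier_mat M M"
  and U_nonneg: "i < M \<Longrightarrow> j < M \<Longrightarrow> 0 \<le> U $$ (i, j)"
  and U_row: "i < M \<Longrightarrow> (\<Sum>j<M. U $$ (i, j)) = 1"
  and U_col: "j < M \<Longrightarrow> (\<Sum>i<M. U $$ (i, j)) = 1"
  using ds by (auto simp: doubly_stochastic_def)

lemma pow_carrier: "U ^\<^sub>m t \<in> carrier_mat M M"
  using U_carrier by simp

lemma U_sym: "i < M \<Longrightarrow> j < M \<Longrightarrow> U $$ (i, j) = U $$ (j, i)"
  using U_carrier sym by (metis carrier_matD index_transpose_mat(1))

lemma pow_Suc_index: "i < M \<Longrightarrow> j < M \<Longrightarrow>
  (U ^\<^sub>m Suc t) $$ (i, j) = (\<Sum>l<M. (U ^\<^sub>m t) $$ (i, l) * U $$ (l, j))"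
  using mult_mat_index[OF pow_carrier U_carrier] by simp

lemma pow_nonneg: "i < M \<Longrightarrow> j < M \<Longrightarrow> 0 \<le> (U ^\<^sub>m t) $$ (i, j)"
proof (induction t arbitrary: j)
  case 0
  then show ?case using U_carrier by simp
next
  case (Suc t)
  then show ?case unfolding pow_Suc_index[OF Suc.prems] by (intro sum_nonneg mult_nonneg_nonneg U_nonneg) auto
qed

lemma pow_row: "i < M \<Longrightarrow> (\<Sum>j<M. (U ^\<^sub>m t) $$ (i, j)) = 1"
proof (induction t)
  case 0
  have "(\<Sum>j<M. (U ^\<^sub>m 0) $$ (i, j)) = (\<Sum>j<M. if j = i then 1 else 0)"
    using U_carrier 0 by (intro sum.cong) auto
  then show ?case using 0 by simp
next
  case (Suc t)
  have "(\<Sum>j<M. (U ^\<^sub>m Suc t) $$ (i, j)) = (\<Sum>j<M. \<Sum>l<M. (U ^\<^sub>m t) $$ (i, l) * U $$ (l, j))"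
    using Suc.prems by (intro sum.cong refl) (simp add: pow_Suc_index del: pow_mat.simps)
  also have "\<dots> = (\<Sum>l<M. (U ^\<^sub>m t) $$ (i, l) * (\<Sum>j<M. U $$ (l, j)))"
    by (subst sum.swap) (simp add: sum_distrib_left)
  also have "\<dots> = 1" using Suc by (simp add: U_row)
  finally show ?case .
qed

lemma pow_sym: "i < M \<Longrightarrow> j < M \<Longrightarrow> (U ^\<^sub>m t) $$ (i, j) = (U ^\<^sub>m t) $$ (j, i)"
proof (induction t arbitrary: i j)
  case 0
  then show ?case using U_carrier by auto
next
  case (Suc t)
  have "(U ^\<^sub>m Suc t) $$ (j, i) = (U ^\<^sub>m (1 + t)) $$ (j, i)" by simp
  also have "\<dots> = (\<Sum>l<M. U $$ (j, l) * (U ^\<^sub>m t) $$ (l, i))"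
    using mat_pow_add_index[OF U_carrier, of j i 1 t] Suc.prems U_carrier by simp
  also have "\<dots> = (\<Sum>l<M. (U ^\<^sub>m t) $$ (i, l) * U $$ (l, j))"
    using Suc by (intro sum.cong refl) (auto simp: U_sym[of j] mult.commute)
  finally show ?case using pow_Suc_index[OF Suc.prems] by simp
qed

lemma pow_col: "j < M \<Longrightarrow> (\<Sum>i<M. (U ^\<^sub>m t) $$ (i, j)) = 1"
  using pow_row[of j t] pow_sym[of _ j t] by simp

lemma dev_sym: "i < M \<Longrightarrow> j < M \<Longrightarrow> dev t i j = dev t j i"
  by (simp add: dev_def pow_sym[of i j])

lemma dev_1: "j < M \<Longrightarrow> m < M \<Longrightarrow> dev 1 j m = U $$ (j, m) - 1 / real M"
  using U_carrier by (simp add: dev_def)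

text \<open>The averaging matrix absorbs every power of \<open>U\<close> from both sides and is
  idempotent, so subtracting it is compatible with multiplying powers.\<close>

lemma dev_add:
  assumes "i < M" "j < M"
  shows "dev (s + t) i j = (\<Sum>l<M. dev s i l * dev t l j)"
proof -
  have "(\<Sum>l<M. dev s i l * dev t l j) = (\<Sum>l<M. (U ^\<^sub>m s) $$ (i, l) * (U ^\<^sub>m t) $$ (l, j))
     - (\<Sum>l<M. (U ^\<^sub>m s) $$ (i, l)) / M - (\<Sum>l<M. (U ^\<^sub>m t) $$ (l, j)) / M + 1 / M"
    using M by (simp add: dev_def algebra_simps sum.distrib sum_subtractf sum_divide_distrib)
  then show ?thesis using assms M
    by (simp add: pow_row pow_col mat_pow_add_index[OF U_carrier assms] dev_def)
qed

lemma dev_Suc: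
  assumes "i < M" "j < M"
  shows "dev (Suc t) i j = (\<Sum>l<M. dev t i l * U $$ (l, j))"
proof -
  have "(\<Sum>l<M. dev t i l * U $$ (l, j)) = (\<Sum>l<M. (U ^\<^sub>m t) $$ (i, l) * U $$ (l, j)) - (\<Sum>l<M. U $$ (l, j)) / M"
    by (simp add: dev_def algebra_simps sum_subtractf sum_divide_distrib)
  then show ?thesis using assms U_col pow_Suc_index[OF assms] by (simp add: dev_def)
qed

lemma eigenvalue_1: "eigenvalue U 1"
proof -
  have "U *\<^sub>v vec M (\<lambda>_. 1) = vec M (\<lambda>_. 1)"
    using U_carrier U_row by (intro eq_vecI) (auto simp: scalar_prod_def lessThan_atLeast0)
  moreover have "vec M (\<lambda>_. 1 :: real) \<noteq> 0\<^sub>v M"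
    using M by (auto dest!: arg_cong[where f = "\<lambda>v. v $ 0"])
  ultimately show ?thesis unfolding eigenvalue_def eigenvector_def using U_carrier
    by (intro exI[of _ "vec M (\<lambda>_. 1)"]) auto
qed

text \<open>Even powers replace eigenvalues by their absolute values, by which
  \<open>second_abs_eigenvalue\<close> orders them. The summand 1 belongs to the eigenvalue 1 of the
  all-ones vector.\<close>

lemma mat_tr_even_pow_le: "mat_tr (U ^\<^sub>m (2 * t)) \<le> 1 + (real M - 1) * second_abs_eigenvalue U ^ (2 * t)"
proof -
  obtain rs where rs: "char_poly U = (\<Prod>r\<leftarrow>rs. [:- r, 1:])" "length rs = M"
    using symmetric_char_poly_splits[OF U_carrier sym] .
  define as where "as = rev (sorted_list_of_multiset (image_mset abs (mset rs)))"
  have ms: "mset as = image_mset abs (mset rs)" by (simp add: as_def)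
  have len: "length as = M" using ms rs(2) by (metis size_image_mset size_mset)
  have "1 \<in> set rs"
    using eigenvalue_1 unfolding eigenvalue_root_char_poly[OF U_carrier] rs(1)
    by (auto simp: poly_prod_list prod_list_zero_iff)
  then have 1: "1 \<in> set as" using ms by (metis abs_one image_eqI set_image_mset set_mset_mset)
  have nonneg: "0 \<le> a" if "a \<in> set as" for a
    using that ms by (metis abs_ge_zero imageE set_image_mset set_mset_mset)
  have s: "second_abs_eigenvalue U = (if 2 \<le> length as then as ! 1 else 0)"
    unfolding second_abs_eigenvalue_def rs(1) proots_prod_linear as_def Let_def ..
  have "mat_tr (U ^\<^sub>m (2 * t)) = (\<Sum>e\<leftarrow>rs. e ^ (2 * t))"
    by (rule mat_tr_pow_eq_sum_roots[OF U_carrier rs(1)])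
  also have "\<dots> = (\<Sum>e\<leftarrow>rs. \<bar>e\<bar> ^ (2 * t))" by (simp add: power_mult)
  also have "\<dots> = sum_mset (image_mset (\<lambda>a. a ^ (2 * t)) (image_mset abs (mset rs)))"
    by (simp add: sum_mset_sum_list[symmetric] o_def image_mset.compositionality)
  also have "\<dots> = (\<Sum>a\<leftarrow>as. a ^ (2 * t))" unfolding ms[symmetric]
    by (simp add: sum_mset_sum_list[symmetric])
  also have "\<dots> \<le> 1 + (real (length as) - 1) * second_abs_eigenvalue U ^ (2 * t)"
    by (intro sum_list_pow_le_second 1 nonneg s sigma) (simp_all add: as_def)
  finally show ?thesis by (simp add: len)
qed

text \<open>Symmetry and \<open>dev_add\<close> turn the sum of squares into the trace of the
  deviation at time \<open>2 * t\<close>; removing the averaging matrix lowers the trace of the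
  power by exactly 1.\<close>

lemma dev_frobenius: "(\<Sum>i<M. \<Sum>j<M. (dev t i j)\<^sup>2) \<le> (real M - 1) * second_abs_eigenvalue U ^ (2 * t)"
proof -
  have "(\<Sum>i<M. \<Sum>j<M. (dev t i j)\<^sup>2) = (\<Sum>i<M. dev (t + t) i i)"
    by (intro sum.cong refl) (auto simp: dev_add power2_eq_square dev_sym intro!: sum.cong)
  also have "\<dots> = mat_tr (U ^\<^sub>m (2 * t)) - 1"
    using M pow_carrier[of "2 * t"] by (simp add: dev_def sum_subtractf mat_tr_def mult_2 del: pow_mat_dim_square pow_mat_dim)
  finally show ?thesis using mat_tr_even_pow_le[of t] by simp
qed

lemma dev_row_le_2: "i < M \<Longrightarrow> (\<Sum>j<M. \<bar>dev t i j\<bar>) \<le> 2"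
proof -
  assume i: "i < M"
  have "(\<Sum>j<M. \<bar>dev t i j\<bar>) \<le> (\<Sum>j<M. (U ^\<^sub>m t) $$ (i, j) + 1 / M)"
    using i pow_nonneg[of i _ t] by (intro sum_mono) (auto simp: dev_def intro!: order_trans[OF abs_triangle_ineq4])
  also have "\<dots> = 2" using i M by (simp add: sum.distrib pow_row)
  finally show ?thesis .
qed

text \<open>Under the square, Cauchy-Schwarz in the row costs one factor \<open>M\<close> and the
  Frobenius bound the other.\<close>

lemma dev_row_le_pow: "i < M \<Longrightarrow> (\<Sum>j<M. \<bar>dev t i j\<bar>) \<le> real M * second_abs_eigenvalue U ^ t"
proof -
  assume i: "i < M"
  have "(\<Sum>j<M. \<bar>dev t i j\<bar>)\<^sup>2 \<le> real M * (\<Sum>j<M. (dev t i j)\<^sup>2)"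
    using Cauchy_Schwarz_ineq_sum[of "\<lambda>_. 1" "\<lambda>j. \<bar>dev t i j\<bar>" "{..<M}"] by simp
  also have "\<dots> \<le> real M * (\<Sum>i<M. \<Sum>j<M. (dev t i j)\<^sup>2)"
    using i by (intro mult_left_mono member_le_sum[of i "{..<M}" "\<lambda>i. \<Sum>j<M. (dev t i j)\<^sup>2"] sum_nonneg) auto
  also have "\<dots> \<le> real M * ((real M - 1) * second_abs_eigenvalue U ^ (2 * t))"
    by (intro mult_left_mono dev_frobenius) auto
  also have "\<dots> \<le> real M * (real M * second_abs_eigenvalue U ^ (2 * t))"
    using sigma by (intro mult_left_mono mult_right_mono) auto
  also have "\<dots> = (real M * second_abs_eigenvalue U ^ t)\<^sup>2"
    by (simp add: power_mult_distrib power2_eq_square power_mult mult_2 power_add)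
  finally show ?thesis by (rule power2_le_imp_le) (use sigma in auto)
qed

lemma mixing_time_ge_1: "1 \<le> mixing_time M U"
  by (simp add: mixing_time_def)

text \<open>For a second eigenvalue \<open>s > 0\<close>, twice the mixing time is at least
  \<open>ln (4 * M) / ln (1 / s)\<close>, so after \<open>mix\<close> rounds
  \<open>M * s ^ mix\<close> is at most 1/4. Rounding up stays within three mixing times, as a
  mixing time is at least 1.\<close>

definition mix :: nat where "mix = nat \<lceil>2 * mixing_time M U\<rceil>"

lemma mix_bounds: "2 * mixing_time M U \<le> real mix" "real mix \<le> 3 * mixing_time M U" "0 < mix"
proof -
  show "2 * mixing_time M U \<le> real mix" unfolding mix_def by linarith
  then show "0 < mix" using mixing_time_ge_1 by linarith
  have "real mix < 2 * mixing_time M U + 1" unfolding mix_def using mixing_time_ge_1 by linarith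
  then show "real mix \<le> 3 * mixing_time M U" using mixing_time_ge_1 by linarith
qed

lemma dev_mix: assumes i: "i < M" shows "(\<Sum>j<M. \<bar>dev mix i j\<bar>) \<le> 1 / 4"
proof (cases "second_abs_eigenvalue U = 0")
  case True
  \<comment> \<open>A zero eigenvalue uses \<open>0 < mix\<close>, which makes
    \<open>0 ^ mix\<close> vanish.\<close>
  then show ?thesis using dev_row_le_pow[OF i, of mix] mix_bounds by (simp add: zero_power)
next
  case False
  define s where "s = second_abs_eigenvalue U"
  have s: "0 < s" "s < 1" using False sigma by (auto simp: s_def)
  have l: "0 < ln (1 / s)" using s by simp
  have "ln (4 * real M) / (2 * ln (1 / s)) \<le> mixing_time M U"
    by (simp add: mixing_time_def s_def)
  then have "ln (4 * real M) \<le> 2 * mixing_time M U * ln (1 / s)"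
    using l by (simp add: field_simps)
  also have "\<dots> \<le> real mix * ln (1 / s)" using l mix_bounds(1) by (intro mult_right_mono) auto
  also have "\<dots> = ln ((1 / s) ^ mix)" using s by (simp add: ln_realpow)
  finally have "4 * real M \<le> (1 / s) ^ mix" using s M by simp
  then have "real M * s ^ mix \<le> 1 / 4" using s by (simp add: field_simps power_one_over)
  then show ?thesis using dev_row_le_pow[OF i, of mix] by (simp add: s_def)
qed

text \<open>Row sums of absolute values are submultiplicative, so each further block of
  \<open>mix\<close> rounds contributes a factor 1/4; the remainder \<open>t\<close> costs the
  trivial bound 2.\<close>

lemma dev_row_mult_mix: "i < M \<Longrightarrow> (\<Sum>j<M. \<bar>dev (t + k * mix) i j\<bar>) \<le> 2 * (1 / 4) ^ k"
proof (induction k)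
  case 0
  then show ?case using dev_row_le_2[of i t] by simp
next
  case (Suc k)
  have "(\<Sum>j<M. \<bar>dev (t + Suc k * mix) i j\<bar>) = (\<Sum>j<M. \<bar>\<Sum>l<M. dev (t + k * mix) i l * dev mix l j\<bar>)"
    using Suc.prems dev_add[of i _ "t + k * mix" mix] by (simp add: algebra_simps)
  also have "\<dots> \<le> (\<Sum>j<M. \<Sum>l<M. \<bar>dev (t + k * mix) i l\<bar> * \<bar>dev mix l j\<bar>)"
    by (intro sum_mono order_trans[OF sum_abs]) (simp add: abs_mult)
  also have "\<dots> = (\<Sum>l<M. \<bar>dev (t + k * mix) i l\<bar> * (\<Sum>j<M. \<bar>dev mix l j\<bar>))"
    by (subst sum.swap) (simp add: sum_distrib_left)
  also have "\<dots> \<le> (\<Sum>l<M. \<bar>dev (t + k * mix) i l\<bar> * (1 / 4))"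
    by (intro sum_mono mult_left_mono dev_mix) auto
  also have "\<dots> \<le> 2 * (1 / 4) ^ Suc k" using Suc by (simp add: sum_divide_distrib[symmetric])
  finally show ?case .
qed

definition rate :: "nat \<Rightarrow> real" where "rate t = 2 * (1 / 4) ^ (t div mix)"

lemma rate_nonneg: "0 \<le> rate t" by (simp add: rate_def)

lemma dev_row_le_rate: "i < M \<Longrightarrow> (\<Sum>j<M. \<bar>dev t i j\<bar>) \<le> rate t"
  using dev_row_mult_mix[of i "t mod mix" "t div mix"] by (simp only: rate_def mod_div_mult_eq)

lemma dev_col_le_rate: "j < M \<Longrightarrow> (\<Sum>i<M. \<bar>dev t i j\<bar>) \<le> rate t"
  using dev_row_le_rate[of j t] by (simp add: dev_sym[of _ j])

text \<open>On each block of \<open>mix\<close> rounds the rate is constant. The geometric series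
  with ratio 1/4 has the sum 4/3, rounded up to 3/2; with the factor 2 of \<open>rate\<close> and at
  most three mixing times per block this makes 9.\<close>

lemma sum_rate_le: "(\<Sum>t<T. rate t) \<le> 9 * mixing_time M U"
proof -
  have "(\<Sum>t<T. rate t) \<le> (\<Sum>t<T * mix. rate t)"
    using mix_bounds rate_nonneg by (intro sum_mono2) auto
  also have "\<dots> = (\<Sum>k<T. \<Sum>t\<in>{k * mix..<k * mix + mix}. rate t)"
    by (simp add: sum.nat_group)
  also have "\<dots> = (\<Sum>k<T. real mix * (2 * (1 / 4) ^ k))"
  proof (intro sum.cong refl)
    fix k
    have "(\<Sum>t\<in>{k * mix..<k * mix + mix}. rate t) = (\<Sum>t\<in>{k * mix..<k * mix + mix}. 2 * (1 / 4) ^ k)"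
    proof (intro sum.cong refl)
      fix t assume "t \<in> {k * mix..<k * mix + mix}"
      then have "t div mix = k" by (intro div_nat_eqI) (auto simp: mult.commute)
      then show "rate t = 2 * (1 / 4) ^ k" by (simp add: rate_def)
    qed
    then show "(\<Sum>t\<in>{k * mix..<k * mix + mix}. rate t) = real mix * (2 * (1 / 4) ^ k)" by simp
  qed
  also have "\<dots> = real mix * 2 * (\<Sum>k<T. (1 / 4) ^ k)" by (simp add: sum_distrib_left mult.assoc)
  also have "\<dots> \<le> real mix * 2 * (3 / 2)"
  proof (intro mult_left_mono)
    have "(\<Sum>k<T. (1 / 4 :: real) ^ k) = (1 - (1 / 4) ^ T) / (3 / 4)" by (simp add: sum_gp_strict)
    also have "\<dots> \<le> 3 / 2" using zero_le_power[of "1 / 4 :: real" T] by (simp del: zero_le_power)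
    finally show "(\<Sum>k<T. (1 / 4 :: real) ^ k) \<le> 3 / 2" .
  qed simp
  finally show ?thesis using mix_bounds(2) by simp
qed

end

section \<open>Pathwise analysis\<close>

text \<open>\<open>mgrad\<close> and \<open>mconj\<close> are gradient and value of the conjugate
  mirror map. With the conjugate exponent in place of \<open>p\<close> the same formulas give the
  mirror map itself and its gradient.\<close>

definition mgrad :: "nat \<Rightarrow> real \<Rightarrow> (nat \<Rightarrow> real) \<Rightarrow> nat \<Rightarrow> real" where
  "mgrad d p z i = dualv d p z i / (p - 1)"

definition mconj :: "nat \<Rightarrow> real \<Rightarrow> (nat \<Rightarrow> real) \<Rightarrow> real" where
  "mconj d p z = (nrm d p z)\<^sup>2 / (2 * (p - 1))"

lemma mgrad_scale: "mgrad d p z = (\<lambda>i. 1 / (p - 1) * dualv d p z i)"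
  by (simp add: mgrad_def fun_eq_iff)

lemma mconj_smooth:
  assumes "2 < p"
  shows "mconj d p (\<lambda>i. z i + v i) \<le> mconj d p z + ip d (mgrad d p z) v + (nrm d p v)\<^sup>2 / 2"
proof -
  have "mconj d p (\<lambda>i. z i + v i) \<le>
      ((nrm d p z)\<^sup>2 + 2 * ip d (dualv d p z) v + (p - 1) * (nrm d p v)\<^sup>2) / (2 * (p - 1))"
    unfolding mconj_def using nrm_sq_smooth[OF assms, of d z v] assms by (intro divide_right_mono) auto
  also have "\<dots> = mconj d p z + ip d (mgrad d p z) v + (nrm d p v)\<^sup>2 / 2"
    unfolding mconj_def mgrad_scale ip_scale_left using assms by (simp add: divide_simps) (simp add: algebra_simps)
  finally show ?thesis .
qed

lemma mgrad_nonexpansive: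
  assumes "2 < p" "conjugate_exponents p q"
  shows "nrm d q (\<lambda>i. mgrad d p z i - mgrad d p y i) \<le> nrm d p (\<lambda>i. z i - y i)"
proof -
  have q: "0 < q" using assms by (simp add: conjugate_exponents_def)
  have "(\<lambda>i. mgrad d p z i - mgrad d p y i) = (\<lambda>i. 1 / (p - 1) * (dualv d p z i - dualv d p y i))"
    by (simp add: mgrad_def diff_divide_distrib)
  then have "nrm d q (\<lambda>i. mgrad d p z i - mgrad d p y i)
      = 1 / (p - 1) * nrm d q (\<lambda>i. dualv d p z i - dualv d p y i)"
    using nrm_scale[OF q, of d "1 / (p - 1)" "\<lambda>i. dualv d p z i - dualv d p y i"] assms by simp
  then show ?thesis using nrm_dualv_diff_le[OF assms, of d z y] assms
    by (simp add: pos_divide_le_eq mult.commute)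
qed

text \<open>The gap is a completed square plus the defect in Hoelder's inequality; the prefactors
  match because \<open>1 / (q - 1) = p - 1\<close>.\<close>

lemma fenchel_young:
  assumes "conjugate_exponents p q"
  shows "ip d z w \<le> mconj d p z + (nrm d q w)\<^sup>2 / (2 * (q - 1))"
proof -
  have pq: "1 < p" "(p - 1) * (q - 1) = 1"
    using assms conjugate_exponents_mult by (auto simp: conjugate_exponents_def)
  then have q: "1 / (q - 1) = p - 1" using assms by (auto simp: conjugate_exponents_def divide_simps)
  have "0 \<le> (nrm d p z - (p - 1) * nrm d q w)\<^sup>2 / (2 * (p - 1))" using pq by simp
  also have "\<dots> = mconj d p z + (p - 1) * (nrm d q w)\<^sup>2 / 2 - nrm d p z * nrm d q w"
    using pq(1) by (simp add: mconj_def divide_simps) (simp add: power2_eq_square algebra_simps)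
  also have "(p - 1) * (nrm d q w)\<^sup>2 / 2 = (nrm d q w)\<^sup>2 / (2 * (q - 1))"
    unfolding q[symmetric] by simp
  finally show ?thesis using ip_le_nrm[OF assms, of d z w] by simp
qed

section \<open>Convexity and smoothness inequalities for the clients\<close>

locale smooth_clients =
  fixes d M :: nat and p q B :: real
    and f :: "nat \<Rightarrow> (nat \<Rightarrow> real) \<Rightarrow> real" and G :: "nat \<Rightarrow> (nat \<Rightarrow> real) \<Rightarrow> nat \<Rightarrow> real"
    and ws :: "nat \<Rightarrow> real"
  assumes M: "1 \<le> M" and p: "2 < p" and pq: "conjugate_exponents p q" and B: "0 < B"
    and convex: "\<And>m x y. m < M \<Longrightarrow> f m x + ip d (G m x) (\<lambda>i. y i - x i) \<le> f m y"
    and lipschitz: "\<And>m x y. m < M \<Longrightarrow>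
      nrm d p (\<lambda>i. G m x i - G m y i) \<le> B * nrm d q (\<lambda>i. x i - y i)"
    and stationary: "\<And>i. (\<Sum>m<M. G m ws i) = 0"
begin

abbreviation "nd \<equiv> nrm d p"
abbreviation "np \<equiv> nrm d q"
abbreviation "hg \<equiv> mgrad d p"

definition av :: "(nat \<Rightarrow> real) \<Rightarrow> real" where "av g = (\<Sum>m<M. g m) / real M"

lemma av_mono: "(\<And>m. m < M \<Longrightarrow> g m \<le> h m) \<Longrightarrow> av g \<le> av h"
  unfolding av_def by (intro divide_right_mono sum_mono) auto

lemma av_cong: "(\<And>m. m < M \<Longrightarrow> g m = h m) \<Longrightarrow> av g = av h"
  unfolding av_def by (intro arg_cong2[where f="(/)"] sum.cong) auto

lemma av_add: "av (\<lambda>m. g m + h m) = av g + av h"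
  by (simp add: av_def sum.distrib add_divide_distrib)

lemma av_diff: "av (\<lambda>m. g m - h m) = av g - av h"
  by (simp add: av_def sum_subtractf diff_divide_distrib)

lemma av_scale: "av (\<lambda>m. c * g m) = c * av g"
  by (simp add: av_def sum_distrib_left)

lemma av_const: "av (\<lambda>m. c) = c"
  using M by (simp add: av_def)

lemma av_sum: "av (\<lambda>m. \<Sum>k\<in>A. g k m) = (\<Sum>k\<in>A. av (g k))"
  unfolding av_def by (subst sum.swap) (simp add: sum_divide_distrib)

lemma av_nonneg: "(\<And>m. m < M \<Longrightarrow> 0 \<le> g m) \<Longrightarrow> 0 \<le> av g"
  unfolding av_def by (intro divide_nonneg_nonneg sum_nonneg) auto

lemma ip_av_left: "ip d (\<lambda>i. av (\<lambda>m. g m i)) x = av (\<lambda>m. ip d (g m) x)"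
proof -
  have "(\<lambda>i. av (\<lambda>m. g m i)) = (\<lambda>i. 1 / real M * (\<Sum>m<M. g m i))" by (simp add: av_def)
  then show ?thesis by (simp only: ip_scale_left ip_sum_left) (simp add: av_def)
qed

lemma ip_av_right: "ip d x (\<lambda>i. av (\<lambda>m. g m i)) = av (\<lambda>m. ip d x (g m))"
  using ip_av_left[of g x] by (simp add: ip_commute[of d x])

lemma nd_sq_av_le: "(nd (\<lambda>i. av (\<lambda>m. x m i)))\<^sup>2 \<le> av (\<lambda>m. (nd (x m))\<^sup>2)"
proof -
  have "(nd (\<lambda>i. \<Sum>m<M. (1 / real M) * x m i))\<^sup>2 \<le>
      (\<Sum>m<M. \<bar>1 / real M\<bar>) * (\<Sum>m<M. \<bar>1 / real M\<bar> * (nd (x m))\<^sup>2)"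
    by (rule nrm_sq_weighted_sum_le[OF pq])
  then show ?thesis using M by (simp add: av_def sum_divide_distrib)
qed

definition fbar :: "(nat \<Rightarrow> real) \<Rightarrow> real" where "fbar x = av (\<lambda>m. f m x)"

lemma qp: "conjugate_exponents q p"
  using pq by (rule conjugate_exponents_sym)

text \<open>Convexity at \<open>y\<close> and the Lipschitz bound replace integration along the
  segment. The quadratic term carries \<open>B\<close> where integration would give
  \<open>B / 2\<close>, which explains the 4 in \<open>cocoercive\<close>.\<close>

lemma upper: assumes m: "m < M"
  shows "f m y \<le> f m x + ip d (G m x) (\<lambda>i. y i - x i) + B * (np (\<lambda>i. y i - x i))\<^sup>2"
proof -
  have "f m y + ip d (G m y) (\<lambda>i. x i - y i) \<le> f m x" by (rule convex[OF m])
  moreover have "ip d (\<lambda>i. G m y i - G m x i) (\<lambda>i. y i - x i) \<le> B * (np (\<lambda>i. y i - x i))\<^sup>2"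
  proof -
    have "ip d (\<lambda>i. G m y i - G m x i) (\<lambda>i. y i - x i)
        \<le> nd (\<lambda>i. G m y i - G m x i) * np (\<lambda>i. y i - x i)" by (rule ip_le_nrm[OF pq])
    also have "\<dots> \<le> (B * np (\<lambda>i. y i - x i)) * np (\<lambda>i. y i - x i)"
      by (intro mult_right_mono lipschitz m) auto
    finally show ?thesis by (simp add: power2_eq_square mult_ac)
  qed
  ultimately show ?thesis by (simp add: ip_diff_left ip_diff_right)
qed

lemma cocoercive: assumes m: "m < M"
  shows "(nd (\<lambda>i. G m y i - G m x i))\<^sup>2 \<le> 4 * B * (f m y - f m x - ip d (G m x) (\<lambda>i. y i - x i))"
proof -
  define D where "D = (\<lambda>i. G m y i - G m x i)"
  \<comment> \<open>This shift minimises \<open>ip d D s + B * (np s)\<^sup>2\<close>; the minimum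
    is \<open>- (nd D)\<^sup>2 / (4 * B)\<close>.\<close>
  define s where "s = (\<lambda>i. - 1 / (2 * B) * dualv d p D i)"
  have p1: "1 < p" using p by simp
  have s1: "ip d D s = - (nd D)\<^sup>2 / (2 * B)"
    unfolding s_def ip_scale_right using p1 by (simp add: ip_commute[of d D] ip_dualv)
  have "np s = \<bar>- 1 / (2 * B)\<bar> * np (dualv d p D)"
    unfolding s_def using qp by (intro nrm_scale) (simp add: conjugate_exponents_def)
  then have s2: "np s = nd D / (2 * B)" using B by (simp add: nrm_dualv[OF pq])
  have "f m x + ip d (G m x) (\<lambda>i. (y i + s i) - x i) \<le> f m (\<lambda>i. y i + s i)"
    by (rule convex[OF m])
  also have "\<dots> \<le> f m y + ip d (G m y) (\<lambda>i. (y i + s i) - y i) + B * (np (\<lambda>i. (y i + s i) - y i))\<^sup>2"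
    by (rule upper[OF m])
  finally have "f m x + ip d (G m x) (\<lambda>i. y i - x i) \<le> f m y + ip d D s + B * (np s)\<^sup>2"
    unfolding D_def ip_diff_left ip_diff_right ip_add_right by simp
  also have "\<dots> = f m y - (nd D)\<^sup>2 / (4 * B)"
    unfolding s1 s2 using B by (simp add: power2_eq_square field_simps)
  finally have "(nd D)\<^sup>2 / (4 * B) \<le> f m y - f m x - ip d (G m x) (\<lambda>i. y i - x i)" by simp
  then show ?thesis unfolding D_def using B by (simp add: pos_divide_le_eq mult.commute)
qed

text \<open>The pairing is split at \<open>x\<close>: \<open>upper\<close> controls the part towards
  \<open>y\<close>, and \<open>cocoercive\<close> the part towards \<open>ws\<close>, where its
  squared deviation is kept instead of being discarded.\<close>

lemma three_point: assumes m: "m < M"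
  shows "f m y - f m ws - B * (np (\<lambda>i. y i - x i))\<^sup>2 + (nd (\<lambda>i. G m x i - G m ws i))\<^sup>2 / (4 * B)
     \<le> ip d (G m x) (\<lambda>i. y i - ws i)"
proof -
  have "(nd (\<lambda>i. G m ws i - G m x i))\<^sup>2 / (4 * B) \<le> f m ws - f m x - ip d (G m x) (\<lambda>i. ws i - x i)"
    using cocoercive[OF m, of ws x] B by (simp add: pos_divide_le_eq mult.commute)
  moreover note upper[OF m, of y x]
  ultimately show ?thesis using nrm_diff_commute[of d p "G m ws"] by (simp add: ip_diff_right)
qed

text \<open>Averaging inside the norm lets stationarity cancel the individual gradients at
  \<open>ws\<close>, so heterogeneity does not enter.\<close>

lemma fbar_cocoercive:
  "(nd (\<lambda>i. av (\<lambda>m. G m y i)))\<^sup>2 \<le> 4 * B * (fbar y - fbar ws)"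
proof -
  have zero: "av (\<lambda>m. G m ws i) = 0" for i using stationary by (simp add: av_def)
  have "(nd (\<lambda>i. av (\<lambda>m. G m y i - G m ws i)))\<^sup>2 \<le> av (\<lambda>m. (nd (\<lambda>i. G m y i - G m ws i))\<^sup>2)"
    by (rule nd_sq_av_le)
  also have "\<dots> \<le> av (\<lambda>m. 4 * B * (f m y - f m ws - ip d (G m ws) (\<lambda>i. y i - ws i)))"
    by (intro av_mono cocoercive)
  also have "\<dots> = 4 * B * (fbar y - fbar ws - ip d (\<lambda>i. av (\<lambda>m. G m ws i)) (\<lambda>i. y i - ws i))"
    by (simp only: av_scale av_diff fbar_def ip_av_left)
  finally show ?thesis by (simp add: av_diff zero ip_def)
qed

lemma fbar_upper:
  "fbar y \<le> fbar x + ip d (\<lambda>i. av (\<lambda>m. G m x i)) (\<lambda>i. y i - x i) + B * (np (\<lambda>i. y i - x i))\<^sup>2"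
proof -
  have "fbar y \<le> av (\<lambda>m. f m x + ip d (G m x) (\<lambda>i. y i - x i) + B * (np (\<lambda>i. y i - x i))\<^sup>2)"
    unfolding fbar_def by (intro av_mono upper)
  then show ?thesis by (simp only: av_add av_const fbar_def ip_av_left)
qed

text \<open>Moves a suboptimality bound to a nearby point without a bound on gradients: Young's
  inequality splits the linear term, and its gradient half is at most the gap at
  \<open>x\<close>.\<close>

lemma fbar_change_point:
  "fbar y - fbar ws \<le> 2 * (fbar x - fbar ws) + 2 * B * (np (\<lambda>i. y i - x i))\<^sup>2"
proof -
  let ?g = "nd (\<lambda>i. av (\<lambda>m. G m x i))" and ?n = "np (\<lambda>i. y i - x i)"
  have "ip d (\<lambda>i. av (\<lambda>m. G m x i)) (\<lambda>i. y i - x i) \<le> ?g * ?n" by (rule ip_le_nrm[OF pq])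
  also have "\<dots> \<le> ?g\<^sup>2 / (4 * B) + B * ?n\<^sup>2"
  proof -
    have "0 \<le> (?g - 2 * B * ?n)\<^sup>2 / (4 * B)" using B by simp
    also have "\<dots> = ?g\<^sup>2 / (4 * B) + B * ?n\<^sup>2 - ?g * ?n"
      using B by (simp add: power2_eq_square field_simps)
    finally show ?thesis by simp
  qed
  also have "?g\<^sup>2 / (4 * B) \<le> fbar x - fbar ws"
    using fbar_cocoercive[of x] B by (simp add: pos_divide_le_eq mult.commute)
  finally show ?thesis using fbar_upper[of y x] by simp
qed

text \<open>The Fenchel gap of \<open>z\<close> and \<open>ws\<close>, which is the Bregman
  divergence from \<open>ws\<close> to \<open>hg z\<close> written in dual variables, so that the
  mirror map need not be inverted.\<close>

definition potential :: "(nat \<Rightarrow> real) \<Rightarrow> real" where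
  "potential z = (np ws)\<^sup>2 / (2 * (q - 1)) + mconj d p z - ip d z ws"

lemma potential_nonneg: "0 \<le> potential z"
  using fenchel_young[OF pq, of d z ws] by (simp add: potential_def)

lemma potential_step:
  "potential (\<lambda>i. z i + v i) \<le> potential z + ip d (\<lambda>i. hg z i - ws i) v + (nd v)\<^sup>2 / 2"
  using mconj_smooth[OF p, of d z v]
  by (simp add: potential_def ip_diff_left ip_add_left ip_commute[of d v])

end

lemma (in smooth_clients) nd_sq_add3_le:
  "(nd (\<lambda>i. x i + y i + w i))\<^sup>2 \<le> 4 * ((nd x)\<^sup>2 + (nd y)\<^sup>2 + (nd w)\<^sup>2)"
proof -
  have "0 \<le> (nd w)\<^sup>2" by simp
  with nrm_sq_add_le[OF pq, of d "\<lambda>i. x i + y i" w] nrm_sq_add_le[OF pq, of d x y]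
  show ?thesis unfolding distrib_left by linarith
qed

lemma (in smooth_clients) nd_sq_add4_le:
  "(nd (\<lambda>i. x i + y i + w i + u i))\<^sup>2 \<le> 4 * ((nd x)\<^sup>2 + (nd y)\<^sup>2 + (nd w)\<^sup>2 + (nd u)\<^sup>2)"
  using nrm_sq_add_le[OF pq, of d "\<lambda>i. x i + y i" "\<lambda>i. w i + u i"] nrm_sq_add_le[OF pq, of d x y]
    nrm_sq_add_le[OF pq, of d w u] by (simp add: add.assoc)

lemma (in smooth_clients) nd_sq_scale: "(nd (\<lambda>i. c * x i))\<^sup>2 = c\<^sup>2 * (nd x)\<^sup>2"
  using p by (simp add: nrm_scale power_mult_distrib)

section \<open>One trajectory: local drift, gossip and potential\<close>

locale dfedda_path = smooth_clients d M p q B f G ws + gossip_matrix M U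
  for d M p q B f G ws U +
  fixes K R :: nat and \<eta> :: real
    and \<zeta> z :: "nat \<Rightarrow> nat \<Rightarrow> nat \<Rightarrow> nat \<Rightarrow> real" and z0 :: "nat \<Rightarrow> real"
  assumes K: "1 \<le> K" and eta: "0 < \<eta>"
    and small: "\<eta> * B * real K * (9 * mixing_time M U) \<le> 1 / 32"
    and start: "\<And>m. m < M \<Longrightarrow> z 0 0 m = z0"
    and step: "\<And>r k m. r < R \<Longrightarrow> k < K \<Longrightarrow> m < M \<Longrightarrow>
      z r (Suc k) m = (\<lambda>i. z r k m i - \<eta> * (G m (hg (z r k m)) i + \<zeta> r k m i))"
    and gossip_step: "\<And>r m. r < R \<Longrightarrow> m < M \<Longrightarrow>
      z (Suc r) 0 m = (\<lambda>i. \<Sum>j<M. U $$ (j, m) * z r K j i)"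
begin

definition "\<kappa> = 9 * mixing_time M U"
text \<open>A local gradient is this deviation plus the fixed vector \<open>G m ws\<close>; the
  latter averages to zero over the clients.\<close>

definition "\<delta> r k m = (\<lambda>i. G m (hg (z r k m)) i - G m ws i)"
definition "zb r = (\<lambda>i. av (\<lambda>m. z r 0 m i))"
definition "wb r = hg (zb r)"
text \<open>\<open>S\<close> is the quantity to be absorbed, \<open>E\<close> the heterogeneity,
  \<open>Nz\<close> measures accumulated noise, \<open>C\<close> is the consensus error at the start
  of a round, and \<open>I\<close> is the linear noise term whose expectation will vanish.\<close>

definition "S r = (\<Sum>k<K. av (\<lambda>m. (nd (\<delta> r k m))\<^sup>2))"
definition "E = av (\<lambda>m. (nd (G m ws))\<^sup>2)"
definition "Nz r k = av (\<lambda>m. (nd (\<lambda>i. \<Sum>l<k. \<zeta> r l m i))\<^sup>2)"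
definition "C r = av (\<lambda>m. (nd (\<lambda>i. z r 0 m i - zb r i))\<^sup>2)"
definition "I r = (\<Sum>k<K. av (\<lambda>m. ip d (\<lambda>i. wb r i - ws i) (\<zeta> r k m)))"

lemma kappa: "1 \<le> \<kappa>" "(\<Sum>t<T. rate t) \<le> \<kappa>" "\<eta> * B * real K * \<kappa> \<le> 1 / 32"
  using mixing_time_ge_1 sum_rate_le small by (auto simp: \<kappa>_def)

lemma S_nonneg: "0 \<le> S r" and E_nonneg: "0 \<le> E" and Nz_nonneg: "0 \<le> Nz r k"
  unfolding S_def E_def Nz_def by (auto intro!: sum_nonneg av_nonneg)

lemma local_drift:
  assumes "r < R" "m < M"
  shows "k \<le> K \<Longrightarrow> z r k m = (\<lambda>i. z r 0 m i - \<eta> * (\<Sum>l<k. \<delta> r l m i) - \<eta> * k * G m ws i - \<eta> * (\<Sum>l<k. \<zeta> r l m i))"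
proof (induction k)
  case (Suc k)
  then have "z r (Suc k) m = (\<lambda>i. z r k m i - \<eta> * (\<delta> r k m i + G m ws i + \<zeta> r k m i))"
    using assms by (simp add: step \<delta>_def)
  also have "z r k m = (\<lambda>i. z r 0 m i - \<eta> * (\<Sum>l<k. \<delta> r l m i) - \<eta> * k * G m ws i - \<eta> * (\<Sum>l<k. \<zeta> r l m i))"
    using Suc by simp
  finally show ?case by (simp add: fun_eq_iff algebra_simps)
qed simp

lemma av_gossip: "av (\<lambda>m. \<Sum>j<M. U $$ (j, m) * x j) = av x"
proof -
  have "(\<Sum>m<M. \<Sum>j<M. U $$ (j, m) * x j) = (\<Sum>j<M. (\<Sum>m<M. U $$ (j, m)) * x j)"
    by (subst sum.swap) (simp add: sum_distrib_right)
  then show ?thesis by (simp add: av_def U_row)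
qed

lemma av_G_ws: "av (\<lambda>m. G m ws i) = 0"
  using stationary by (simp add: av_def)

lemma zb_Suc:
  assumes "r < R"
  shows "zb (Suc r) = (\<lambda>i. zb r i - \<eta> * (\<Sum>k<K. av (\<lambda>m. \<delta> r k m i + \<zeta> r k m i)))"
proof
  fix i
  have "zb (Suc r) i = av (\<lambda>m. \<Sum>j<M. U $$ (j, m) * z r K j i)"
    unfolding zb_def using assms by (intro av_cong) (simp add: gossip_step)
  also have "\<dots> = av (\<lambda>m. z r 0 m i - \<eta> * (\<Sum>l<K. \<delta> r l m i) - \<eta> * K * G m ws i - \<eta> * (\<Sum>l<K. \<zeta> r l m i))"
    unfolding av_gossip using assms by (intro av_cong) (simp add: local_drift[of r _ K])
  also have "\<dots> = zb r i - \<eta> * (\<Sum>k<K. av (\<lambda>m. \<delta> r k m i + \<zeta> r k m i))"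
    unfolding av_diff av_scale av_G_ws av_sum zb_def av_add sum.distrib by (simp add: algebra_simps)
  finally show "zb (Suc r) i = zb r i - \<eta> * (\<Sum>k<K. av (\<lambda>m. \<delta> r k m i + \<zeta> r k m i))" .
qed

lemma nd_sq_sum_delta_le: "(nd (\<lambda>i. \<Sum>l<k. \<delta> r l m i))\<^sup>2 \<le> real K * (\<Sum>l<K. (nd (\<delta> r l m))\<^sup>2)" if "k \<le> K"
proof -
  have "(nd (\<lambda>i. \<Sum>l<k. \<delta> r l m i))\<^sup>2 \<le> real k * (\<Sum>l<k. (nd (\<delta> r l m))\<^sup>2)"
    using nrm_sq_sum_le[OF pq, of d "\<lambda>l. \<delta> r l m" "{..<k}"] by simp
  also have "\<dots> \<le> real K * (\<Sum>l<K. (nd (\<delta> r l m))\<^sup>2)"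
    using that by (intro mult_mono sum_mono2 sum_nonneg) auto
  finally show ?thesis .
qed

text \<open>Nonexpansiveness reduces primal drift to the distance of \<open>z r k m\<close> from
  \<open>zb r\<close>, which unrolls into consensus error, gradient deviation, heterogeneity and
  noise. The factor 4 is the price of squaring four summands.\<close>

lemma drift_le:
  assumes r: "r < R"
  shows "(\<Sum>k<K. av (\<lambda>m. (np (\<lambda>i. wb r i - hg (z r k m) i))\<^sup>2))
    \<le> 4 * K * C r + 4 * \<eta>\<^sup>2 * K\<^sup>2 * S r + 4 * \<eta>\<^sup>2 * K ^ 3 * E + 4 * \<eta>\<^sup>2 * (\<Sum>k<K. Nz r k)"
proof -
  have 1: "(np (\<lambda>i. wb r i - hg (z r k m) i))\<^sup>2 \<le>
    4 * ((nd (\<lambda>i. z r 0 m i - zb r i))\<^sup>2 + \<eta>\<^sup>2 * (K * (\<Sum>l<K. (nd (\<delta> r l m))\<^sup>2))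
       + \<eta>\<^sup>2 * K\<^sup>2 * (nd (G m ws))\<^sup>2 + \<eta>\<^sup>2 * (nd (\<lambda>i. \<Sum>l<k. \<zeta> r l m i))\<^sup>2)"
    if k: "k < K" and m: "m < M" for k m
  proof -
    have "np (\<lambda>i. wb r i - hg (z r k m) i) \<le> nd (\<lambda>i. zb r i - z r k m i)"
      unfolding wb_def by (rule mgrad_nonexpansive[OF p pq])
    then have "(np (\<lambda>i. wb r i - hg (z r k m) i))\<^sup>2 \<le> (nd (\<lambda>i. z r k m i - zb r i))\<^sup>2"
      by (intro power_mono) (auto simp: nrm_diff_commute[of d p "zb r"])
    also have "(\<lambda>i. z r k m i - zb r i) = (\<lambda>i. (z r 0 m i - zb r i) + (- \<eta>) * (\<Sum>l<k. \<delta> r l m i)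
         + (- \<eta> * k) * G m ws i + (- \<eta>) * (\<Sum>l<k. \<zeta> r l m i))"
      using k by (subst local_drift[OF r m]) (auto simp: algebra_simps)
    also have "(nd \<dots>)\<^sup>2 \<le> 4 * ((nd (\<lambda>i. z r 0 m i - zb r i))\<^sup>2 + (nd (\<lambda>i. (- \<eta>) * (\<Sum>l<k. \<delta> r l m i)))\<^sup>2
       + (nd (\<lambda>i. (- \<eta> * k) * G m ws i))\<^sup>2 + (nd (\<lambda>i. (- \<eta>) * (\<Sum>l<k. \<zeta> r l m i)))\<^sup>2)"
      by (rule nd_sq_add4_le)
    also have "\<dots> = 4 * ((nd (\<lambda>i. z r 0 m i - zb r i))\<^sup>2 + \<eta>\<^sup>2 * (nd (\<lambda>i. \<Sum>l<k. \<delta> r l m i))\<^sup>2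
       + \<eta>\<^sup>2 * k\<^sup>2 * (nd (G m ws))\<^sup>2 + \<eta>\<^sup>2 * (nd (\<lambda>i. \<Sum>l<k. \<zeta> r l m i))\<^sup>2)"
      unfolding nd_sq_scale by (simp add: power_mult_distrib)
    also have "\<dots> \<le> 4 * ((nd (\<lambda>i. z r 0 m i - zb r i))\<^sup>2 + \<eta>\<^sup>2 * (K * (\<Sum>l<K. (nd (\<delta> r l m))\<^sup>2))
       + \<eta>\<^sup>2 * K\<^sup>2 * (nd (G m ws))\<^sup>2 + \<eta>\<^sup>2 * (nd (\<lambda>i. \<Sum>l<k. \<zeta> r l m i))\<^sup>2)"
      using k by (intro mult_left_mono add_mono mult_right_mono nd_sq_sum_delta_le) auto
    finally show ?thesis .
  qed
  have "(\<Sum>k<K. av (\<lambda>m. (np (\<lambda>i. wb r i - hg (z r k m) i))\<^sup>2)) \<le>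
    (\<Sum>k<K. av (\<lambda>m. 4 * ((nd (\<lambda>i. z r 0 m i - zb r i))\<^sup>2 + \<eta>\<^sup>2 * (K * (\<Sum>l<K. (nd (\<delta> r l m))\<^sup>2))
       + \<eta>\<^sup>2 * K\<^sup>2 * (nd (G m ws))\<^sup>2 + \<eta>\<^sup>2 * (nd (\<lambda>i. \<Sum>l<k. \<zeta> r l m i))\<^sup>2)))"
    using 1 by (intro sum_mono av_mono) auto
  also have "\<dots> = (\<Sum>k<K. 4 * (C r + \<eta>\<^sup>2 * (K * S r) + \<eta>\<^sup>2 * K\<^sup>2 * E + \<eta>\<^sup>2 * Nz r k))"
    unfolding av_scale av_add av_sum C_def S_def E_def Nz_def ..
  also have "\<dots> = 4 * K * C r + 4 * \<eta>\<^sup>2 * K\<^sup>2 * S r + 4 * \<eta>\<^sup>2 * K ^ 3 * E + 4 * \<eta>\<^sup>2 * (\<Sum>k<K. Nz r k)"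
    by (simp add: sum.distrib sum_distrib_left[symmetric] algebra_simps power2_eq_square power3_eq_cube)
  finally show ?thesis .
qed

text \<open>A whole round is one mirror descent step of the averaged dual variable, with
  \<open>three_point\<close> applied at each local step. Its quadratic term is charged to
  \<open>S\<close> and \<open>Nz\<close> alone, since the averaged gradient at \<open>ws\<close>
  vanishes.\<close>

lemma potential_round:
  assumes r: "r < R"
  shows "potential (zb (Suc r)) \<le> potential (zb r) - \<eta> * K * (fbar (wb r) - fbar ws)
    + \<eta> * B * (\<Sum>k<K. av (\<lambda>m. (np (\<lambda>i. wb r i - hg (z r k m) i))\<^sup>2)) - \<eta> / (4 * B) * S r
    + \<eta>\<^sup>2 * (K * S r + Nz r K) - \<eta> * I r"
proof -
  define X where "X = (\<lambda>i. wb r i - ws i)"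
  define v where "v = (\<lambda>i. - \<eta> * (\<Sum>k<K. av (\<lambda>m. \<delta> r k m i + \<zeta> r k m i)))"
  have "potential (zb (Suc r)) \<le> potential (zb r) + ip d X v + (nd v)\<^sup>2 / 2"
    using potential_step[of "zb r" v] by (simp add: zb_Suc[OF r] v_def X_def wb_def)
  moreover have "ip d X v \<le> - \<eta> * (K * (fbar (wb r) - fbar ws)
      - B * (\<Sum>k<K. av (\<lambda>m. (np (\<lambda>i. wb r i - hg (z r k m) i))\<^sup>2)) + S r / (4 * B) + I r)"
  proof -
    have "ip d X v = - \<eta> * (\<Sum>k<K. av (\<lambda>m. ip d X (\<delta> r k m)) + av (\<lambda>m. ip d X (\<zeta> r k m)))"
      unfolding v_def ip_scale_right ip_sum_right ip_av_right ip_add_right av_add ..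
    also have "\<dots> = - \<eta> * ((\<Sum>k<K. av (\<lambda>m. ip d X (\<delta> r k m))) + I r)"
      unfolding sum.distrib I_def X_def ..
    also have "\<dots> \<le> - \<eta> * ((\<Sum>k<K. fbar (wb r) - fbar ws
        - B * av (\<lambda>m. (np (\<lambda>i. wb r i - hg (z r k m) i))\<^sup>2) + av (\<lambda>m. (nd (\<delta> r k m))\<^sup>2) / (4 * B)) + I r)"
    proof (intro mult_left_mono_neg add_right_mono sum_mono)
      fix k
      have "av (\<lambda>m. ip d X (\<delta> r k m)) = av (\<lambda>m. ip d (G m (hg (z r k m))) X) - av (\<lambda>m. ip d (G m ws) X)"
        unfolding av_diff[symmetric] by (simp add: \<delta>_def ip_diff_right ip_commute[of d X])
      also have "av (\<lambda>m. ip d (G m ws) X) = 0"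
        unfolding ip_av_left[symmetric] by (simp add: av_G_ws ip_def)
      finally have eq: "av (\<lambda>m. ip d X (\<delta> r k m)) = av (\<lambda>m. ip d (G m (hg (z r k m))) X)" by simp
      have "av (\<lambda>m. f m (wb r) - f m ws - B * (np (\<lambda>i. wb r i - hg (z r k m) i))\<^sup>2 + 1 / (4 * B) * (nd (\<delta> r k m))\<^sup>2)
         \<le> av (\<lambda>m. ip d (G m (hg (z r k m))) X)"
        unfolding \<delta>_def X_def using three_point by (intro av_mono) simp
      then show "fbar (wb r) - fbar ws - B * av (\<lambda>m. (np (\<lambda>i. wb r i - hg (z r k m) i))\<^sup>2)
          + av (\<lambda>m. (nd (\<delta> r k m))\<^sup>2) / (4 * B) \<le> av (\<lambda>m. ip d X (\<delta> r k m))"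
        unfolding av_add av_diff av_scale eq fbar_def by simp
    qed (use eta in auto)
    also have "(\<Sum>k<K. fbar (wb r) - fbar ws
        - B * av (\<lambda>m. (np (\<lambda>i. wb r i - hg (z r k m) i))\<^sup>2) + av (\<lambda>m. (nd (\<delta> r k m))\<^sup>2) / (4 * B))
      = K * (fbar (wb r) - fbar ws)
      - B * (\<Sum>k<K. av (\<lambda>m. (np (\<lambda>i. wb r i - hg (z r k m) i))\<^sup>2)) + S r / (4 * B)"
      by (simp add: S_def sum.distrib sum_subtractf sum_distrib_left sum_divide_distrib)
    finally show ?thesis .
  qed
  moreover have "(nd v)\<^sup>2 / 2 \<le> \<eta>\<^sup>2 * (K * S r + Nz r K)"
  proof -
    have "(nd v)\<^sup>2 = \<eta>\<^sup>2 * (nd (\<lambda>i. (\<Sum>k<K. av (\<lambda>m. \<delta> r k m i)) + av (\<lambda>m. \<Sum>k<K. \<zeta> r k m i)))\<^sup>2"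
      unfolding v_def nd_sq_scale av_sum av_add sum.distrib by simp
    also have "\<dots> \<le> \<eta>\<^sup>2 * (2 * (nd (\<lambda>i. \<Sum>k<K. av (\<lambda>m. \<delta> r k m i)))\<^sup>2 + 2 * (nd (\<lambda>i. av (\<lambda>m. \<Sum>k<K. \<zeta> r k m i)))\<^sup>2)"
      by (intro mult_left_mono nrm_sq_add_le[OF pq]) auto
    also have "\<dots> \<le> \<eta>\<^sup>2 * (2 * (K * S r) + 2 * Nz r K)"
    proof (intro mult_left_mono add_mono)
      have "(nd (\<lambda>i. \<Sum>k<K. av (\<lambda>m. \<delta> r k m i)))\<^sup>2 \<le> K * (\<Sum>k<K. (nd (\<lambda>i. av (\<lambda>m. \<delta> r k m i)))\<^sup>2)"
        using nrm_sq_sum_le[OF pq, of d "\<lambda>k i. av (\<lambda>m. \<delta> r k m i)" "{..<K}"] by simp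
      also have "\<dots> \<le> K * S r" unfolding S_def by (intro mult_left_mono sum_mono nd_sq_av_le) auto
      finally show "(nd (\<lambda>i. \<Sum>k<K. av (\<lambda>m. \<delta> r k m i)))\<^sup>2 \<le> K * S r" .
      show "(nd (\<lambda>i. av (\<lambda>m. \<Sum>k<K. \<zeta> r k m i)))\<^sup>2 \<le> Nz r K"
        unfolding Nz_def by (rule nd_sq_av_le)
    qed auto
    finally show ?thesis by (simp add: algebra_simps)
  qed
  ultimately show ?thesis by (simp add: algebra_simps)
qed

text \<open>The local update of a whole round before gossip, in units of
  \<open>- \<eta>\<close>.\<close>

definition "\<Delta> r m = (\<lambda>i. (\<Sum>l<K. \<delta> r l m i) + real K * G m ws i + (\<Sum>l<K. \<zeta> r l m i))"

lemma Delta_le: "av (\<lambda>m. (nd (\<Delta> r m))\<^sup>2) \<le> 4 * (K * S r + K\<^sup>2 * E + Nz r K)"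
proof -
  have "av (\<lambda>m. (nd (\<Delta> r m))\<^sup>2) \<le> av (\<lambda>m. 4 * (K * (\<Sum>l<K. (nd (\<delta> r l m))\<^sup>2) + K\<^sup>2 * (nd (G m ws))\<^sup>2
      + (nd (\<lambda>i. \<Sum>l<K. \<zeta> r l m i))\<^sup>2))"
  proof (intro av_mono)
    fix m
    have "(nd (\<Delta> r m))\<^sup>2 \<le> 4 * ((nd (\<lambda>i. \<Sum>l<K. \<delta> r l m i))\<^sup>2 + (nd (\<lambda>i. real K * G m ws i))\<^sup>2
       + (nd (\<lambda>i. \<Sum>l<K. \<zeta> r l m i))\<^sup>2)"
      unfolding \<Delta>_def by (rule nd_sq_add3_le)
    also have "\<dots> \<le> 4 * (K * (\<Sum>l<K. (nd (\<delta> r l m))\<^sup>2) + K\<^sup>2 * (nd (G m ws))\<^sup>2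
      + (nd (\<lambda>i. \<Sum>l<K. \<zeta> r l m i))\<^sup>2)"
      unfolding nd_sq_scale by (intro mult_left_mono add_mono nd_sq_sum_delta_le) auto
    finally show "(nd (\<Delta> r m))\<^sup>2 \<le> 4 * (K * (\<Sum>l<K. (nd (\<delta> r l m))\<^sup>2) + K\<^sup>2 * (nd (G m ws))\<^sup>2
      + (nd (\<lambda>i. \<Sum>l<K. \<zeta> r l m i))\<^sup>2)" .
  qed
  also have "\<dots> = 4 * (K * S r + K\<^sup>2 * E + Nz r K)"
    unfolding av_scale av_add av_sum S_def E_def Nz_def ..
  finally show ?thesis .
qed

text \<open>Variation of constants: a round adds its local updates to the disagreement, and gossip
  then acts on old and new part alike, so even the latest updates carry \<open>dev 1\<close>. The
  common starting point leaves no homogeneous term.\<close>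

lemma consensus:
  "r \<le> R \<Longrightarrow> m < M \<Longrightarrow> z r 0 m i - zb r i = - \<eta> * (\<Sum>s<r. \<Sum>j<M. dev (r - s) j m * \<Delta> s j i)"
proof (induction r arbitrary: m)
  case 0
  have "av (\<lambda>m. z 0 0 m i) = av (\<lambda>m. z0 i)" by (intro av_cong) (simp add: start)
  then show ?case using 0 by (simp add: start zb_def av_const)
next
  case (Suc r)
  then have r: "r < R" by simp
  have zK: "z r K j i = z r 0 j i - \<eta> * \<Delta> r j i" if "j < M" for j
    using local_drift[OF r that, of K] by (simp add: \<Delta>_def algebra_simps)
  have zb': "zb (Suc r) i = zb r i - \<eta> * av (\<lambda>j. \<Delta> r j i)"
    unfolding zb_Suc[OF r] \<Delta>_def av_add av_sum av_scale av_G_ws sum.distrib by simp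
  have "z (Suc r) 0 m i - zb (Suc r) i
     = (\<Sum>j<M. U $$ (j, m) * (z r 0 j i - \<eta> * \<Delta> r j i)) - zb (Suc r) i"
    using Suc.prems r by (simp add: gossip_step zK)
  also have "\<dots> = (\<Sum>j<M. U $$ (j, m) * (z r 0 j i - zb r i)) + (\<Sum>j<M. U $$ (j, m)) * zb r i
      - \<eta> * (\<Sum>j<M. U $$ (j, m) * \<Delta> r j i) - zb (Suc r) i"
    by (simp add: algebra_simps sum_subtractf sum_distrib_left sum_distrib_right sum.distrib)
  \<comment> \<open>The column sums of \<open>U\<close> are 1, which cancels \<open>zb r\<close>;
    subtracting the averaged update from the gossiped one turns \<open>U\<close> into
    \<open>dev 1\<close>.\<close>
  also have "\<dots> = (\<Sum>j<M. U $$ (j, m) * (z r 0 j i - zb r i)) - \<eta> * (\<Sum>j<M. dev 1 j m * \<Delta> r j i)"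
    using Suc.prems unfolding zb' av_def
    by (simp add: U_col dev_1[unfolded One_nat_def] algebra_simps sum_subtractf sum_divide_distrib)
  also have "(\<Sum>j<M. U $$ (j, m) * (z r 0 j i - zb r i))
      = - \<eta> * (\<Sum>l<M. \<Sum>s<r. \<Sum>j<M. dev (r - s) j l * U $$ (l, m) * \<Delta> s j i)"
    using Suc.IH r by (simp add: sum_distrib_left mult_ac)
  also have "(\<Sum>l<M. \<Sum>s<r. \<Sum>j<M. dev (r - s) j l * U $$ (l, m) * \<Delta> s j i)
      = (\<Sum>s<r. \<Sum>l<M. \<Sum>j<M. dev (r - s) j l * U $$ (l, m) * \<Delta> s j i)"
    by (rule sum.swap)
  also have "\<dots> = (\<Sum>s<r. \<Sum>j<M. dev (Suc r - s) j m * \<Delta> s j i)"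
  proof (rule sum.cong[OF refl])
    fix s assume "s \<in> {..<r}"
    then have "Suc r - s = Suc (r - s)" by auto
    then show "(\<Sum>l<M. \<Sum>j<M. dev (r - s) j l * U $$ (l, m) * \<Delta> s j i) = (\<Sum>j<M. dev (Suc r - s) j m * \<Delta> s j i)"
      using Suc.prems by (subst sum.swap) (simp add: dev_Suc sum_distrib_right)
  qed
  finally show ?case by (simp add: algebra_simps)
qed

text \<open>Weighted Cauchy-Schwarz over pairs of a past round and a client. For fixed
  \<open>m\<close>, column sums of the deviations bound the total weight; once the average over
  \<open>m\<close> is taken, row sums bound what each past update contributes.\<close>

lemma consensus_le:
  assumes "r \<le> R"
  shows "C r \<le> \<eta>\<^sup>2 * \<kappa> * (\<Sum>s<r. rate (r - s) * av (\<lambda>m. (nd (\<Delta> s m))\<^sup>2))"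
proof -
  have rates: "(\<Sum>s<r. rate (r - s)) \<le> \<kappa>"
  proof -
    have "(\<Sum>s<r. rate (r - s)) = (\<Sum>t<r. rate (Suc t))"
      by (rule sum.reindex_bij_witness[of _ "\<lambda>t. r - Suc t" "\<lambda>s. r - Suc s"]) (auto simp: Suc_diff_Suc)
    also have "\<dots> \<le> (\<Sum>t<Suc r. rate t)"
      unfolding sum.lessThan_Suc_shift using rate_nonneg[of 0] by simp
    finally show ?thesis using kappa(2)[of "Suc r"] by simp
  qed
  have col: "(\<Sum>j<M. \<bar>dev t j m\<bar>) \<le> rate t" if "m < M" for t m
    by (rule dev_col_le_rate[OF that])
  have "C r \<le> av (\<lambda>m. \<eta>\<^sup>2 * \<kappa> * (\<Sum>s<r. \<Sum>j<M. \<bar>dev (r - s) j m\<bar> * (nd (\<Delta> s j))\<^sup>2))"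
    unfolding C_def
  proof (intro av_mono)
    fix m assume m: "m < M"
    have "(nd (\<lambda>i. z r 0 m i - zb r i))\<^sup>2 =
       \<eta>\<^sup>2 * (nd (\<lambda>i. \<Sum>(s, j)\<in>{..<r} \<times> {..<M}. dev (r - s) j m * \<Delta> s j i))\<^sup>2"
      unfolding consensus[OF assms m] nd_sq_scale by (simp add: sum.cartesian_product)
    also have "\<dots> \<le> \<eta>\<^sup>2 * ((\<Sum>(s, j)\<in>{..<r} \<times> {..<M}. \<bar>dev (r - s) j m\<bar>) *
        (\<Sum>(s, j)\<in>{..<r} \<times> {..<M}. \<bar>dev (r - s) j m\<bar> * (nd (\<Delta> s j))\<^sup>2))"
      using nrm_sq_weighted_sum_le[OF pq, of d "\<lambda>(s, j). dev (r - s) j m" "\<lambda>(s, j). \<Delta> s j" "{..<r} \<times> {..<M}"]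
      by (intro mult_left_mono) (simp_all add: case_prod_unfold)
    also have "\<dots> \<le> \<eta>\<^sup>2 * (\<kappa> * (\<Sum>(s, j)\<in>{..<r} \<times> {..<M}. \<bar>dev (r - s) j m\<bar> * (nd (\<Delta> s j))\<^sup>2))"
    proof (intro mult_left_mono mult_right_mono sum_nonneg)
      have "(\<Sum>(s, j)\<in>{..<r} \<times> {..<M}. \<bar>dev (r - s) j m\<bar>) = (\<Sum>s<r. \<Sum>j<M. \<bar>dev (r - s) j m\<bar>)"
        by (simp add: sum.cartesian_product)
      also have "\<dots> \<le> (\<Sum>s<r. rate (r - s))" by (intro sum_mono col m)
      finally show "(\<Sum>(s, j)\<in>{..<r} \<times> {..<M}. \<bar>dev (r - s) j m\<bar>) \<le> \<kappa>" using rates by simp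
    qed auto
    finally show "(nd (\<lambda>i. z r 0 m i - zb r i))\<^sup>2 \<le> \<eta>\<^sup>2 * \<kappa> * (\<Sum>s<r. \<Sum>j<M. \<bar>dev (r - s) j m\<bar> * (nd (\<Delta> s j))\<^sup>2)"
      by (simp add: sum.cartesian_product mult.assoc)
  qed
  also have "\<dots> = \<eta>\<^sup>2 * \<kappa> * (\<Sum>s<r. (\<Sum>j<M. (\<Sum>m<M. \<bar>dev (r - s) j m\<bar>) * (nd (\<Delta> s j))\<^sup>2) / M)"
    unfolding av_scale av_sum av_def
    by (simp add: sum_divide_distrib[symmetric] sum_distrib_right)
  also have "\<dots> \<le> \<eta>\<^sup>2 * \<kappa> * (\<Sum>s<r. (\<Sum>j<M. rate (r - s) * (nd (\<Delta> s j))\<^sup>2) / M)"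
    using kappa(1) by (intro mult_left_mono sum_mono divide_right_mono mult_right_mono dev_row_le_rate) auto
  also have "\<dots> = \<eta>\<^sup>2 * \<kappa> * (\<Sum>s<r. rate (r - s) * av (\<lambda>m. (nd (\<Delta> s m))\<^sup>2))"
    by (simp add: av_def sum_distrib_left[symmetric])
  finally show ?thesis .
qed

text \<open>Exchanging the two sums over rounds yields the second factor \<kappa>: each past round
  is counted with a total rate of at most \<kappa>.\<close>

lemma sum_consensus_le:
  "(\<Sum>r<R. C r) \<le> 4 * \<eta>\<^sup>2 * \<kappa>\<^sup>2 * (K * (\<Sum>r<R. S r) + R * K\<^sup>2 * E + (\<Sum>r<R. Nz r K))"
proof -
  define D where "D s = av (\<lambda>m. (nd (\<Delta> s m))\<^sup>2)" for s
  have D: "0 \<le> D s" for s unfolding D_def by (intro av_nonneg) auto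
  have "(\<Sum>r<R. \<Sum>s<r. rate (r - s) * D s) = (\<Sum>s<R. \<Sum>r\<in>{Suc s..<R}. rate (r - s) * D s)"
    unfolding sum.Sigma[OF finite_lessThan ballI[OF finite_lessThan]] sum.Sigma[OF finite_lessThan ballI[OF finite_atLeastLessThan]]
    by (rule sum.reindex_bij_witness[of _ prod.swap prod.swap]) auto
  also have "\<dots> \<le> (\<Sum>s<R. \<kappa> * D s)"
  proof (intro sum_mono)
    fix s
    have "(\<Sum>r\<in>{Suc s..<R}. rate (r - s)) = (\<Sum>t\<in>{1..<R - s}. rate t)"
      by (rule sum.reindex_bij_witness[of _ "\<lambda>t. t + s" "\<lambda>r. r - s"]) auto
    also have "\<dots> \<le> (\<Sum>t<R - s. rate t)" using rate_nonneg by (intro sum_mono2) auto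
    also have "\<dots> \<le> \<kappa>" by (rule kappa)
    finally show "(\<Sum>r\<in>{Suc s..<R}. rate (r - s) * D s) \<le> \<kappa> * D s"
      unfolding sum_distrib_right[symmetric] using D by (intro mult_right_mono) auto
  qed
  also have "\<dots> \<le> (\<Sum>s<R. \<kappa> * (4 * (K * S s + K\<^sup>2 * E + Nz s K)))"
    unfolding D_def using kappa by (intro sum_mono mult_left_mono Delta_le) auto
  also have "\<dots> = 4 * \<kappa> * (K * (\<Sum>r<R. S r) + R * K\<^sup>2 * E + (\<Sum>r<R. Nz r K))"
    by (simp add: sum_distrib_left sum.distrib algebra_simps)
  finally have *: "(\<Sum>r<R. \<Sum>s<r. rate (r - s) * D s) \<le> 4 * \<kappa> * (K * (\<Sum>r<R. S r) + R * K\<^sup>2 * E + (\<Sum>r<R. Nz r K))" .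
  have "(\<Sum>r<R. C r) \<le> (\<Sum>r<R. \<eta>\<^sup>2 * \<kappa> * (\<Sum>s<r. rate (r - s) * D s))"
    unfolding D_def by (intro sum_mono consensus_le) auto
  also have "\<dots> = \<eta>\<^sup>2 * \<kappa> * (\<Sum>r<R. \<Sum>s<r. rate (r - s) * D s)" by (simp add: sum_distrib_left)
  also have "\<dots> \<le> \<eta>\<^sup>2 * \<kappa> * (4 * \<kappa> * (K * (\<Sum>r<R. S r) + R * K\<^sup>2 * E + (\<Sum>r<R. Nz r K)))"
    using kappa by (intro mult_left_mono *) auto
  finally show ?thesis by (simp add: power2_eq_square mult_ac)
qed

text \<open>The round inequalities telescope to a nonnegative final potential. Once the consensus
  bound is inserted, the summed deviations have a nonpositive coefficient, and a change of point
  leads from the averaged dual iterate to the clients' own iterates.\<close>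

theorem path_bound:
  "(\<Sum>r<R. av (\<lambda>m. fbar (hg (z r 0 m)) - fbar ws)) \<le>
     2 * potential z0 / (\<eta> * K) + 48 * \<eta>\<^sup>2 * B * K\<^sup>2 * \<kappa>\<^sup>2 * R * E
     + (40 * \<eta>\<^sup>2 * B * \<kappa>\<^sup>2 + 2 * \<eta> / K) * (\<Sum>r<R. Nz r K)
     + 8 * \<eta>\<^sup>2 * B / K * (\<Sum>r<R. \<Sum>k<K. Nz r k) - 2 / K * (\<Sum>r<R. I r)"
proof -
  define GG where "GG = (\<Sum>r<R. fbar (wb r) - fbar ws)"
  define SS where "SS = (\<Sum>r<R. S r)"
  define CC where "CC = (\<Sum>r<R. C r)"
  define NN where "NN = (\<Sum>r<R. Nz r K)"
  define NS where "NS = (\<Sum>r<R. \<Sum>k<K. Nz r k)"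
  define II where "II = (\<Sum>r<R. I r)"
  define \<Phi> where "\<Phi> = potential z0"
  have Kp: "0 < real K" using K by simp
  have SS: "0 \<le> SS" unfolding SS_def by (intro sum_nonneg S_nonneg)
  have CC: "CC \<le> 4 * \<eta>\<^sup>2 * \<kappa>\<^sup>2 * (K * SS + R * K\<^sup>2 * E + NN)"
    using sum_consensus_le by (simp add: CC_def SS_def NN_def)
  have "potential (zb n) \<le> potential (zb 0) + (\<Sum>r<n. - \<eta> * K * (fbar (wb r) - fbar ws)
    + \<eta> * B * (4 * K * C r + 4 * \<eta>\<^sup>2 * K\<^sup>2 * S r + 4 * \<eta>\<^sup>2 * K ^ 3 * E + 4 * \<eta>\<^sup>2 * (\<Sum>k<K. Nz r k))
    - \<eta> / (4 * B) * S r + \<eta>\<^sup>2 * (K * S r + Nz r K) - \<eta> * I r)" if "n \<le> R" for n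
    using that
  proof (induction n)
    case (Suc n)
    have "\<eta> * B * (\<Sum>k<K. av (\<lambda>m. (np (\<lambda>i. wb n i - hg (z n k m) i))\<^sup>2)) \<le>
      \<eta> * B * (4 * K * C n + 4 * \<eta>\<^sup>2 * K\<^sup>2 * S n + 4 * \<eta>\<^sup>2 * K ^ 3 * E + 4 * \<eta>\<^sup>2 * (\<Sum>k<K. Nz n k))"
      using Suc.prems eta B by (intro mult_left_mono drift_le) auto
    then show ?case using Suc potential_round[of n] by simp
  qed simp
  from this[of R] potential_nonneg[of "zb R"]
  have "0 \<le> potential (zb 0) + (\<Sum>r<R. - \<eta> * K * (fbar (wb r) - fbar ws)
    + \<eta> * B * (4 * K * C r + 4 * \<eta>\<^sup>2 * K\<^sup>2 * S r + 4 * \<eta>\<^sup>2 * K ^ 3 * E + 4 * \<eta>\<^sup>2 * (\<Sum>k<K. Nz r k))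
    - \<eta> / (4 * B) * S r + \<eta>\<^sup>2 * (K * S r + Nz r K) - \<eta> * I r)" by simp
  also have "potential (zb 0) = \<Phi>"
  proof -
    have "zb 0 = z0" unfolding zb_def using av_const by (simp add: start cong: av_cong)
    then show ?thesis by (simp add: \<Phi>_def)
  qed
  also have "(\<Sum>r<R. - \<eta> * K * (fbar (wb r) - fbar ws)
    + \<eta> * B * (4 * K * C r + 4 * \<eta>\<^sup>2 * K\<^sup>2 * S r + 4 * \<eta>\<^sup>2 * K ^ 3 * E + 4 * \<eta>\<^sup>2 * (\<Sum>k<K. Nz r k))
    - \<eta> / (4 * B) * S r + \<eta>\<^sup>2 * (K * S r + Nz r K) - \<eta> * I r)
    = - \<eta> * K * GG + \<eta> * B * (4 * K * CC + 4 * \<eta>\<^sup>2 * K\<^sup>2 * SS + R * (4 * \<eta>\<^sup>2 * K ^ 3 * E) + 4 * \<eta>\<^sup>2 * NS)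
    - \<eta> / (4 * B) * SS + \<eta>\<^sup>2 * (K * SS + NN) - \<eta> * II"
    unfolding GG_def SS_def CC_def NS_def NN_def II_def
    unfolding sum_subtractf sum.distrib sum_distrib_left[symmetric] by simp
  finally have pot: "0 \<le> \<Phi> - \<eta> * K * GG + \<eta> * B * (4 * K * CC + 4 * \<eta>\<^sup>2 * K\<^sup>2 * SS + R * (4 * \<eta>\<^sup>2 * K ^ 3 * E) + 4 * \<eta>\<^sup>2 * NS)
    - \<eta> / (4 * B) * SS + \<eta>\<^sup>2 * (K * SS + NN) - \<eta> * II" by simp
  \<comment> \<open>This scaling isolates twice the summed gap, the amount that
    \<open>fbar_change_point\<close> consumes.\<close>
  have "0 \<le> 2 / (\<eta> * K) * (\<Phi> - \<eta> * K * GG + \<eta> * B * (4 * K * CC + 4 * \<eta>\<^sup>2 * K\<^sup>2 * SS + R * (4 * \<eta>\<^sup>2 * K ^ 3 * E) + 4 * \<eta>\<^sup>2 * NS)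
    - \<eta> / (4 * B) * SS + \<eta>\<^sup>2 * (K * SS + NN) - \<eta> * II)"
    using eta Kp by (intro mult_nonneg_nonneg pot) auto
  also have "\<dots> = 2 * \<Phi> / (\<eta> * K) - 2 * GG + 8 * B * CC + 8 * \<eta>\<^sup>2 * B * K * SS + 8 * \<eta>\<^sup>2 * B * K\<^sup>2 * R * E
      + 8 * \<eta>\<^sup>2 * B / K * NS - SS / (2 * (B * K)) + 2 * \<eta> * SS + 2 * \<eta> / K * NN - 2 / K * II"
    using eta Kp B by (simp add: field_simps power2_eq_square power3_eq_cube)
  finally have GG: "2 * GG \<le> 2 * \<Phi> / (\<eta> * K) + 8 * B * CC + 8 * \<eta>\<^sup>2 * B * K * SS + 8 * \<eta>\<^sup>2 * B * K\<^sup>2 * R * E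
      + 8 * \<eta>\<^sup>2 * B / K * NS - SS / (2 * (B * K)) + 2 * \<eta> * SS + 2 * \<eta> / K * NN - 2 / K * II" by simp
  have change: "av (\<lambda>m. fbar (hg (z r 0 m)) - fbar ws) \<le> 2 * (fbar (wb r) - fbar ws) + 2 * B * C r" for r
  proof -
    have "av (\<lambda>m. fbar (hg (z r 0 m)) - fbar ws)
      \<le> av (\<lambda>m. 2 * (fbar (wb r) - fbar ws) + 2 * B * (nd (\<lambda>i. z r 0 m i - zb r i))\<^sup>2)"
    proof (intro av_mono)
      fix m
      have "np (\<lambda>i. hg (z r 0 m) i - wb r i) \<le> nd (\<lambda>i. z r 0 m i - zb r i)"
        unfolding wb_def by (rule mgrad_nonexpansive[OF p pq])
      then have "2 * B * (np (\<lambda>i. hg (z r 0 m) i - wb r i))\<^sup>2 \<le> 2 * B * (nd (\<lambda>i. z r 0 m i - zb r i))\<^sup>2"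
        using B by (intro mult_left_mono power_mono) auto
      then show "fbar (hg (z r 0 m)) - fbar ws \<le> 2 * (fbar (wb r) - fbar ws) + 2 * B * (nd (\<lambda>i. z r 0 m i - zb r i))\<^sup>2"
        using fbar_change_point[of "hg (z r 0 m)" "wb r"] by linarith
    qed
    then show ?thesis unfolding av_add av_const av_scale C_def .
  qed
  have "(\<Sum>r<R. av (\<lambda>m. fbar (hg (z r 0 m)) - fbar ws)) \<le> (\<Sum>r<R. 2 * (fbar (wb r) - fbar ws) + 2 * B * C r)"
    by (intro sum_mono change)
  also have "\<dots> = 2 * GG + 2 * B * CC"
    by (simp add: GG_def CC_def sum.distrib sum_distrib_left)
  finally have T: "(\<Sum>r<R. av (\<lambda>m. fbar (hg (z r 0 m)) - fbar ws)) \<le> 2 * GG + 2 * B * CC" .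
  \<comment> \<open>Eight copies of \<open>B * CC\<close> come from the drift, two from the change
    of point.\<close>
  have CC': "10 * B * CC \<le> 10 * B * (4 * \<eta>\<^sup>2 * \<kappa>\<^sup>2 * (K * SS + R * K\<^sup>2 * E + NN))"
    using B by (intro mult_left_mono CC) auto
  define a where "a = \<eta> * B * K"
  have a0: "0 \<le> a" using eta B by (simp add: a_def)
  have ak: "a * \<kappa> \<le> 1 / 32" using kappa by (simp add: a_def)
  have "a * 1 \<le> a * \<kappa>" using a0 kappa by (intro mult_left_mono) auto
  then have a1: "a \<le> 1 / 32" using ak by simp
  \<comment> \<open>In terms of \<open>a = \<eta> * B * K\<close> this is \<open>40 * (a *
    \<kappa>)\<^sup>2 + 8 * a\<^sup>2 + 2 * a \<le> 1 / 2\<close>; the smallness 1/32 satisfies it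
    with room to spare.\<close>
  have coef: "40 * \<eta>\<^sup>2 * B * \<kappa>\<^sup>2 * K + 8 * \<eta>\<^sup>2 * B * K + 2 * \<eta> \<le> 1 / (2 * (B * K))"
  proof -
    have "(a * \<kappa>)\<^sup>2 \<le> (1 / 32)\<^sup>2" "a\<^sup>2 \<le> (1 / 32)\<^sup>2"
      using a0 ak a1 kappa by (auto intro!: power_mono)
    then have "40 * (a * \<kappa>)\<^sup>2 + 8 * a\<^sup>2 + 2 * a \<le> 1 / 2" using a1 by (simp add: power2_eq_square)
    also have "40 * (a * \<kappa>)\<^sup>2 + 8 * a\<^sup>2 + 2 * a = (40 * \<eta>\<^sup>2 * B * \<kappa>\<^sup>2 * K + 8 * \<eta>\<^sup>2 * B * K + 2 * \<eta>) * (B * K)"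
      by (simp add: a_def power2_eq_square algebra_simps)
    finally show ?thesis using B Kp by (simp add: pos_le_divide_eq)
  qed
  have Sterm: "(40 * \<eta>\<^sup>2 * B * \<kappa>\<^sup>2 * K + 8 * \<eta>\<^sup>2 * B * K + 2 * \<eta>) * SS \<le> 1 / (2 * (B * K)) * SS"
    using coef SS by (rule mult_right_mono)
  \<comment> \<open>As \<kappa> is at least 1, the 8 from the drift joins the 40 from the consensus
    error to make 48.\<close>
  have Eterm: "8 * \<eta>\<^sup>2 * B * K\<^sup>2 * R * E * 1 \<le> 8 * \<eta>\<^sup>2 * B * K\<^sup>2 * R * E * \<kappa>\<^sup>2"
    using kappa(1) B E_nonneg by (intro mult_left_mono) (auto simp: one_le_power)
  have "(\<Sum>r<R. av (\<lambda>m. fbar (hg (z r 0 m)) - fbar ws)) \<le>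
    2 * \<Phi> / (\<eta> * K) + 10 * B * (4 * \<eta>\<^sup>2 * \<kappa>\<^sup>2 * (K * SS + R * K\<^sup>2 * E + NN)) + 8 * \<eta>\<^sup>2 * B * K * SS
      + 8 * \<eta>\<^sup>2 * B * K\<^sup>2 * R * E
      + 8 * \<eta>\<^sup>2 * B / K * NS - SS / (2 * (B * K)) + 2 * \<eta> * SS + 2 * \<eta> / K * NN - 2 / K * II"
    using T GG CC' by linarith
  also have "\<dots> = 2 * \<Phi> / (\<eta> * K) + ((40 * \<eta>\<^sup>2 * B * \<kappa>\<^sup>2 * K + 8 * \<eta>\<^sup>2 * B * K + 2 * \<eta>) * SS - 1 / (2 * (B * K)) * SS)
      + (8 * \<eta>\<^sup>2 * B * K\<^sup>2 * R * E * 1 + 40 * \<eta>\<^sup>2 * B * K\<^sup>2 * R * E * \<kappa>\<^sup>2) + (40 * \<eta>\<^sup>2 * B * \<kappa>\<^sup>2 + 2 * \<eta> / K) * NN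
      + 8 * \<eta>\<^sup>2 * B / K * NS - 2 / K * II"
    by (simp add: algebra_simps)
  also have "\<dots> \<le> 2 * \<Phi> / (\<eta> * K) + 0
      + (8 * \<eta>\<^sup>2 * B * K\<^sup>2 * R * E * \<kappa>\<^sup>2 + 40 * \<eta>\<^sup>2 * B * K\<^sup>2 * R * E * \<kappa>\<^sup>2) + (40 * \<eta>\<^sup>2 * B * \<kappa>\<^sup>2 + 2 * \<eta> / K) * NN
      + 8 * \<eta>\<^sup>2 * B / K * NS - 2 / K * II"
    using Sterm Eterm by (intro add_mono diff_right_mono) auto
  finally show ?thesis unfolding \<Phi>_def NN_def NS_def II_def by (simp add: algebra_simps)
qed

end

section \<open>Gradients of vector functions and mirror maps\<close>

lemma lp_norm_vec: "lp_norm p (vec d x) = nrm d p x"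
  unfolding lp_norm_def nrm_def by (intro arg_cong2[where f = "(powr)"] sum.cong) auto

lemma scalar_prod_vec: "vec d x \<bullet> vec d y = ip d x y"
  by (auto simp: scalar_prod_def ip_def lessThan_atLeast0 intro!: sum.cong)

lemma carrier_eq_vec: "w \<in> carrier_vec d \<Longrightarrow> w = vec d (\<lambda>i. w $ i)"
  by (intro eq_vecI) auto

lemma vec_add_vec: "vec d x + vec d y = vec d (\<lambda>i. x i + y i)"
  by (intro eq_vecI) auto

lemma vec_diff_vec: "vec d x - vec d y = vec d (\<lambda>i. x i - y i :: real)"
  by (intro eq_vecI) auto

lemma has_gradient_vec:
  "has_gradient d \<phi> (vec d g) (vec d x) \<longleftrightarrow>
     (\<forall>e>0. \<exists>\<delta>>0. \<forall>v. nrm d 2 v < \<delta> \<longrightarrow>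
        \<bar>\<phi> (vec d (\<lambda>i. x i + v i)) - \<phi> (vec d x) - ip d g v\<bar> \<le> e * nrm d 2 v)"
proof -
  have eq: "(\<forall>v\<in>carrier_vec d. P v) \<longleftrightarrow> (\<forall>v. P (vec d v))" for P :: "real vec \<Rightarrow> bool"
    by (metis carrier_eq_vec vec_carrier)
  show ?thesis unfolding has_gradient_def eq by (simp add: vec_add_vec scalar_prod_vec lp_norm_vec)
qed

lemma nrm_single: "i < d \<Longrightarrow> 0 < p \<Longrightarrow> nrm d p (\<lambda>j. if j = i then t else 0) = \<bar>t\<bar>"
proof -
  assume i: "i < d" and p: "0 < p"
  have "(\<Sum>j<d. \<bar>if j = i then t else 0\<bar> powr p) = (\<Sum>j<d. if j = i then \<bar>t\<bar> powr p else 0)"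
    by (intro sum.cong) auto
  then show ?thesis using i p by (simp add: nrm_def powr_powr)
qed

lemma ip_single: "i < d \<Longrightarrow> ip d g (\<lambda>j. if j = i then t else 0) = g i * t"
proof -
  assume i: "i < d"
  have "ip d g (\<lambda>j. if j = i then t else 0) = (\<Sum>j<d. if j = i then g i * t else 0)"
    unfolding ip_def by (intro sum.cong) auto
  then show ?thesis using i by simp
qed

text \<open>Small steps in coordinate directions separate two candidates. Uniqueness is what gives
  the description operator in \<open>gradient\<close> a value.\<close>

lemma has_gradient_unique:
  assumes "has_gradient d \<phi> g w" "has_gradient d \<phi> g' w" "w \<in> carrier_vec d"
  shows "g = g'"
proof (rule eq_vecI)
  have c: "g \<in> carrier_vec d" "g' \<in> carrier_vec d" using assms by (auto simp: has_gradient_def)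
  then show "dim_vec g = dim_vec g'" by simp
  fix i assume "i < dim_vec g'"
  then have i: "i < d" using c by simp
  let ?x = "\<lambda>i. w $ i" and ?g = "\<lambda>i. g $ i" and ?g' = "\<lambda>i. g' $ i"
  have h: "has_gradient d \<phi> (vec d ?g) (vec d ?x)" "has_gradient d \<phi> (vec d ?g') (vec d ?x)"
    using assms(1,2) unfolding carrier_eq_vec[OF assms(3), symmetric] carrier_eq_vec[OF c(1), symmetric]
      carrier_eq_vec[OF c(2), symmetric] .
  have "\<bar>g $ i - g' $ i\<bar> \<le> e" if "0 < e" for e
  proof -
    have e2: "0 < e / 2" using that by simp
    obtain \<delta> where \<delta>: "0 < \<delta>" "\<And>v. nrm d 2 v < \<delta> \<Longrightarrow>
        \<bar>\<phi> (vec d (\<lambda>i. ?x i + v i)) - \<phi> (vec d ?x) - ip d ?g v\<bar> \<le> e / 2 * nrm d 2 v"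
      using h(1)[unfolded has_gradient_vec] e2 by blast
    obtain \<delta>' where \<delta>': "0 < \<delta>'" "\<And>v. nrm d 2 v < \<delta>' \<Longrightarrow>
        \<bar>\<phi> (vec d (\<lambda>i. ?x i + v i)) - \<phi> (vec d ?x) - ip d ?g' v\<bar> \<le> e / 2 * nrm d 2 v"
      using h(2)[unfolded has_gradient_vec] e2 by blast
    define t where "t = min \<delta> \<delta>' / 2"
    have t: "0 < t" "t < \<delta>" "t < \<delta>'" using \<delta>(1) \<delta>'(1) by (auto simp: t_def)
    let ?v = "\<lambda>j. if j = i then t else 0"
    have n: "nrm d 2 ?v = t" using t i by (simp add: nrm_single)
    have "\<bar>\<phi> (vec d (\<lambda>j. ?x j + ?v j)) - \<phi> (vec d ?x) - g $ i * t\<bar> \<le> e / 2 * t"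
      "\<bar>\<phi> (vec d (\<lambda>j. ?x j + ?v j)) - \<phi> (vec d ?x) - g' $ i * t\<bar> \<le> e / 2 * t"
      using \<delta>(2)[of ?v] \<delta>'(2)[of ?v] t unfolding n ip_single[OF i] by auto
    then have "\<bar>g $ i * t - g' $ i * t\<bar> \<le> e * t" by linarith
    then have "\<bar>g $ i - g' $ i\<bar> * t \<le> e * t" using t
      by (simp add: left_diff_distrib[symmetric] abs_mult)
    then show ?thesis using t by simp
  qed
  then show "g $ i = g' $ i"
    using field_le_epsilon[of "\<bar>g $ i - g' $ i\<bar>" 0] by auto
qed

lemma gradient_eqI: "has_gradient d \<phi> g w \<Longrightarrow> w \<in> carrier_vec d \<Longrightarrow> gradient d \<phi> w = g"
  unfolding gradient_def by (rule the_equality) (auto intro: has_gradient_unique)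

lemma has_gradient_gradient:
  "differentiable_everywhere d \<phi> \<Longrightarrow> w \<in> carrier_vec d \<Longrightarrow> has_gradient d \<phi> (gradient d \<phi> w) w"
  unfolding differentiable_everywhere_def by (metis gradient_eqI)

lemma gradient_carrier:
  "differentiable_everywhere d \<phi> \<Longrightarrow> w \<in> carrier_vec d \<Longrightarrow> gradient d \<phi> w \<in> carrier_vec d"
  using has_gradient_gradient by (auto simp: has_gradient_def)

lemma nrm_tendsto_0:
  assumes "\<And>i. i < d \<Longrightarrow> (\<lambda>n. v n i) \<longlonglongrightarrow> 0" "1 \<le> p"
  shows "(\<lambda>n. nrm d p (v n)) \<longlonglongrightarrow> 0"
proof (rule tendsto_sandwich[of "\<lambda>_. 0" _ _ "\<lambda>n. \<Sum>i<d. \<bar>v n i\<bar>"])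
  show "(\<lambda>n. \<Sum>i<d. \<bar>v n i\<bar>) \<longlonglongrightarrow> 0"
    using assms(1) by (intro tendsto_null_sum tendsto_rabs_zero) auto
qed (use assms(2) nrm_le_sum_abs in auto)

lemma has_gradient_sequentially:
  assumes "has_gradient d \<phi> (vec d g) (vec d x)" "\<And>i. i < d \<Longrightarrow> (\<lambda>n. v n i) \<longlonglongrightarrow> 0" "0 < e"
  shows "\<forall>\<^sub>F n in sequentially.
    \<bar>\<phi> (vec d (\<lambda>i. x i + v n i)) - \<phi> (vec d x) - ip d g (v n)\<bar> \<le> e * nrm d 2 (v n)"
proof -
  obtain \<delta> where \<delta>: "0 < \<delta>" "\<And>v. nrm d 2 v < \<delta> \<Longrightarrow>
      \<bar>\<phi> (vec d (\<lambda>i. x i + v i)) - \<phi> (vec d x) - ip d g v\<bar> \<le> e * nrm d 2 v"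
    using assms(1,3) unfolding has_gradient_vec by blast
  have "\<forall>\<^sub>F n in sequentially. nrm d 2 (v n) < \<delta>"
    using nrm_tendsto_0[of d v 2] assms(2) \<delta>(1) by (intro order_tendstoD(2)) auto
  then show ?thesis by (rule eventually_mono) (rule \<delta>(2))
qed

text \<open>Continuity in the sequential, coordinatewise form in which
  \<open>caratheodory_measurable\<close> asks for it.\<close>

lemma has_gradient_continuous:
  assumes "has_gradient d \<phi> (vec d g) (vec d x)" "\<And>i. i < d \<Longrightarrow> (\<lambda>n. y n i) \<longlonglongrightarrow> x i"
  shows "(\<lambda>n. \<phi> (vec d (y n))) \<longlonglongrightarrow> \<phi> (vec d x)"
proof -
  define v where "v n i = y n i - x i" for n i
  have v: "(\<lambda>n. v n i) \<longlonglongrightarrow> 0" if "i < d" for i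
    unfolding v_def using assms(2)[OF that] by (simp add: LIM_zero_iff)
  have "(\<lambda>n. \<phi> (vec d (y n)) - \<phi> (vec d x)) \<longlonglongrightarrow> 0"
  proof (rule Lim_null_comparison)
    show "\<forall>\<^sub>F n in sequentially. norm (\<phi> (vec d (y n)) - \<phi> (vec d x)) \<le> \<bar>ip d g (v n)\<bar> + nrm d 2 (v n)"
      using has_gradient_sequentially[OF assms(1), of v 1] v
      by (auto simp: v_def elim!: eventually_mono)
    have "(\<lambda>n. ip d g (v n)) \<longlonglongrightarrow> 0" unfolding ip_def
      using v by (intro tendsto_null_sum tendsto_mult_right_zero) auto
    then show "(\<lambda>n. \<bar>ip d g (v n)\<bar> + nrm d 2 (v n)) \<longlonglongrightarrow> 0"
      using nrm_tendsto_0[of d v 2] v by (intro tendsto_add_zero tendsto_rabs_zero) auto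
  qed
  then show ?thesis by (simp add: LIM_zero_iff)
qed

text \<open>Presents a partial derivative as the limit of a sequence of difference quotients, from
  which its measurability will follow.\<close>

lemma has_gradient_partial:
  assumes "has_gradient d \<phi> (vec d g) (vec d x)" "i < d"
  shows "(\<lambda>n. (\<phi> (vec d (\<lambda>j. x j + (if j = i then 1 / real (Suc n) else 0))) - \<phi> (vec d x)) * real (Suc n)) \<longlonglongrightarrow> g i"
proof (rule LIMSEQ_I)
  fix e :: real assume e: "0 < e"
  define v where "v n j = (if j = i then 1 / real (Suc n) else 0)" for n j
  have v: "(\<lambda>n. v n j) \<longlonglongrightarrow> 0" for j
    unfolding v_def using LIMSEQ_inverse_real_of_nat
    by (cases "j = i") (simp_all add: inverse_eq_divide del: of_nat_Suc)
  have "\<forall>\<^sub>F n in sequentially. \<bar>\<phi> (vec d (\<lambda>i. x i + v n i)) - \<phi> (vec d x) - ip d g (v n)\<bar> \<le> e / 2 * nrm d 2 (v n)"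
    using has_gradient_sequentially[OF assms(1), of v "e / 2"] e v by simp
  then have "\<forall>\<^sub>F n in sequentially. \<bar>(\<phi> (vec d (\<lambda>j. x j + v n j)) - \<phi> (vec d x)) * real (Suc n) - g i\<bar> < e"
  proof (rule eventually_mono)
    fix n assume *: "\<bar>\<phi> (vec d (\<lambda>i. x i + v n i)) - \<phi> (vec d x) - ip d g (v n)\<bar> \<le> e / 2 * nrm d 2 (v n)"
    define N where "N = real (Suc n)"
    have N: "0 < N" by (simp add: N_def)
    have "nrm d 2 (v n) = 1 / N" "ip d g (v n) = g i * (1 / N)"
      unfolding v_def N_def using assms(2) by (simp_all add: nrm_single ip_single)
    then have "\<bar>\<phi> (vec d (\<lambda>i. x i + v n i)) - \<phi> (vec d x) - g i * (1 / N)\<bar> * N \<le> e / 2 * (1 / N) * N"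
      using * N by (intro mult_right_mono) auto
    then have "\<bar>(\<phi> (vec d (\<lambda>i. x i + v n i)) - \<phi> (vec d x) - g i * (1 / N)) * N\<bar> \<le> e / 2"
      using N by (simp add: abs_mult)
    then show "\<bar>(\<phi> (vec d (\<lambda>j. x j + v n j)) - \<phi> (vec d x)) * real (Suc n) - g i\<bar> < e"
      using N e unfolding N_def[symmetric] by (simp add: left_diff_distrib)
  qed
  then show "\<exists>no. \<forall>n\<ge>no. norm ((\<phi> (vec d (\<lambda>j. x j + (if j = i then 1 / real (Suc n) else 0))) - \<phi> (vec d x)) * real (Suc n) - g i) < e"
    unfolding v_def eventually_sequentially real_norm_def .
qed

lemma nrm_le_nrm_2: "1 \<le> p \<Longrightarrow> nrm d p v \<le> real d * nrm d 2 v"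
proof -
  assume "1 \<le> p"
  then have "nrm d p v \<le> (\<Sum>i<d. \<bar>v i\<bar>)" by (rule nrm_le_sum_abs)
  also have "\<dots> \<le> (\<Sum>i<d. nrm d 2 v)" by (intro sum_mono abs_le_nrm) auto
  finally show ?thesis by simp
qed

lemma mirror_conj_vec: "mirror_conj p (vec d z) = mconj d p z"
  by (simp add: mirror_conj_def mconj_def lp_norm_vec)

text \<open>Hoelder followed by Young. It holds for every exponent above 1, hence for the conjugate
  map with exponent \<open>p\<close> as well as for the mirror map, whose exponent is below
  2.\<close>

lemma mconj_subgradient:
  assumes p: "1 < p"
  shows "mconj d p y + ip d (mgrad d p y) (\<lambda>i. z i - y i) \<le> mconj d p z"
proof -
  define q where "q = p / (p - 1)"
  have pq: "conjugate_exponents p q" unfolding q_def using p by (rule conjugate_exponentsI)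
  have "ip d (dualv d p y) z \<le> nrm d q (dualv d p y) * nrm d p z"
    using ip_le_nrm[OF conjugate_exponents_sym[OF pq]] .
  also have "2 * \<dots> \<le> (nrm d p y)\<^sup>2 + (nrm d p z)\<^sup>2"
    using sum_squares_bound[of "nrm d p y" "nrm d p z"] by (simp add: nrm_dualv[OF pq])
  finally have "((nrm d p y)\<^sup>2 + 2 * (ip d (dualv d p y) z - (nrm d p y)\<^sup>2)) / (2 * (p - 1)) \<le> (nrm d p z)\<^sup>2 / (2 * (p - 1))"
    using p by (intro divide_right_mono) auto
  moreover have "((nrm d p y)\<^sup>2 + 2 * (ip d (dualv d p y) z - (nrm d p y)\<^sup>2)) / (2 * (p - 1))
     = mconj d p y + ip d (mgrad d p y) (\<lambda>i. z i - y i)"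
  proof -
    have *: "(a + 2 * (b - a)) / (2 * c) = a / (2 * c) + 1 / c * (b - a)" if "c \<noteq> 0" for a b c :: real
      using that by (simp add: field_simps)
    show ?thesis unfolding mconj_def mgrad_scale ip_scale_left ip_diff_right ip_dualv[OF p]
      by (rule *) (use p in simp)
  qed
  ultimately show ?thesis by (simp add: mconj_def)
qed

text \<open>The remainder is nonnegative by the subgradient inequality and at most half the squared
  \<open>p\<close>-norm of \<open>v\<close> by smoothness. The comparison with the Euclidean norm is
  crude but suffices for a limit.\<close>

lemma has_gradient_mirror_conj:
  assumes p: "2 < p"
  shows "has_gradient d (mirror_conj p) (vec d (mgrad d p z)) (vec d z)"
  unfolding has_gradient_vec
proof (intro allI impI)
  fix e :: real assume e: "0 < e"
  \<comment> \<open>As \<open>d\<close> is arbitrary here, \<open>d + 1\<close> avoids a zero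
    denominator.\<close>
  define \<delta> where "\<delta> = 2 * e / (real d + 1)\<^sup>2"
  show "\<exists>\<delta>>0. \<forall>v. nrm d 2 v < \<delta> \<longrightarrow>
     \<bar>mirror_conj p (vec d (\<lambda>i. z i + v i)) - mirror_conj p (vec d z) - ip d (mgrad d p z) v\<bar> \<le> e * nrm d 2 v"
  proof (intro exI[of _ \<delta>] conjI allI impI)
    show "0 < \<delta>" using e by (simp add: \<delta>_def add_nonneg_pos)
    fix v assume v: "nrm d 2 v < \<delta>"
    have "nrm d p v \<le> (real d + 1) * nrm d 2 v"
      using nrm_le_nrm_2[of p d v] p add_increasing2[OF nrm_nonneg[of d 2 v]] by (simp add: distrib_right)
    then have "(nrm d p v)\<^sup>2 \<le> ((real d + 1) * nrm d 2 v)\<^sup>2" by (intro power_mono) auto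
    also have "\<dots> = (real d + 1)\<^sup>2 * nrm d 2 v * nrm d 2 v" by (simp add: power2_eq_square)
    also have "\<dots> \<le> (real d + 1)\<^sup>2 * \<delta> * nrm d 2 v"
      using v by (intro mult_right_mono mult_left_mono) auto
    also have "\<dots> = 2 * e * nrm d 2 v" unfolding \<delta>_def by (simp add: add_nonneg_eq_0_iff)
    finally have "(nrm d p v)\<^sup>2 / 2 \<le> e * nrm d 2 v" by simp
    moreover have "0 \<le> mconj d p (\<lambda>i. z i + v i) - mconj d p z - ip d (mgrad d p z) v"
      using mconj_subgradient[of p d z "\<lambda>i. z i + v i"] p by simp
    moreover note mconj_smooth[OF p, of d z v]
    ultimately show "\<bar>mirror_conj p (vec d (\<lambda>i. z i + v i)) - mirror_conj p (vec d z) - ip d (mgrad d p z) v\<bar> \<le> e * nrm d 2 v"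
      unfolding mirror_conj_vec by linarith
  qed
qed

lemma mirror_inv_vec: "2 < p \<Longrightarrow> mirror_inv d p (vec d z) = vec d (mgrad d p z)"
  unfolding mirror_inv_def by (intro gradient_eqI has_gradient_mirror_conj) auto

lemma mirror_map_vec:
  "1 < p \<Longrightarrow> mirror_map p (vec d w) = mconj d (p / (p - 1)) w"
  by (simp add: mirror_map_def mconj_def lp_norm_vec Let_def)

lemma tendsto_abs_powr_sgn:
  fixes f :: "nat \<Rightarrow> real"
  assumes "f \<longlonglongrightarrow> x" "0 < a"
  shows "(\<lambda>n. \<bar>f n\<bar> powr a * sgn (f n)) \<longlonglongrightarrow> \<bar>x\<bar> powr a * sgn x"
proof (cases "x = 0")
  case False
  then show ?thesis using assms by (intro tendsto_intros) auto
next
  case True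
  have "(\<lambda>n. \<bar>f n\<bar> powr a * sgn (f n)) \<longlonglongrightarrow> 0"
  proof (rule Lim_null_comparison)
    show "\<forall>\<^sub>F n in sequentially. norm (\<bar>f n\<bar> powr a * sgn (f n)) \<le> \<bar>f n\<bar> powr a"
      by (simp add: abs_mult abs_sgn_eq)
    have "(\<lambda>n. \<bar>f n\<bar> powr a) \<longlonglongrightarrow> \<bar>x\<bar> powr a"
      using assms by (intro tendsto_powr' tendsto_rabs tendsto_const) auto
    then show "(\<lambda>n. \<bar>f n\<bar> powr a) \<longlonglongrightarrow> 0" using True by simp
  qed
  then show ?thesis using True by simp
qed

text \<open>For \<open>r < 2\<close> the exponent \<open>2 - r\<close> is positive, so the
  normalising factor is continuous even at the zero vector.\<close>

lemma dualv_tendsto: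
  assumes y: "\<And>i. i < d \<Longrightarrow> (\<lambda>n. y n i) \<longlonglongrightarrow> x i" and i: "i < d" and r: "1 < r" "r < 2"
  shows "(\<lambda>n. dualv d r (y n) i) \<longlonglongrightarrow> dualv d r x i"
proof -
  have "(\<lambda>n. \<Sum>i<d. \<bar>y n i\<bar> powr r) \<longlonglongrightarrow> (\<Sum>i<d. \<bar>x i\<bar> powr r)"
    using y r by (intro tendsto_sum tendsto_powr' tendsto_rabs tendsto_const) auto
  then have "(\<lambda>n. nrm d r (y n)) \<longlonglongrightarrow> nrm d r x"
    unfolding nrm_def using r by (intro tendsto_powr' tendsto_const) (auto simp: sum_nonneg)
  then have "(\<lambda>n. nrm d r (y n) powr (2 - r)) \<longlonglongrightarrow> nrm d r x powr (2 - r)"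
    using r by (intro tendsto_powr' tendsto_const) auto
  from tendsto_mult[OF this tendsto_abs_powr_sgn[OF y[OF i], of "r - 1"]] show ?thesis
    using r by (simp add: dualv_def mult.assoc)
qed

text \<open>For exponents below 2 the mirror map has no quadratic upper bound; differentiability follows
  from convexity and the continuity of the explicit gradient formula.\<close>

lemma has_gradient_mconj_small:
  assumes r: "1 < r" "r < 2" and \<phi>: "\<And>x. \<phi> (vec d x) = mconj d r x"
  shows "has_gradient d \<phi> (vec d (mgrad d r x)) (vec d x)"
  unfolding has_gradient_vec
proof (intro allI impI, rule ccontr)
  fix e :: real assume e: "0 < e"
  assume neg: "\<not> (\<exists>\<delta>>0. \<forall>v. nrm d 2 v < \<delta> \<longrightarrow>
     \<bar>\<phi> (vec d (\<lambda>i. x i + v i)) - \<phi> (vec d x) - ip d (mgrad d r x) v\<bar> \<le> e * nrm d 2 v)"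
  have "\<exists>v. nrm d 2 v < 1 / real (Suc n) \<and>
     e * nrm d 2 v < \<bar>\<phi> (vec d (\<lambda>i. x i + v i)) - \<phi> (vec d x) - ip d (mgrad d r x) v\<bar>" for n
  proof -
    have "0 < 1 / real (Suc n)" by simp
    then show ?thesis using neg by (meson not_le)
  qed
  then obtain v where v: "nrm d 2 (v n) < 1 / real (Suc n)"
     "e * nrm d 2 (v n) < \<bar>\<phi> (vec d (\<lambda>i. x i + v n i)) - \<phi> (vec d x) - ip d (mgrad d r x) (v n)\<bar>" for n
    using choice[of "\<lambda>n v. nrm d 2 v < 1 / real (Suc n) \<and>
     e * nrm d 2 v < \<bar>\<phi> (vec d (\<lambda>i. x i + v i)) - \<phi> (vec d x) - ip d (mgrad d r x) v\<bar>"] by blast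
  have v0: "(\<lambda>n. v n i) \<longlonglongrightarrow> 0" if "i < d" for i
  proof (rule Lim_null_comparison)
    show "\<forall>\<^sub>F n in sequentially. norm (v n i) \<le> 1 / real (Suc n)"
    proof (intro always_eventually allI)
      fix n
      have "\<bar>v n i\<bar> \<le> nrm d 2 (v n)" using that by (intro abs_le_nrm) auto
      then show "norm (v n i) \<le> 1 / real (Suc n)" using v(1)[of n] by simp
    qed
    show "(\<lambda>n. 1 / real (Suc n)) \<longlonglongrightarrow> 0"
      using LIMSEQ_inverse_real_of_nat by (simp add: inverse_eq_divide)
  qed
  \<comment> \<open>The subgradient inequalities at both endpoints place the remainder between 0 and
    the pairing of \<open>v n\<close> with the gradient change \<open>?D n\<close>. A remainder
    above \<open>e\<close> times the norm of \<open>v n\<close> therefore keeps the norm of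
    \<open>?D n\<close> above \<open>e\<close>, although it must tend to 0.\<close>
  let ?D = "\<lambda>n i. mgrad d r (\<lambda>i. x i + v n i) i - mgrad d r x i"
  have c2: "conjugate_exponents 2 2" by (simp add: conjugate_exponents_def)
  have "e * nrm d 2 (v n) < nrm d 2 (?D n) * nrm d 2 (v n)" for n
  proof -
    have "0 \<le> mconj d r (\<lambda>i. x i + v n i) - mconj d r x - ip d (mgrad d r x) (v n)"
      using mconj_subgradient[OF r(1), of d x "\<lambda>i. x i + v n i"] by simp
    moreover have "mconj d r (\<lambda>i. x i + v n i) - mconj d r x - ip d (mgrad d r x) (v n) \<le> ip d (?D n) (v n)"
      using mconj_subgradient[OF r(1), of d "\<lambda>i. x i + v n i" x]
      by (simp add: ip_diff_left ip_scale_right[of _ _ "-1", simplified])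
    moreover have "ip d (?D n) (v n) \<le> nrm d 2 (?D n) * nrm d 2 (v n)" by (rule ip_le_nrm[OF c2])
    ultimately show ?thesis using v(2)[of n] unfolding \<phi> by linarith
  qed
  then have big: "e < nrm d 2 (?D n)" for n
    by (meson mult_right_mono not_less nrm_nonneg)
  have "(\<lambda>n. ?D n i) \<longlonglongrightarrow> 0" if "i < d" for i
  proof -
    have "(\<lambda>n. x j + v n j) \<longlonglongrightarrow> x j" if "j < d" for j using tendsto_add[OF tendsto_const v0[OF that]] by simp
    from dualv_tendsto[OF this \<open>i < d\<close> r] have "(\<lambda>n. mgrad d r (\<lambda>i. x i + v n i) i) \<longlonglongrightarrow> mgrad d r x i"
      unfolding mgrad_def using r by (intro tendsto_divide) auto
    then show ?thesis by (simp add: LIM_zero_iff)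
  qed
  then have "(\<lambda>n. nrm d 2 (?D n)) \<longlonglongrightarrow> 0" by (intro nrm_tendsto_0) auto
  then have "\<forall>\<^sub>F n in sequentially. nrm d 2 (?D n) < e" using e by (rule order_tendstoD(2))
  then show False using big by (auto simp: eventually_sequentially less_le_not_le)
qed

lemma gradient_mirror_map:
  assumes "2 < p"
  shows "gradient d (mirror_map p) (vec d w) = vec d (mgrad d (p / (p - 1)) w)"
proof (rule gradient_eqI[OF has_gradient_mconj_small])
  show "1 < p / (p - 1)" "p / (p - 1) < 2" using assms by (auto simp: field_simps)
qed (use assms in \<open>auto simp: mirror_map_vec\<close>)

text \<open>The value of the conjugate at the gradient, and Euler's identity for a 2-homogeneous
  function; together they evaluate the potential and the divergence at the starting point.\<close>

lemma mconj_mgrad: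
  assumes pq: "conjugate_exponents p q"
  shows "mconj d p (mgrad d q w) = mconj d q w" "ip d (mgrad d q w) w = 2 * mconj d q w"
proof -
  have q: "1 < q" "1 < p" "(p - 1) * (q - 1) = 1"
    using pq conjugate_exponents_mult[OF pq] by (auto simp: conjugate_exponents_def)
  have "nrm d p (mgrad d q w) = \<bar>1 / (q - 1)\<bar> * nrm d p (dualv d q w)"
    unfolding mgrad_scale using q by (intro nrm_scale) simp
  then have "nrm d p (mgrad d q w) = (p - 1) * nrm d q w"
  proof -
    have "1 / (q - 1) = p - 1" using q by (simp add: divide_simps)
    moreover have "\<bar>p - 1\<bar> = p - 1" using q by simp
    ultimately show ?thesis
      using \<open>nrm d p (mgrad d q w) = _\<close> by (simp only: nrm_dualv[OF conjugate_exponents_sym[OF pq]])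
  qed
  then have "mconj d p (mgrad d q w) = (p - 1) * (nrm d q w)\<^sup>2 / 2"
    using q by (simp add: mconj_def power_mult_distrib divide_simps) (simp add: power2_eq_square)
  also have "\<dots> = ((p - 1) * (q - 1)) * (nrm d q w)\<^sup>2 / (2 * (q - 1))" using q(1) by (simp add: divide_simps)
  finally show "mconj d p (mgrad d q w) = mconj d q w" using q(3) by (simp add: mconj_def)
  show "ip d (mgrad d q w) w = 2 * mconj d q w"
    unfolding mgrad_scale ip_scale_left ip_dualv[OF q(1)] mconj_def using q by (simp add: divide_simps)
qed

section \<open>Measurability, independence and second moments\<close>

text \<open>Lists code the rounded vectors in a countable type, where measurability can be checked
  on a discrete space.\<close>

lemma measurable_list_of_ints:
  fixes c :: "'a \<Rightarrow> nat \<Rightarrow> int"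
  assumes "\<And>i. i < d \<Longrightarrow> (\<lambda>a. c a i) \<in> measurable N (count_space UNIV)"
  shows "(\<lambda>a. map (c a) [0..<d]) \<in> measurable N (count_space UNIV)"
  using assms
proof (induction d)
  case (Suc d)
  have "(\<lambda>(l, x). l @ [x]) \<in> measurable (count_space UNIV \<Otimes>\<^sub>M count_space (UNIV :: int set)) (count_space UNIV)"
    by (subst pair_measure_countable) auto
  moreover have "(\<lambda>a. (map (c a) [0..<d], c a d)) \<in> measurable N (count_space UNIV \<Otimes>\<^sub>M count_space UNIV)"
    using Suc by (intro measurable_Pair) auto
  ultimately show ?case using measurable_compose by fastforce
qed simp

text \<open>Rounding every coordinate of the random point to the grid of mesh \<open>1 / (n + 1)\<close> leaves
  countably many values; the limit \<open>n \<rightarrow> \<infinity>\<close> is harmless by continuity.\<close>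

lemma caratheodory_measurable:
  fixes \<Phi> :: "(nat \<Rightarrow> real) \<Rightarrow> 'x \<Rightarrow> real"
  assumes meas: "\<And>w. \<Phi> w \<in> borel_measurable S"
    and cont: "\<And>x w y. x \<in> space S \<Longrightarrow> (\<And>i. i < d \<Longrightarrow> (\<lambda>n. y n i) \<longlonglongrightarrow> w i) \<Longrightarrow> (\<lambda>n. \<Phi> (y n) x) \<longlonglongrightarrow> \<Phi> w x"
    and W: "\<And>i. i < d \<Longrightarrow> (\<lambda>a. W a i) \<in> borel_measurable N"
    and X: "X \<in> measurable N S"
  shows "(\<lambda>a. \<Phi> (W a) (X a)) \<in> borel_measurable N"
proof -
  define c where "c n a i = \<lfloor>real (Suc n) * W a i\<rfloor>" for n a i
  define h where "h n l i = (real_of_int (l ! i) / real (Suc n))" for n l i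
  define g where "g n a = map (c n a) [0..<d]" for n a
  have "(\<lambda>a. \<Phi> (h n (g n a)) (X a)) \<in> borel_measurable N" for n
  proof (rule measurable_compose_countable[of "\<lambda>l a. \<Phi> (h n l) (X a)" N borel "g n"])
    show "(\<lambda>a. \<Phi> (h n l) (X a)) \<in> borel_measurable N" for l
      by (rule measurable_compose[OF X meas])
    have "(\<lambda>a. c n a i) \<in> measurable N (count_space UNIV)" if "i < d" for i
      unfolding c_def using W[OF that] by measurable
    then show "g n \<in> measurable N (count_space UNIV)"
      unfolding g_def by (rule measurable_list_of_ints)
  qed
  then show ?thesis
  proof (rule borel_measurable_LIMSEQ_real[rotated])
    fix a assume a: "a \<in> space N"
    show "(\<lambda>n. \<Phi> (h n (g n a)) (X a)) \<longlonglongrightarrow> \<Phi> (W a) (X a)"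
    proof (rule cont)
      show "X a \<in> space S" using X a by (rule measurable_space)
      fix i assume i: "i < d"
      have eq: "h n (g n a) i = real_of_int \<lfloor>real (Suc n) * W a i\<rfloor> / real (Suc n)" for n
        using i by (simp add: h_def g_def c_def)
      show "(\<lambda>n. h n (g n a) i) \<longlonglongrightarrow> W a i"
        unfolding eq
      proof (rule tendsto_sandwich)
        show "\<forall>\<^sub>F n in sequentially. W a i - 1 / real (Suc n) \<le> real_of_int \<lfloor>real (Suc n) * W a i\<rfloor> / real (Suc n)"
        proof (intro always_eventually allI)
          fix n
          have "real (Suc n) * W a i - 1 \<le> real_of_int \<lfloor>real (Suc n) * W a i\<rfloor>" by linarith
          then have "(real (Suc n) * W a i - 1) / real (Suc n) \<le> real_of_int \<lfloor>real (Suc n) * W a i\<rfloor> / real (Suc n)"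
            by (intro divide_right_mono) auto
          then show "W a i - 1 / real (Suc n) \<le> real_of_int \<lfloor>real (Suc n) * W a i\<rfloor> / real (Suc n)"
            by (simp add: diff_divide_distrib del: of_nat_Suc)
        qed
        show "\<forall>\<^sub>F n in sequentially. real_of_int \<lfloor>real (Suc n) * W a i\<rfloor> / real (Suc n) \<le> W a i"
        proof (intro always_eventually allI)
          fix n
          have "real_of_int \<lfloor>real (Suc n) * W a i\<rfloor> / real (Suc n) \<le> real (Suc n) * W a i / real (Suc n)"
            by (intro divide_right_mono) auto
          then show "real_of_int \<lfloor>real (Suc n) * W a i\<rfloor> / real (Suc n) \<le> W a i" by (simp del: of_nat_Suc)
        qed
        show "(\<lambda>n. W a i - 1 / real (Suc n)) \<longlonglongrightarrow> W a i"
          using tendsto_diff[OF tendsto_const[of "W a i"] LIMSEQ_inverse_real_of_nat] by (simp add: inverse_eq_divide)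
      qed simp
    qed
  qed
qed

text \<open>Freezing: independence makes the joint law a product, and Fubini integrates over
  \<open>Y\<close> first with the value of \<open>X\<close> held fixed.\<close>

lemma (in prob_space) indep_expectation_zero:
  fixes g :: "'b \<Rightarrow> 'b \<Rightarrow> real"
  assumes ind: "indep_var S X T Y"
    and g: "(\<lambda>(a, y). g a y) \<in> borel_measurable (S \<Otimes>\<^sub>M T)"
    and int: "integrable M (\<lambda>\<omega>. g (X \<omega>) (Y \<omega>))"
    and zero: "\<And>a. a \<in> space S \<Longrightarrow> (\<integral>y. g a y \<partial>distr M T Y) = 0"
  shows "expectation (\<lambda>\<omega>. g (X \<omega>) (Y \<omega>)) = 0"
proof -
  have rv: "X \<in> measurable M S" "Y \<in> measurable M T"
    and eq: "distr M S X \<Otimes>\<^sub>M distr M T Y = distr M (S \<Otimes>\<^sub>M T) (\<lambda>\<omega>. (X \<omega>, Y \<omega>))"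
    using ind unfolding indep_var_distribution_eq by auto
  interpret SX: prob_space "distr M S X" using rv by (intro prob_space_distr)
  interpret TY: prob_space "distr M T Y" using rv by (intro prob_space_distr)
  interpret P: pair_sigma_finite "distr M S X" "distr M T Y" ..
  have pair: "(\<lambda>\<omega>. (X \<omega>, Y \<omega>)) \<in> measurable M (S \<Otimes>\<^sub>M T)" using rv by simp
  have int': "integrable (distr M S X \<Otimes>\<^sub>M distr M T Y) (\<lambda>(a, y). g a y)"
    unfolding eq using int g pair by (subst integrable_distr_eq) auto
  have "expectation (\<lambda>\<omega>. g (X \<omega>) (Y \<omega>)) = (\<integral>z. (case z of (a, y) \<Rightarrow> g a y) \<partial>(distr M S X \<Otimes>\<^sub>M distr M T Y))"
    unfolding eq using g pair by (subst integral_distr) auto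
  also have "\<dots> = (\<integral>a. (\<integral>y. g a y \<partial>distr M T Y) \<partial>distr M S X)"
    using P.integral_fst'[OF int'] by simp
  also have "\<dots> = (\<integral>a. 0 \<partial>distr M S X)"
    by (intro Bochner_Integration.integral_cong) (auto simp: zero)
  finally show ?thesis by simp
qed

text \<open>Freezing with Tonelli in place of Fubini. Integrability belongs to the conclusion, so
  the bound is first proved for the nonnegative integral.\<close>

lemma (in prob_space) indep_expectation_le:
  fixes g :: "'b \<Rightarrow> 'b \<Rightarrow> real"
  assumes ind: "indep_var S X T Y"
    and g: "(\<lambda>(a, y). g a y) \<in> borel_measurable (S \<Otimes>\<^sub>M T)"
    and nonneg: "\<And>a y. 0 \<le> g a y"
    and int: "\<And>a. a \<in> space S \<Longrightarrow> integrable (distr M T Y) (g a)"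
    and le: "\<And>a. a \<in> space S \<Longrightarrow> (\<integral>y. g a y \<partial>distr M T Y) \<le> B"
    and B: "0 \<le> B"
  shows "integrable M (\<lambda>\<omega>. g (X \<omega>) (Y \<omega>)) \<and> expectation (\<lambda>\<omega>. g (X \<omega>) (Y \<omega>)) \<le> B"
proof -
  have rv: "X \<in> measurable M S" "Y \<in> measurable M T"
    and eq: "distr M S X \<Otimes>\<^sub>M distr M T Y = distr M (S \<Otimes>\<^sub>M T) (\<lambda>\<omega>. (X \<omega>, Y \<omega>))"
    using ind unfolding indep_var_distribution_eq by auto
  interpret SX: prob_space "distr M S X" using rv by (intro prob_space_distr)
  interpret TY: prob_space "distr M T Y" using rv by (intro prob_space_distr)
  have pair: "(\<lambda>\<omega>. (X \<omega>, Y \<omega>)) \<in> measurable M (S \<Otimes>\<^sub>M T)" using rv by simp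
  have m: "(\<lambda>\<omega>. g (X \<omega>) (Y \<omega>)) \<in> borel_measurable M"
    using measurable_compose[OF pair g] by simp
  have "(\<integral>\<^sup>+\<omega>. ennreal (g (X \<omega>) (Y \<omega>)) \<partial>M) = (\<integral>\<^sup>+z. ennreal (case z of (a, y) \<Rightarrow> g a y) \<partial>(distr M S X \<Otimes>\<^sub>M distr M T Y))"
    unfolding eq using g pair by (subst nn_integral_distr) auto
  also have "\<dots> = (\<integral>\<^sup>+a. (\<integral>\<^sup>+y. ennreal (g a y) \<partial>distr M T Y) \<partial>distr M S X)"
    using g by (subst TY.nn_integral_fst[symmetric]) (auto cong: measurable_cong_sets)
  also have "\<dots> \<le> (\<integral>\<^sup>+a. ennreal B \<partial>distr M S X)"
  proof (intro nn_integral_mono)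
    fix a assume "a \<in> space (distr M S X)"
    then have a: "a \<in> space S" by simp
    have "(\<integral>\<^sup>+y. ennreal (g a y) \<partial>distr M T Y) = ennreal (\<integral>y. g a y \<partial>distr M T Y)"
      using int[OF a] nonneg by (intro nn_integral_eq_integral) auto
    then show "(\<integral>\<^sup>+y. ennreal (g a y) \<partial>distr M T Y) \<le> ennreal B"
      using le[OF a] by (simp add: ennreal_leI)
  qed
  also have "\<dots> = ennreal B" using SX.emeasure_space_1 by simp
  finally have bound: "(\<integral>\<^sup>+\<omega>. ennreal (g (X \<omega>) (Y \<omega>)) \<partial>M) \<le> ennreal B" .
  then have i: "integrable M (\<lambda>\<omega>. g (X \<omega>) (Y \<omega>))"
    using m nonneg by (intro integrableI_nonneg) (auto simp: top_unique intro: le_less_trans)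
  moreover have "expectation (\<lambda>\<omega>. g (X \<omega>) (Y \<omega>)) \<le> B"
    using bound nn_integral_eq_integral[OF i] nonneg B by (simp add: ennreal_le_iff)
  ultimately show ?thesis by blast
qed

text \<open>Second moments are propagated because products of two such variables are integrable,
  which the orthogonality of noise and past requires.\<close>

definition square_integrable :: "'w measure \<Rightarrow> ('w \<Rightarrow> real) \<Rightarrow> bool" where
  "square_integrable P X \<longleftrightarrow> X \<in> borel_measurable P \<and> integrable P (\<lambda>\<omega>. (X \<omega>)\<^sup>2)"

lemma square_integrable_mult:
  assumes "square_integrable P X" "square_integrable P Y"
  shows "integrable P (\<lambda>\<omega>. X \<omega> * Y \<omega>)"
proof (rule Bochner_Integration.integrable_bound)
  show "integrable P (\<lambda>\<omega>. (X \<omega>)\<^sup>2 + (Y \<omega>)\<^sup>2)" "(\<lambda>\<omega>. X \<omega> * Y \<omega>) \<in> borel_measurable P"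
    using assms by (auto simp: square_integrable_def)
  have "\<bar>a * b\<bar> \<le> a\<^sup>2 + b\<^sup>2" for a b :: real
  proof -
    have "2 * \<bar>a * b\<bar> \<le> a\<^sup>2 + b\<^sup>2"
      using sum_squares_bound[of "\<bar>a\<bar>" "\<bar>b\<bar>"] by (simp add: abs_mult)
    then show ?thesis using abs_ge_zero[of "a * b"] by linarith
  qed
  then show "AE \<omega> in P. norm (X \<omega> * Y \<omega>) \<le> norm ((X \<omega>)\<^sup>2 + (Y \<omega>)\<^sup>2)" by simp
qed

lemma square_integrable_add:
  assumes "square_integrable P X" "square_integrable P Y"
  shows "square_integrable P (\<lambda>\<omega>. X \<omega> + Y \<omega>)"
  using assms square_integrable_mult[OF assms] by (auto simp: square_integrable_def power2_sum mult.assoc)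

lemma square_integrable_scale: "square_integrable P X \<Longrightarrow> square_integrable P (\<lambda>\<omega>. c * X \<omega>)"
  by (auto simp: square_integrable_def power_mult_distrib)

lemma square_integrable_diff:
  assumes "square_integrable P X" "square_integrable P Y"
  shows "square_integrable P (\<lambda>\<omega>. X \<omega> - Y \<omega>)"
  using square_integrable_add[OF assms(1) square_integrable_scale[OF assms(2), of "-1"]] by simp

lemma square_integrable_const: "prob_space P \<Longrightarrow> square_integrable P (\<lambda>\<omega>. c)"
  by (simp add: square_integrable_def prob_space.finite_measure finite_measure.integrable_const)

lemma square_integrable_sum:
  assumes "prob_space P" "\<And>i. i \<in> A \<Longrightarrow> square_integrable P (X i)"
  shows "square_integrable P (\<lambda>\<omega>. \<Sum>i\<in>A. X i \<omega>)"
  using assms(2)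
proof (induction A rule: infinite_finite_induct)
  case (insert i A)
  then show ?case by (simp add: square_integrable_add)
qed (simp_all add: square_integrable_const assms(1))

lemma square_integrable_bound:
  assumes "square_integrable P Y" "X \<in> borel_measurable P" "\<And>\<omega>. \<omega> \<in> space P \<Longrightarrow> \<bar>X \<omega>\<bar> \<le> Y \<omega>"
  shows "square_integrable P X"
  unfolding square_integrable_def
proof
  show "integrable P (\<lambda>\<omega>. (X \<omega>)\<^sup>2)"
  proof (rule Bochner_Integration.integrable_bound)
    show "integrable P (\<lambda>\<omega>. (Y \<omega>)\<^sup>2)" using assms by (simp add: square_integrable_def)
    show "AE \<omega> in P. norm ((X \<omega>)\<^sup>2) \<le> norm ((Y \<omega>)\<^sup>2)"
    proof (rule AE_I2)
      fix \<omega> assume "\<omega> \<in> space P"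
      then have "\<bar>X \<omega>\<bar>\<^sup>2 \<le> (Y \<omega>)\<^sup>2" using assms(3) by (intro power_mono) auto
      then show "norm ((X \<omega>)\<^sup>2) \<le> norm ((Y \<omega>)\<^sup>2)" by simp
    qed
  qed (use assms(2) in measurable)
qed (fact assms(2))

lemma square_integrable_abs: "square_integrable P X \<Longrightarrow> square_integrable P (\<lambda>\<omega>. \<bar>X \<omega>\<bar>)"
  by (auto simp: square_integrable_def)

lemma square_integrable_integrable:
  assumes "prob_space P" "square_integrable P X" shows "integrable P X"
  using square_integrable_mult[OF assms(2) square_integrable_const[OF assms(1), of 1]] by simp

text \<open>With parameter \<open>1 / \<rho>\<close> in the moment generating functions and threshold \<open>t = ln d\<close>, the part of
  \<open>u\<^sup>2\<close> above \<open>t\<^sup>2\<close> is dominated by exponentials, whose sum over the coordinates is of order \<open>t\<close>.\<close>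

lemma square_le_exp:
  fixes u t :: real assumes "0 \<le> t"
  shows "u\<^sup>2 \<le> t\<^sup>2 + (2 * t + 2) * (exp (u - t) + exp (- u - t))"
proof -
  have main: "v\<^sup>2 \<le> t\<^sup>2 + (2 * t + 2) * exp (v - t)" if "0 \<le> v" for v :: real
  proof (cases "v \<le> t")
    case True
    then have "v\<^sup>2 \<le> t\<^sup>2" using that by (intro power_mono) auto
    then show ?thesis using assms by (simp add: add_increasing2)
  next
    case False
    define s where "s = v - t"
    have s: "0 \<le> s" using False by (simp add: s_def)
    have "s \<le> exp s" using exp_ge_add_one_self[of s] by linarith
    moreover have "s\<^sup>2 \<le> 2 * exp s" using exp_lower_Taylor_quadratic[OF s] s by simp
    ultimately have "2 * t * s + s\<^sup>2 \<le> 2 * t * exp s + 2 * exp s"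
      using assms by (intro add_mono mult_left_mono) auto
    then show ?thesis by (simp add: s_def power2_eq_square algebra_simps)
  qed
  show ?thesis
  proof (cases "0 \<le> u")
    case True
    have "0 \<le> (2 * t + 2) * exp (- u - t)" using assms by simp
    then show ?thesis using main[OF True] by (simp add: distrib_left)
  next
    case False
    have "0 \<le> (2 * t + 2) * exp (u - t)" using assms by simp
    then show ?thesis using main[of "- u"] False by (simp add: distrib_left)
  qed
qed

text \<open>Values at a random point are measurable by continuity in the point, and partial
  derivatives are limits of difference quotients of such values.\<close>

lemma grad_measurable:
  fixes \<Phi> :: "real vec \<Rightarrow> 'x \<Rightarrow> real"
  assumes meas: "\<And>w. w \<in> carrier_vec d \<Longrightarrow> \<Phi> w \<in> borel_measurable S"
    and diff: "\<And>x. x \<in> space S \<Longrightarrow> differentiable_everywhere d (\<lambda>w. \<Phi> w x)"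
    and W: "\<And>i. i < d \<Longrightarrow> (\<lambda>a. W a i) \<in> borel_measurable N"
    and X: "X \<in> measurable N S"
  shows "(\<lambda>a. \<Phi> (vec d (W a)) (X a)) \<in> borel_measurable N"
    and "i < d \<Longrightarrow> (\<lambda>a. gradient d (\<lambda>w. \<Phi> w (X a)) (vec d (W a)) $ i) \<in> borel_measurable N"
proof -
  have grad: "has_gradient d (\<lambda>w. \<Phi> w x) (vec d (\<lambda>i. gradient d (\<lambda>w. \<Phi> w x) (vec d w) $ i)) (vec d w)"
    if "x \<in> space S" for x w
    using has_gradient_gradient[OF diff[OF that], of "vec d w"] gradient_carrier[OF diff[OF that], of "vec d w"]
    by (metis carrier_eq_vec vec_carrier)
  have val: "(\<lambda>a. \<Phi> (vec d (V a)) (X a)) \<in> borel_measurable N"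
    if V: "\<And>i. i < d \<Longrightarrow> (\<lambda>a. V a i) \<in> borel_measurable N" for V
  proof (rule caratheodory_measurable[where \<Phi> = "\<lambda>w x. \<Phi> (vec d w) x" and d = d and S = S])
    show "\<Phi> (vec d w) \<in> borel_measurable S" for w by (rule meas) simp
  next
    fix x w and y :: "nat \<Rightarrow> nat \<Rightarrow> real"
    assume "x \<in> space S" "\<And>i. i < d \<Longrightarrow> (\<lambda>n. y n i) \<longlonglongrightarrow> w i"
    then show "(\<lambda>n. \<Phi> (vec d (y n)) x) \<longlonglongrightarrow> \<Phi> (vec d w) x"
      by (rule has_gradient_continuous[OF grad])
  qed (use V X in auto)
  show "(\<lambda>a. \<Phi> (vec d (W a)) (X a)) \<in> borel_measurable N" by (rule val[OF W])
  assume i: "i < d"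
  show "(\<lambda>a. gradient d (\<lambda>w. \<Phi> w (X a)) (vec d (W a)) $ i) \<in> borel_measurable N"
  proof (rule borel_measurable_LIMSEQ_real)
    fix a assume "a \<in> space N"
    then have "X a \<in> space S" using X by (rule measurable_space[rotated])
    from has_gradient_partial[OF grad[OF this] i]
    show "(\<lambda>n. (\<Phi> (vec d (\<lambda>j. W a j + (if j = i then 1 / real (Suc n) else 0))) (X a)
      - \<Phi> (vec d (W a)) (X a)) * real (Suc n)) \<longlonglongrightarrow> gradient d (\<lambda>w. \<Phi> w (X a)) (vec d (W a)) $ i" .
  next
    fix n
    have "(\<lambda>a. \<Phi> (vec d (\<lambda>j. W a j + (if j = i then 1 / real (Suc n) else 0))) (X a)) \<in> borel_measurable N"
      by (rule val) (use W in measurable)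
    then show "(\<lambda>a. (\<Phi> (vec d (\<lambda>j. W a j + (if j = i then 1 / real (Suc n) else 0))) (X a)
      - \<Phi> (vec d (W a)) (X a)) * real (Suc n)) \<in> borel_measurable N"
      using val[OF W] by measurable
  qed
qed

lemma nrm_measurable:
  assumes "\<And>i. i < d \<Longrightarrow> (\<lambda>a. W a i) \<in> borel_measurable N"
  shows "(\<lambda>a. nrm d p (W a)) \<in> borel_measurable N"
  unfolding nrm_def using assms by (intro powr_real_measurable borel_measurable_sum) auto

lemma dualv_measurable:
  assumes "\<And>i. (\<lambda>a. W a i) \<in> borel_measurable N"
  shows "(\<lambda>a. dualv d r (W a) i) \<in> borel_measurable N"
  unfolding dualv_def using assms nrm_measurable[of d W N r]
  by (intro borel_measurable_times powr_real_measurable) auto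

lemma mgrad_measurable:
  assumes "\<And>i. (\<lambda>a. W a i) \<in> borel_measurable N"
  shows "(\<lambda>a. mgrad d r (W a) i) \<in> borel_measurable N"
  unfolding mgrad_def using dualv_measurable[OF assms] by auto

section \<open>Translation of the assumptions and moments of the gradient noise\<close>

context dfedda_setting
begin

lemma ln_d: "1 \<le> ln (real d)"
  using exponent by simp

text \<open>The exponent condition says \<open>ln d \<ge> 1\<close>. For \<open>d \<le> 2\<close>
  the tangent bound \<open>ln d \<le> d - 1\<close> would have to be an equality, which forces
  \<open>d = 1\<close>. Integrality thus turns \<open>2 \<le> p\<close> into
  \<open>2 < p\<close>.\<close>

lemma d_ge_3: "3 \<le> d"
proof (rule ccontr)
  assume "\<not> 3 \<le> d"
  then have le: "real d \<le> 2" by simp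
  have pos: "0 < real d" using ln_d by (cases "d = 0") auto
  then have "ln (real d) = real d - 1" using ln_le_minus_one[OF pos] ln_d le by linarith
  then have "real d = 1" using ln_eq_minus_one[OF pos] by simp
  then show False using ln_d by simp
qed

lemma p_gt_2: "2 < p"
proof -
  have "ln 3 \<le> ln (real d)" using d_ge_3 by simp
  then show ?thesis using ln3_gt_1 exponent by simp
qed

definition q :: real where "q = p / (p - 1)"

lemma pq: "conjugate_exponents p q" and qp: "conjugate_exponents q p"
proof -
  show "conjugate_exponents p q" unfolding q_def using p_gt_2 by (intro conjugate_exponentsI) simp
  then show "conjugate_exponents q p" by (rule conjugate_exponents_sym)
qed

lemma d_powr: "real d powr (1 / p) = exp (1 / 2)"
  using ln_d d_ge_3 exponent by (simp add: powr_def)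

lemma nrm_const: "0 \<le> c \<Longrightarrow> nrm d p (\<lambda>_. c) = exp (1 / 2) * c"
  using p_gt_2 by (simp add: nrm_def powr_mult powr_powr d_powr[symmetric])

lemma nrm_1_le: "nrm d 1 x \<le> exp (1 / 2) * nrm d q x"
proof -
  have "ip d (\<lambda>_. 1) (\<lambda>i. \<bar>x i\<bar>) \<le> nrm d p (\<lambda>_. 1) * nrm d q (\<lambda>i. \<bar>x i\<bar>)"
    by (rule ip_le_nrm[OF pq])
  then show ?thesis unfolding nrm_const[OF zero_le_one] by (simp add: nrm_1 ip_def nrm_def)
qed

lemma nrm_p_le: assumes "\<And>i. i < d \<Longrightarrow> \<bar>x i\<bar> \<le> c" "0 \<le> c" shows "nrm d p x \<le> exp (1 / 2) * c"
proof -
  have "nrm d p x \<le> nrm d p (\<lambda>_. c)" using p_gt_2 assms by (intro nrm_mono) auto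
  then show ?thesis using nrm_const[OF assms(2)] by simp
qed

definition cf :: "nat \<Rightarrow> (nat \<Rightarrow> real) \<Rightarrow> real" where
  "cf m x = client_obj D F m (vec d x)"

text \<open>Entries from \<open>d\<close> on are zero, so that identities between functions,
  stationarity among them, hold at every index.\<close>

definition Gr :: "nat \<Rightarrow> (nat \<Rightarrow> real) \<Rightarrow> nat \<Rightarrow> real" where
  "Gr m x i = (if i < d then gradient d (client_obj D F m) (vec d x) $ i else 0)"

definition sg :: "(nat \<Rightarrow> real) \<Rightarrow> 'x \<Rightarrow> nat \<Rightarrow> real" where
  "sg x y i = (if i < d then stoch_grad d F (vec d x) y $ i else 0)"

definition wsf :: "nat \<Rightarrow> real" where "wsf i = (if i < d then wstar $ i else 0)"

lemma vec_wsf: "vec d wsf = wstar"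
  using minimizer(1) by (intro eq_vecI) (auto simp: wsf_def)

lemma gradient_client:
  assumes "m < M" shows "gradient d (client_obj D F m) (vec d x) = vec d (Gr m x)"
proof -
  have "gradient d (client_obj D F m) (vec d x) \<in> carrier_vec d"
    by (rule gradient_carrier[OF client_differentiable[OF assms]]) simp
  then show ?thesis by (intro eq_vecI) (auto simp: Gr_def)
qed

lemma gradient_stoch:
  assumes "m < M" "y \<in> space (D m)" shows "stoch_grad d F (vec d x) y = vec d (sg x y)"
proof -
  have "stoch_grad d F (vec d x) y \<in> carrier_vec d"
    unfolding stoch_grad_def by (rule gradient_carrier[OF loss_differentiable[OF assms]]) simp
  then show ?thesis by (intro eq_vecI) (auto simp: sg_def)
qed

lemma Gr_lipschitz_inf:
  assumes "m < M" "i < d"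
  shows "\<bar>Gr m x i - Gr m y i\<bar> \<le> L * nrm d 1 (\<lambda>i. x i - y i)"
proof -
  have "\<bar>Gr m x i - Gr m y i\<bar> \<le> linf_norm (vec d (\<lambda>i. Gr m x i - Gr m y i))"
    unfolding linf_norm_def using assms(2) by (intro Max_ge) (auto intro!: image_eqI[of _ _ i])
  also have "\<dots> \<le> L * nrm d 1 (\<lambda>i. x i - y i)"
    using smooth[OF assms(1), of "vec d x" "vec d y"]
    by (simp add: gradient_client[OF assms(1)] vec_diff_vec lp_norm_vec)
  finally show ?thesis .
qed

lemma global_obj_vec: "global_obj M D F (vec d x) = (\<Sum>m<M. cf m x) / real M"
  by (simp add: global_obj_def cf_def)

lemma cf_convex: "m < M \<Longrightarrow> cf m x + ip d (Gr m x) (\<lambda>i. y i - x i) \<le> cf m y"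
  using convex[of m "vec d x" "vec d y"]
  by (simp add: gradient_client vec_diff_vec scalar_prod_vec cf_def)

lemma Gr_lipschitz:
  assumes "m < M"
  shows "nrm d p (\<lambda>i. Gr m x i - Gr m y i) \<le> exp 1 * L * nrm d q (\<lambda>i. x i - y i)"
proof -
  have "nrm d p (\<lambda>i. Gr m x i - Gr m y i) \<le> exp (1 / 2) * (L * nrm d 1 (\<lambda>i. x i - y i))"
    using parameters Gr_lipschitz_inf[OF assms] by (intro nrm_p_le) auto
  also have "\<dots> \<le> exp (1 / 2) * (L * (exp (1 / 2) * nrm d q (\<lambda>i. x i - y i)))"
    using parameters nrm_1_le by (intro mult_left_mono) auto
  also have "\<dots> = (exp (1 / 2) * exp (1 / 2)) * L * nrm d q (\<lambda>i. x i - y i)" by simp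
  also have "exp (1 / 2) * exp (1 / 2) = (exp 1 :: real)" by (simp add: exp_add[symmetric])
  finally show ?thesis .
qed

text \<open>Fermat's rule from inequalities: moving coordinate \<open>i\<close> by \<open>t\<close>
  raises the sum of the objectives by at most \<open>g * t + M * L * t\<^sup>2\<close>, which
  minimality makes nonnegative for all \<open>t\<close>.\<close>

lemma Gr_stationary: "(\<Sum>m<M. Gr m wsf i) = 0"
proof (cases "i < d")
  case i: True
  define g where "g = (\<Sum>m<M. Gr m wsf i)"
  have key: "0 \<le> g * t + real M * L * t\<^sup>2" for t
  proof -
    define y where "y j = wsf j + (if j = i then t else 0)" for j
    have "(\<Sum>m<M. cf m wsf) / real M \<le> (\<Sum>m<M. cf m y) / real M"
      using minimizer(2)[of "vec d y"] vec_wsf by (simp add: global_obj_vec[symmetric])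
    then have "(\<Sum>m<M. cf m wsf) \<le> (\<Sum>m<M. cf m y)"
      using sizes by (simp add: divide_le_cancel)
    also have "\<dots> \<le> (\<Sum>m<M. cf m wsf + Gr m wsf i * t + L * t\<^sup>2)"
    proof (intro sum_mono)
      fix m assume "m \<in> {..<M}"
      then have m: "m < M" by simp
      have "cf m y + ip d (Gr m y) (\<lambda>j. if j = i then - t else 0) \<le> cf m wsf"
        using cf_convex[OF m, of y wsf] by (simp add: y_def if_distrib cong: if_cong)
      then have "cf m y \<le> cf m wsf + Gr m y i * t" by (simp add: ip_single[OF i])
      moreover have "\<bar>Gr m y i - Gr m wsf i\<bar> \<le> L * \<bar>t\<bar>"
        using Gr_lipschitz_inf[OF m i, of y wsf] nrm_single[OF i, of 1 t] by (simp add: y_def)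
      then have "\<bar>(Gr m y i - Gr m wsf i) * t\<bar> \<le> L * \<bar>t\<bar> * \<bar>t\<bar>"
        unfolding abs_mult by (rule mult_right_mono) simp
      then have "\<bar>(Gr m y i - Gr m wsf i) * t\<bar> \<le> L * t\<^sup>2"
        by (simp add: power2_eq_square mult.assoc)
      then have "Gr m y i * t - Gr m wsf i * t \<le> L * t\<^sup>2" unfolding left_diff_distrib by simp
      ultimately show "cf m y \<le> cf m wsf + Gr m wsf i * t + L * t\<^sup>2" by linarith
    qed
    finally show ?thesis by (simp add: sum.distrib g_def sum_distrib_right)
  qed
  define c where "c = real M * L"
  have c: "0 < c" using sizes parameters by (simp add: c_def)
  \<comment> \<open>The minimiser \<open>- g / (2 * c)\<close> of the quadratic gives the value
    \<open>- g\<^sup>2 / (4 * c)\<close>, so \<open>g\<close> is zero.\<close>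
  have "0 \<le> g * (- g / (2 * c)) + c * (- g / (2 * c))\<^sup>2" using key[of "- g / (2 * c)"] by (simp add: c_def)
  also have "\<dots> = - (g\<^sup>2 / (4 * c))" using c by (simp add: power2_eq_square field_simps)
  finally have "g\<^sup>2 \<le> 0" using c by (simp add: divide_le_0_iff)
  then show ?thesis by (simp add: g_def)
qed (simp add: Gr_def)

lemma smooth_clients: "smooth_clients d M p q (exp 1 * L) cf Gr wsf"
  using sizes parameters p_gt_2 pq cf_convex Gr_lipschitz Gr_stationary by unfold_locales auto

lemma heterogeneity_eq: "heterogeneity d M p D F wstar = (\<Sum>m<M. (nrm d p (Gr m wsf))\<^sup>2) / real M"
proof -
  have "lp_norm p (gradient d (client_obj D F m) wstar) = nrm d p (Gr m wsf)" if "m < M" for m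
    using gradient_client[OF that, of wsf] by (simp add: vec_wsf lp_norm_vec)
  then show ?thesis by (simp add: heterogeneity_def)
qed

lemma cf_measurable:
  assumes "m < M" "\<And>i. i < d \<Longrightarrow> (\<lambda>a. W a i) \<in> borel_measurable N"
  shows "(\<lambda>a. cf m (W a)) \<in> borel_measurable N"
  unfolding cf_def
  by (rule grad_measurable(1)[where \<Phi> = "\<lambda>w x. client_obj D F m w" and S = N and X = "\<lambda>a. a"])
     (use assms client_differentiable in auto)

lemma Gr_measurable:
  assumes "m < M" "\<And>i. i < d \<Longrightarrow> (\<lambda>a. W a i) \<in> borel_measurable N"
  shows "(\<lambda>a. Gr m (W a) i) \<in> borel_measurable N"
proof (cases "i < d")
  case True
  have "(\<lambda>a. gradient d (\<lambda>w. client_obj D F m w) (vec d (W a)) $ i) \<in> borel_measurable N"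
    by (rule grad_measurable(2)[where \<Phi> = "\<lambda>w x. client_obj D F m w" and S = N and X = "\<lambda>a. a"])
       (use assms client_differentiable True in auto)
  then show ?thesis using True by (simp add: Gr_def)
qed (simp add: Gr_def)

lemma sg_measurable:
  assumes "m < M" "\<And>i. i < d \<Longrightarrow> (\<lambda>a. W a i) \<in> borel_measurable N" "X \<in> measurable N (D m)"
  shows "(\<lambda>a. sg (W a) (X a) i) \<in> borel_measurable N"
proof (cases "i < d")
  case True
  have "(\<lambda>a. gradient d (\<lambda>w. F w (X a)) (vec d (W a)) $ i) \<in> borel_measurable N"
    by (rule grad_measurable(2)[where S = "D m"])
       (use assms loss_differentiable loss_integrable True in auto)
  then show ?thesis using True by (simp add: sg_def stoch_grad_def)
qed (simp add: sg_def)

lemma noise_mean: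
  assumes "m < M"
  shows "integrable (D m) (\<lambda>y. sg w y i - Gr m w i)" "(\<integral>y. sg w y i - Gr m w i \<partial>D m) = 0"
proof -
  interpret prob_space "D m" by (rule data[OF assms])
  have "integrable (D m) (\<lambda>y. sg w y i) \<and> (\<integral>y. sg w y i \<partial>D m) = Gr m w i"
    using unbiased[OF assms, of "vec d w" i] by (auto simp: sg_def Gr_def)
  then show "integrable (D m) (\<lambda>y. sg w y i - Gr m w i)" "(\<integral>y. sg w y i - Gr m w i \<partial>D m) = 0"
    by (auto simp: prob_space)
qed

lemma noise_mgf:
  assumes "m < M" "i < d"
  shows "integrable (D m) (\<lambda>y. exp (t * (sg w y i - Gr m w i)))"
    "(\<integral>y. exp (t * (sg w y i - Gr m w i)) \<partial>D m) \<le> exp (t\<^sup>2 * \<sigma>\<^sup>2 / 2)"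
proof -
  have eq: "(stoch_grad d F (vec d w) y - gradient d (client_obj D F m) (vec d w)) $ i = sg w y i - Gr m w i" for y
    using assms by (simp add: gradient_client[OF assms(1)] sg_def)
  show "integrable (D m) (\<lambda>y. exp (t * (sg w y i - Gr m w i)))"
    "(\<integral>y. exp (t * (sg w y i - Gr m w i)) \<partial>D m) \<le> exp (t\<^sup>2 * \<sigma>\<^sup>2 / 2)"
    using sub_gaussian[OF assms(1), of "vec d w" i t] assms(2) unfolding eq by auto
qed

text \<open>The norm change contributes \<open>exp (1 / 2)\<close> squared. The 17 stems from
  \<open>t\<^sup>2 + (2 * t + 2) * 4 \<le> 17 * t\<^sup>2\<close> for
  \<open>t = ln d \<ge> 1\<close>, where 4 bounds the expected pair of exponentials of a
  coordinate.\<close>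

definition \<nu> :: real where "\<nu> = exp 1 * (17 * (ln (real d))\<^sup>2 * \<sigma>\<^sup>2)"

lemma noise_sq_measurable:
  assumes "m < M"
  shows "(\<lambda>y. (nrm d p (\<lambda>i. sg w y i - Gr m w i))\<^sup>2) \<in> borel_measurable (D m)"
  by (intro borel_measurable_power nrm_measurable borel_measurable_diff sg_measurable[OF assms]) auto

text \<open>The scale \<rho> is kept apart from \<sigma> because the exponentials are taken at
  \<open>1 / \<rho>\<close>, and \<sigma> may be 0.\<close>

lemma noise_second_moment_scaled:
  fixes \<rho> :: real assumes m: "m < M" and \<rho>: "0 < \<rho>" "\<sigma> \<le> \<rho>"
  shows "integrable (D m) (\<lambda>y. (nrm d p (\<lambda>i. sg w y i - Gr m w i))\<^sup>2)"
    "(\<integral>y. (nrm d p (\<lambda>i. sg w y i - Gr m w i))\<^sup>2 \<partial>D m) \<le> exp 1 * (17 * (ln (real d))\<^sup>2 * \<rho>\<^sup>2)"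
proof -
  interpret prob_space "D m" by (rule data[OF m])
  define t where "t = ln (real d)"
  have t: "1 \<le> t" using ln_d by (simp add: t_def)
  define e where "e j y = exp (1 / \<rho> * (sg w y j - Gr m w j)) + exp (- 1 / \<rho> * (sg w y j - Gr m w j))" for j y
  \<comment> \<open>\<open>b\<close> dominates the squares of all coordinates at once: their maximum
    is traded for a sum of exponentials, damped by \<open>exp (- t) = 1 / d\<close>.\<close>
  define b where "b y = \<rho>\<^sup>2 * (t\<^sup>2 + (2 * t + 2) * (exp (- t) * (\<Sum>j<d. e j y)))" for y
  have e_int: "integrable (D m) (e j)" if "j < d" for j
    unfolding e_def using noise_mgf(1)[OF m that] by (intro Bochner_Integration.integrable_add)
  have "exp (1 / 2) \<le> (2 :: real)"
  proof (rule power2_le_imp_le)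
    show "(exp (1 / 2))\<^sup>2 \<le> (2 :: real)\<^sup>2" using exp_le by (simp add: power2_eq_square exp_add[symmetric])
  qed simp
  have e_le: "(\<integral>y. e j y \<partial>D m) \<le> 4" if "j < d" for j
  proof -
    have "((c / \<rho>)\<^sup>2 * \<sigma>\<^sup>2 / 2) \<le> 1 / 2" if "c\<^sup>2 = 1" for c
    proof -
      have "\<sigma>\<^sup>2 \<le> \<rho>\<^sup>2" using parameters \<rho> by (intro power_mono) auto
      then show ?thesis using that \<rho> by (simp add: power_divide)
    qed
    from this[of 1] this[of "-1"]
    have "exp ((1 / \<rho>)\<^sup>2 * \<sigma>\<^sup>2 / 2) \<le> exp (1 / 2)" "exp ((- 1 / \<rho>)\<^sup>2 * \<sigma>\<^sup>2 / 2) \<le> exp (1 / 2)" by simp_all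
    then have "exp ((1 / \<rho>)\<^sup>2 * \<sigma>\<^sup>2 / 2) \<le> 2" "exp ((- 1 / \<rho>)\<^sup>2 * \<sigma>\<^sup>2 / 2) \<le> 2"
      using \<open>exp (1 / 2) \<le> 2\<close> by linarith+
    then show ?thesis
      unfolding e_def using noise_mgf[OF m that, of "1 / \<rho>" w] noise_mgf[OF m that, of "- 1 / \<rho>" w]
      by (subst Bochner_Integration.integral_add) auto
  qed
  have b_int: "integrable (D m) b"
    unfolding b_def using e_int by (intro integrable_mult_right Bochner_Integration.integrable_add
      Bochner_Integration.integrable_sum) auto
  have dom: "(nrm d p (\<lambda>i. sg w y i - Gr m w i))\<^sup>2 \<le> exp 1 * b y" for y
  proof -
    have e0: "0 \<le> e j y" for j by (simp add: e_def)
    have b0: "0 \<le> b y" unfolding b_def using t e0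
      by (intro mult_nonneg_nonneg add_nonneg_nonneg sum_nonneg) auto
    have "\<bar>sg w y i - Gr m w i\<bar> \<le> sqrt (b y)" if i: "i < d" for i
    proof (rule real_le_rsqrt)
      define u where "u = (sg w y i - Gr m w i) / \<rho>"
      have "u\<^sup>2 \<le> t\<^sup>2 + (2 * t + 2) * (exp (u - t) + exp (- u - t))"
        using t by (intro square_le_exp) simp
      also have "exp (u - t) + exp (- u - t) = exp (- t) * e i y"
        by (simp add: e_def u_def exp_add[symmetric] distrib_left)
      also have "t\<^sup>2 + (2 * t + 2) * (exp (- t) * e i y) \<le> t\<^sup>2 + (2 * t + 2) * (exp (- t) * (\<Sum>j<d. e j y))"
        using t i e0 by (intro add_left_mono mult_left_mono member_le_sum) auto
      finally have "\<rho>\<^sup>2 * u\<^sup>2 \<le> b y" unfolding b_def by (intro mult_left_mono) auto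
      then show "\<bar>sg w y i - Gr m w i\<bar>\<^sup>2 \<le> b y" using \<rho> by (simp add: u_def power_divide)
    qed
    then have "nrm d p (\<lambda>i. sg w y i - Gr m w i) \<le> exp (1 / 2) * sqrt (b y)"
      using b0 by (intro nrm_p_le) auto
    then have "(nrm d p (\<lambda>i. sg w y i - Gr m w i))\<^sup>2 \<le> (exp (1 / 2) * sqrt (b y))\<^sup>2"
      by (intro power_mono) auto
    also have "\<dots> = exp 1 * b y"
      using b0 by (simp add: power_mult_distrib) (simp add: power2_eq_square exp_add[symmetric])
    finally show ?thesis .
  qed
  have int_b: "integrable (D m) (\<lambda>y. exp 1 * b y)" using b_int by simp
  show int: "integrable (D m) (\<lambda>y. (nrm d p (\<lambda>i. sg w y i - Gr m w i))\<^sup>2)"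
    by (rule Bochner_Integration.integrable_bound[OF int_b noise_sq_measurable[OF m]])
       (use dom in \<open>auto intro: order_trans[OF _ abs_ge_self]\<close>)
  have "(\<integral>y. (nrm d p (\<lambda>i. sg w y i - Gr m w i))\<^sup>2 \<partial>D m) \<le> (\<integral>y. exp 1 * b y \<partial>D m)"
    by (rule integral_mono[OF int int_b dom])
  also have "\<dots> = exp 1 * (\<rho>\<^sup>2 * (t\<^sup>2 + (2 * t + 2) * (exp (- t) * (\<Sum>j<d. \<integral>y. e j y \<partial>D m))))"
  proof -
    have sum: "integrable (D m) (\<lambda>y. \<Sum>j<d. e j y)"
      using e_int by (intro Bochner_Integration.integrable_sum) auto
    have "(\<integral>y. (\<Sum>j<d. e j y) \<partial>D m) = (\<Sum>j<d. \<integral>y. e j y \<partial>D m)"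
      using e_int by (intro Bochner_Integration.integral_sum) auto
    then show ?thesis unfolding b_def using sum by (simp add: prob_space)
  qed
  also have "\<dots> \<le> exp 1 * (\<rho>\<^sup>2 * (t\<^sup>2 + (2 * t + 2) * (exp (- t) * (\<Sum>j<d. 4))))"
    using e_le t by (intro mult_left_mono add_left_mono sum_mono) auto
  also have "exp (- t) * (\<Sum>j<d. 4) = 4" using d_ge_3 by (simp add: t_def exp_minus)
  also have "exp 1 * (\<rho>\<^sup>2 * (t\<^sup>2 + (2 * t + 2) * 4)) \<le> exp 1 * (\<rho>\<^sup>2 * (17 * t\<^sup>2))"
  proof (intro mult_left_mono)
    have "t * 1 \<le> t * t" using t by (intro mult_left_mono) auto
    then have "t \<le> t\<^sup>2" by (simp add: power2_eq_square)
    then show "t\<^sup>2 + (2 * t + 2) * 4 \<le> 17 * t\<^sup>2" using t unfolding distrib_right by linarith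
  qed auto
  finally show "(\<integral>y. (nrm d p (\<lambda>i. sg w y i - Gr m w i))\<^sup>2 \<partial>D m) \<le> exp 1 * (17 * (ln (real d))\<^sup>2 * \<rho>\<^sup>2)"
    by (simp add: t_def mult_ac)
qed

lemma noise_second_moment:
  assumes m: "m < M"
  shows "integrable (D m) (\<lambda>y. (nrm d p (\<lambda>i. sg w y i - Gr m w i))\<^sup>2)"
    "(\<integral>y. (nrm d p (\<lambda>i. sg w y i - Gr m w i))\<^sup>2 \<partial>D m) \<le> \<nu>"
proof -
  show "integrable (D m) (\<lambda>y. (nrm d p (\<lambda>i. sg w y i - Gr m w i))\<^sup>2)"
    using noise_second_moment_scaled(1)[OF m, where \<rho> = "\<sigma> + 1"] parameters by simp
  let ?X = "\<integral>y. (nrm d p (\<lambda>i. sg w y i - Gr m w i))\<^sup>2 \<partial>D m"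
  have "?X \<le> exp 1 * (17 * (ln (real d))\<^sup>2 * \<sigma>\<^sup>2)"
  proof (cases "\<sigma> = 0")
    case False
    then show ?thesis using noise_second_moment_scaled(2)[OF m, where \<rho> = \<sigma>] parameters by simp
  next
    case True
    \<comment> \<open>Without noise every positive \<rho> is admissible, and letting it tend to 0
      yields the bound 0.\<close>
    have "((\<lambda>\<rho>. exp 1 * (17 * (ln (real d))\<^sup>2 * \<rho>\<^sup>2)) \<longlongrightarrow> exp 1 * (17 * (ln (real d))\<^sup>2 * 0\<^sup>2)) (at_right 0)"
      by (intro tendsto_intros)
    moreover have "\<forall>\<^sub>F \<rho> in at_right 0. ?X \<le> exp 1 * (17 * (ln (real d))\<^sup>2 * \<rho>\<^sup>2)"
      using noise_second_moment_scaled(2)[OF m] True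
      by (auto simp: eventually_at_right[of 0 1] intro!: exI[of _ 1])
    ultimately show ?thesis using True by (intro tendsto_lowerbound) auto
  qed
  then show "?X \<le> \<nu>" by (simp add: \<nu>_def)
qed

end

section \<open>Adaptedness and expectations of the iterates\<close>

locale dfedda_run = dfedda_setting +
  fixes \<eta> :: real
  assumes eta: "0 < \<eta>" and small: "\<eta> * (exp 1 * L) * real K * (9 * mixing_time M U) \<le> 1 / 32"
begin

definition Zd :: "(nat \<Rightarrow> nat \<Rightarrow> nat \<Rightarrow> 'a) \<Rightarrow> nat \<Rightarrow> nat \<Rightarrow> nat \<Rightarrow> real vec" where
  "Zd x r k m = local_dual d p \<eta> F (\<lambda>k. x r k m) (round_dual d M K p \<eta> F U w0 x r m) k"

definition zf :: "(nat \<Rightarrow> nat \<Rightarrow> nat \<Rightarrow> 'a) \<Rightarrow> nat \<Rightarrow> nat \<Rightarrow> nat \<Rightarrow> nat \<Rightarrow> real" where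
  "zf x r k m i = (if i < d then Zd x r k m $ i else 0)"

definition wf :: "(nat \<Rightarrow> nat \<Rightarrow> nat \<Rightarrow> 'a) \<Rightarrow> nat \<Rightarrow> nat \<Rightarrow> nat \<Rightarrow> nat \<Rightarrow> real" where
  "wf x r k m = mgrad d p (zf x r k m)"

definition noise :: "(nat \<Rightarrow> nat \<Rightarrow> nat \<Rightarrow> 'a) \<Rightarrow> nat \<Rightarrow> nat \<Rightarrow> nat \<Rightarrow> nat \<Rightarrow> real" where
  "noise x r k m i = sg (wf x r k m) (x r k m) i - Gr m (wf x r k m) i"

definition w0f :: "nat \<Rightarrow> real" where "w0f i = (if i < d then w0 $ i else 0)"

definition z0 :: "nat \<Rightarrow> real" where "z0 = mgrad d q w0f"

lemma vec_w0f: "vec d w0f = w0"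
  using start(1) by (intro eq_vecI) (auto simp: w0f_def)

lemma Zd_Suc: "Zd x r (Suc k) m = Zd x r k m - \<eta> \<cdot>\<^sub>v stoch_grad d F (mirror_inv d p (Zd x r k m)) (x r k m)"
  by (simp add: Zd_def)

lemma Zd_round: "Zd x (Suc r) 0 m = vec d (\<lambda>i. \<Sum>j<M. U $$ (j, m) * Zd x r K j $ i)"
  by (simp add: Zd_def)

lemma Zd_start: "Zd x 0 0 m = vec d z0"
  using gradient_mirror_map[OF p_gt_2, of d w0f] by (simp add: Zd_def vec_w0f z0_def q_def)

lemma zf_start: "zf x 0 0 m = z0"
  by (auto simp: zf_def Zd_start z0_def w0f_def mgrad_def dualv_def fun_eq_iff)

lemma zf_round: "zf x (Suc r) 0 m = (\<lambda>i. \<Sum>j<M. U $$ (j, m) * zf x r K j i)"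
  by (auto simp: zf_def Zd_round fun_eq_iff)

lemma Zd_zf: "Zd x r k m \<in> carrier_vec d \<Longrightarrow> Zd x r k m = vec d (zf x r k m)"
  by (intro eq_vecI) (auto simp: zf_def)

text \<open>Outside the sample spaces the loss may fail to be differentiable, and
  \<open>stoch_grad\<close> is then an unspecified vector of unknown dimension. The gossip step
  restores dimension \<open>d\<close>, so only samples of the current round matter.\<close>

lemma Zd_carrier:
  assumes "m < M" "\<And>l. l < k \<Longrightarrow> x r l m \<in> space (D m)"
  shows "Zd x r k m \<in> carrier_vec d"
  using assms(2)
proof (induction k)
  case 0
  then show ?case by (cases r) (auto simp: Zd_start Zd_round)
next
  case (Suc k)
  then have Z: "Zd x r k m = vec d (zf x r k m)" by (intro Zd_zf) auto
  show ?case unfolding Zd_Suc unfolding Z mirror_inv_vec[OF p_gt_2]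
    using Suc.prems[of k] by (simp add: gradient_stoch[OF assms(1)])
qed

lemma zf_Suc:
  assumes "m < M" "\<And>l. l \<le> k \<Longrightarrow> x r l m \<in> space (D m)"
  shows "zf x r (Suc k) m = (\<lambda>i. zf x r k m i - \<eta> * (Gr m (wf x r k m) i + noise x r k m i))"
proof
  fix i
  have Z: "Zd x r k m = vec d (zf x r k m)" using assms by (intro Zd_zf Zd_carrier) auto
  have "Zd x r (Suc k) m = vec d (zf x r k m) - \<eta> \<cdot>\<^sub>v vec d (sg (wf x r k m) (x r k m))"
    unfolding Zd_Suc unfolding Z mirror_inv_vec[OF p_gt_2]
    using assms(2)[of k] by (simp add: gradient_stoch[OF assms(1)] wf_def)
  then show "zf x r (Suc k) m i = zf x r k m i - \<eta> * (Gr m (wf x r k m) i + noise x r k m i)"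
    by (cases "i < d") (auto simp: zf_def[of x r "Suc k"] noise_def sg_def Gr_def, auto simp: zf_def)
qed

definition valid :: "(nat \<Rightarrow> nat \<Rightarrow> nat \<Rightarrow> 'a) \<Rightarrow> bool" where
  "valid x \<longleftrightarrow> (\<forall>r<R. \<forall>k<K. \<forall>m<M. x r k m \<in> space (D m))"

lemma gossip_matrix: "gossip_matrix M U"
  using sizes gossip by unfold_locales auto

lemma path: "valid x \<Longrightarrow> dfedda_path d M p q (exp 1 * L) cf Gr wsf U K R \<eta> (noise x) (zf x) z0"
proof -
  assume x: "valid x"
  interpret smooth_clients d M p q "exp 1 * L" cf Gr wsf by (rule smooth_clients)
  interpret gossip_matrix M U by (rule gossip_matrix)
  show ?thesis
  proof
    show "zf x r (Suc k) m = (\<lambda>i. zf x r k m i - \<eta> * (Gr m (mgrad d p (zf x r k m)) i + noise x r k m i))"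
      if "r < R" "k < K" "m < M" for r k m
      using zf_Suc[of m k x r] x that by (auto simp: valid_def wf_def)
  qed (use sizes eta small in \<open>auto simp: zf_start zf_round mult.assoc\<close>)
qed

text \<open>The bound \<open>k' < K\<close> is built in, so \<open>past r K\<close> equals
  \<open>past (Suc r) 0\<close>: gossip uses no new sample.\<close>

definition past :: "nat \<Rightarrow> nat \<Rightarrow> (nat \<times> nat \<times> nat) set" where
  "past r k = {(r', k', m'). (r' < r \<or> r' = r \<and> k' < k) \<and> k' < K \<and> m' < M}"

abbreviation untuple :: "(nat \<times> nat \<times> nat \<Rightarrow> 'a) \<Rightarrow> nat \<Rightarrow> nat \<Rightarrow> nat \<Rightarrow> 'a" where
  "untuple a \<equiv> (\<lambda>r k m. a (r, k, m))"

abbreviation DD :: "nat \<times> nat \<times> nat \<Rightarrow> 'a measure" where "DD \<equiv> (\<lambda>(r, k, m). D m)"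

text \<open>\<open>adapted r k f\<close>: the functional \<open>f\<close> of the sample array only uses the samples drawn before local
  step \<open>k\<close> of round \<open>r\<close>. Measurability on every larger index set makes the notion monotone.\<close>

definition adapted :: "nat \<Rightarrow> nat \<Rightarrow> ((nat \<Rightarrow> nat \<Rightarrow> nat \<Rightarrow> 'a) \<Rightarrow> real) \<Rightarrow> bool" where
  "adapted r k f \<longleftrightarrow>
     (\<forall>x y. (\<forall>(r', k', m')\<in>past r k. x r' k' m' = y r' k' m') \<longrightarrow> f x = f y) \<and>
     (\<forall>J. past r k \<subseteq> J \<longrightarrow> (\<lambda>a. f (untuple a)) \<in> borel_measurable (PiM J DD))"

lemma adapted_cong:
  "adapted r k f \<Longrightarrow> (\<And>r' k' m'. (r', k', m') \<in> past r k \<Longrightarrow> x r' k' m' = y r' k' m') \<Longrightarrow> f x = f y"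
  unfolding adapted_def by blast

lemma adapted_measurable:
  "adapted r k f \<Longrightarrow> past r k \<subseteq> J \<Longrightarrow> (\<lambda>a. f (untuple a)) \<in> borel_measurable (PiM J DD)"
  unfolding adapted_def by blast

lemma adapted_mono: "adapted r k f \<Longrightarrow> past r k \<subseteq> past r' k' \<Longrightarrow> adapted r' k' f"
  unfolding adapted_def by blast

lemma adapted_const: "adapted r k (\<lambda>x. c)"
  by (simp add: adapted_def)

text \<open>\<Psi> acts on a whole vector; its measurability is stated as stability under inserting
  coordinatewise measurable families, which avoids a sigma-algebra on functions.\<close>

lemma adapted_fun:
  fixes \<Psi> :: "(nat \<Rightarrow> real) \<Rightarrow> real"
  assumes y: "\<And>i. adapted r k (\<lambda>x. y x i)"
    and \<Psi>: "\<And>J W. (\<And>i. (\<lambda>a. W a i) \<in> borel_measurable (PiM J DD)) \<Longrightarrow> (\<lambda>a. \<Psi> (W a)) \<in> borel_measurable (PiM J DD)"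
  shows "adapted r k (\<lambda>x. \<Psi> (y x))"
  unfolding adapted_def
proof (intro conjI allI impI)
  fix x x' :: "nat \<Rightarrow> nat \<Rightarrow> nat \<Rightarrow> 'a" assume "\<forall>(r', k', m')\<in>past r k. x r' k' m' = x' r' k' m'"
  then have "y x i = y x' i" for i by (intro adapted_cong[OF y]) auto
  then show "\<Psi> (y x) = \<Psi> (y x')" by (metis ext)
next
  fix J assume "past r k \<subseteq> J"
  then show "(\<lambda>a. \<Psi> (y (untuple a))) \<in> borel_measurable (PiM J DD)"
    by (intro \<Psi> adapted_measurable[OF y])
qed

lemma adapted_add: "adapted r k f \<Longrightarrow> adapted r k g \<Longrightarrow> adapted r k (\<lambda>x. f x + g x)"
  unfolding adapted_def by (auto intro!: borel_measurable_add)

lemma adapted_diff: "adapted r k f \<Longrightarrow> adapted r k g \<Longrightarrow> adapted r k (\<lambda>x. f x - g x)"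
  unfolding adapted_def by (auto intro!: borel_measurable_diff)

lemma adapted_scale: "adapted r k f \<Longrightarrow> adapted r k (\<lambda>x. c * f x)"
  unfolding adapted_def by (auto intro!: borel_measurable_times)

lemma adapted_sum: "(\<And>j. j \<in> A \<Longrightarrow> adapted r k (f j)) \<Longrightarrow> adapted r k (\<lambda>x. \<Sum>j\<in>A. f j x)"
  by (induction A rule: infinite_finite_induct) (auto simp: adapted_const adapted_add)

lemma adapted_mgrad: "(\<And>i. adapted r k (\<lambda>x. y x i)) \<Longrightarrow> adapted r k (\<lambda>x. mgrad d r' (y x) i)"
  by (rule adapted_fun[where \<Psi> = "\<lambda>w. mgrad d r' w i"]) (auto intro: mgrad_measurable)

lemma adapted_dualv: "(\<And>i. adapted r k (\<lambda>x. y x i)) \<Longrightarrow> adapted r k (\<lambda>x. dualv d r' (y x) i)"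
  by (rule adapted_fun[where \<Psi> = "\<lambda>w. dualv d r' w i"]) (auto intro: dualv_measurable)

lemma adapted_Gr: "m < M \<Longrightarrow> (\<And>i. adapted r k (\<lambda>x. y x i)) \<Longrightarrow> adapted r k (\<lambda>x. Gr m (y x) i)"
  by (rule adapted_fun[where \<Psi> = "\<lambda>w. Gr m w i"]) (auto intro: Gr_measurable)

lemma past_mono: "r < r' \<or> r = r' \<and> k \<le> k' \<Longrightarrow> past r k \<subseteq> past r' k'"
  by (auto simp: past_def)

text \<open>Here a fresh sample enters: the point is known before step \<open>k\<close>, the
  stochastic gradient only after it.\<close>

lemma adapted_sg:
  assumes m: "m < M" and k: "k < K" and y: "\<And>i. adapted r k (\<lambda>x. y x i)"
  shows "adapted r (Suc k) (\<lambda>x. sg (y x) (x r k m) i)"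
  unfolding adapted_def
proof (intro conjI allI impI)
  have y': "adapted r (Suc k) (\<lambda>x. y x i)" for i
    using y by (rule adapted_mono) (simp add: past_mono)
  have mem: "(r, k, m) \<in> past r (Suc k)" using m k by (auto simp: past_def)
  {
    fix x x' :: "nat \<Rightarrow> nat \<Rightarrow> nat \<Rightarrow> 'a" assume eq: "\<forall>(r', k', m')\<in>past r (Suc k). x r' k' m' = x' r' k' m'"
    then have "y x i = y x' i" for i by (intro adapted_cong[OF y']) auto
    then have "y x = y x'" by auto
    moreover have "x r k m = x' r k m" using eq mem by auto
    ultimately show "sg (y x) (x r k m) i = sg (y x') (x' r k m) i" by simp
  }
  fix J assume J: "past r (Suc k) \<subseteq> J"
  show "(\<lambda>a. sg (y (untuple a)) (untuple a r k m) i) \<in> borel_measurable (PiM J DD)"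
  proof (rule sg_measurable[OF m])
    show "(\<lambda>a. y (untuple a) i) \<in> borel_measurable (PiM J DD)" for i
      by (rule adapted_measurable[OF y' J])
    show "(\<lambda>a. a (r, k, m)) \<in> measurable (PiM J DD) (D m)"
      using measurable_component_singleton[of "(r, k, m)" J DD] mem J by auto
  qed
qed

text \<open>Follows the recursion only, and therefore holds for arbitrary sample arrays, as the
  first half of \<open>adapted\<close> demands.\<close>

lemma Zd_cong:
  assumes "m < M" "k \<le> K" "\<And>r' k' m'. (r', k', m') \<in> past r k \<Longrightarrow> x r' k' m' = y r' k' m'"
  shows "Zd x r k m = Zd y r k m"
  using assms
proof (induction r arbitrary: k m)
  case (0 k m)
  then show ?case
  proof (induction k)
    case (Suc k)
    have "x 0 k m = y 0 k m" using Suc.prems by (auto simp: past_def)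
    moreover have "Zd x 0 k m = Zd y 0 k m" using Suc by (auto simp: past_def)
    ultimately show ?case by (simp add: Zd_Suc)
  qed (simp add: Zd_start)
next
  case (Suc r k m)
  have K: "Zd x r K j = Zd y r K j" if "j < M" for j
    using that Suc.prems(3) by (intro Suc.IH) (auto simp: past_def)
  show ?case using Suc.prems
  proof (induction k)
    case 0
    then show ?case by (auto simp: Zd_round K)
  next
    case (Suc k)
    have "x (Suc r) k m = y (Suc r) k m" using Suc.prems by (auto simp: past_def)
    moreover have "Zd x (Suc r) k m = Zd y (Suc r) k m"
      by (rule Suc.IH) (use Suc.prems in \<open>auto simp: past_def\<close>)
    ultimately show ?case by (simp add: Zd_Suc)
  qed
qed

lemma adapted_zf:
  assumes "m < M" "k \<le> K"
  shows "adapted r k (\<lambda>x. zf x r k m i)"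
proof -
  have meas_step: "(\<lambda>a. zf (untuple a) r (Suc k) m i) \<in> borel_measurable (PiM J DD)"
    if IH: "\<And>i. adapted r k (\<lambda>x. zf x r k m i)" and mk: "m < M" "Suc k \<le> K" and J: "past r (Suc k) \<subseteq> J"
    for r k m i J
  proof -
    have w: "adapted r k (\<lambda>x. wf x r k m i)" for i unfolding wf_def by (rule adapted_mgrad[OF IH])
    have z': "adapted r (Suc k) (\<lambda>x. zf x r k m i)" for i
      using IH by (rule adapted_mono) (simp add: past_mono)
    have "adapted r (Suc k) (\<lambda>x. zf x r k m i - \<eta> * sg (wf x r k m) (x r k m) i)"
      using mk by (intro adapted_diff adapted_scale adapted_sg z' w) auto
    from adapted_measurable[OF this J]
    have "(\<lambda>a. zf (untuple a) r k m i - \<eta> * sg (wf (untuple a) r k m) (untuple a r k m) i) \<in> borel_measurable (PiM J DD)" .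
    then show ?thesis
    \<comment> \<open>The recursion \<open>zf_Suc\<close> is valid for samples in their spaces only;
      these make up the space of the product measure, and measurability does not look beyond
      it.\<close>
    proof (rule measurable_cong[THEN iffD2, rotated])
      fix a assume a: "a \<in> space (PiM J DD)"
      have "untuple a r l m \<in> space (D m)" if "l \<le> k" for l
      proof -
        have "(r, l, m) \<in> J" using J mk that by (auto simp: past_def)
        then show ?thesis using a by (auto simp: space_PiM PiE_iff)
      qed
      then show "zf (untuple a) r (Suc k) m i = zf (untuple a) r k m i - \<eta> * sg (wf (untuple a) r k m) (untuple a r k m) i"
        using zf_Suc[of m k "untuple a" r] mk by (simp add: noise_def)
    qed
  qed
  have dep: "(\<forall>x y. (\<forall>(r', k', m')\<in>past r k. x r' k' m' = y r' k' m') \<longrightarrow> zf x r k m i = zf y r k m i)"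
    if "m < M" "k \<le> K" for r k m i
  proof (intro allI impI)
    fix x y :: "nat \<Rightarrow> nat \<Rightarrow> nat \<Rightarrow> 'a"
    assume *: "\<forall>(r', k', m')\<in>past r k. x r' k' m' = y r' k' m'"
    have "Zd x r k m = Zd y r k m" by (rule Zd_cong[OF that]) (use * in auto)
    then show "zf x r k m i = zf y r k m i" by (simp add: zf_def)
  qed
  have loop: "adapted r k (\<lambda>x. zf x r k m i)"
    if base: "\<And>i. adapted r 0 (\<lambda>x. zf x r 0 m i)" and mk: "m < M" "k \<le> K" for r k m i
    using mk(2)
  proof (induction k arbitrary: i)
    case (Suc k)
    have "adapted r k (\<lambda>x. zf x r k m i)" for i using Suc by simp
    from meas_step[OF this mk(1) Suc.prems] show ?case
      unfolding adapted_def[of r "Suc k"] using dep[OF mk(1) Suc.prems, of r i] by blast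
  qed (rule base)
  show ?thesis using assms
  proof (induction r arbitrary: k m i)
    case 0
    show ?case by (rule loop[OF _ 0]) (simp add: zf_start adapted_const)
  next
    case (Suc r)
    have IH: "adapted (Suc r) 0 (\<lambda>x. zf x r K j i)" if "j < M" for i j
      using Suc.IH[OF that order_refl] by (rule adapted_mono) (simp add: past_mono)
    have "adapted (Suc r) 0 (\<lambda>x. \<Sum>j<M. U $$ (j, m') * zf x r K j i)" for m' i
      by (intro adapted_sum adapted_scale IH) simp
    then have "adapted (Suc r) 0 (\<lambda>x. zf x (Suc r) 0 m' i)" for m' i by (simp only: zf_round)
    then show ?case by (rule loop[OF _ Suc.prems])
  qed
qed

lemma adapted_wf: "m < M \<Longrightarrow> k \<le> K \<Longrightarrow> adapted r k (\<lambda>x. wf x r k m i)"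
  unfolding wf_def by (intro adapted_mgrad adapted_zf)

lemma adapted_noise:
  assumes "m < M" "k < K" shows "adapted r (Suc k) (\<lambda>x. noise x r k m i)"
proof -
  have w: "adapted r k (\<lambda>x. wf x r k m i)" for i using assms by (intro adapted_wf) auto
  then have "adapted r (Suc k) (\<lambda>x. wf x r k m i)" for i
    by (rule adapted_mono) (simp add: past_mono)
  then show ?thesis unfolding noise_def
    using assms w by (intro adapted_diff adapted_sg adapted_Gr) auto
qed

lemma adapted_noise_sum:
  assumes "m < M" "k \<le> K" shows "adapted r k (\<lambda>x. \<Sum>l<k. noise x r l m i)"
proof (intro adapted_sum)
  fix l assume l: "l \<in> {..<k}"
  show "adapted r k (\<lambda>x. noise x r l m i)"
  proof (rule adapted_mono)
    show "adapted r (Suc l) (\<lambda>x. noise x r l m i)" using assms l by (intro adapted_noise) auto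
    show "past r (Suc l) \<subseteq> past r k" using l by (intro past_mono) auto
  qed
qed

end

lemma (in dfedda_setting) xi_measurable:
  assumes "r < R" "k < K" "m < M" shows "\<xi> r k m \<in> measurable P (D m)"
proof -
  interpret prob_space P by (rule probability_space)
  show ?thesis using fresh_samples(1) assms unfolding indep_vars_def by auto
qed

section \<open>Independence of the noise from the past and square integrability\<close>

context dfedda_run
begin

abbreviation Xi :: "'b \<Rightarrow> nat \<Rightarrow> nat \<Rightarrow> nat \<Rightarrow> 'a" where "Xi \<omega> \<equiv> (\<lambda>r k m. \<xi> r k m \<omega>)"

text \<open>A single sample is also wrapped as a tuple over a one-element index set, because the
  freezing lemmas take both variables with values in one type.\<close>

definition tup :: "(nat \<times> nat \<times> nat) set \<Rightarrow> 'b \<Rightarrow> nat \<times> nat \<times> nat \<Rightarrow> 'a" where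
  "tup A \<omega> = (\<lambda>i\<in>A. (case i of (r, k, m) \<Rightarrow> \<xi> r k m) \<omega>)"

lemma valid_Xi: "\<omega> \<in> space P \<Longrightarrow> valid (Xi \<omega>)"
  unfolding valid_def using xi_measurable by (auto dest: measurable_space)

lemma past_subset: "r < R \<Longrightarrow> past r k \<subseteq> {..<R} \<times> {..<K} \<times> {..<M}"
  by (auto simp: past_def)

lemma tup_measurable:
  assumes "A \<subseteq> {..<R} \<times> {..<K} \<times> {..<M}" shows "tup A \<in> measurable P (PiM A DD)"
  unfolding tup_def
proof (rule measurable_restrict)
  fix i assume "i \<in> A"
  then show "(case i of (r, k, m) \<Rightarrow> \<xi> r k m) \<in> measurable P (DD i)"
    using assms xi_measurable by (cases i) auto
qed

lemma adapted_tup: "adapted r k f \<Longrightarrow> past r k \<subseteq> A \<Longrightarrow> f (untuple (tup A \<omega>)) = f (Xi \<omega>)"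
  by (rule adapted_cong) (auto simp: tup_def)

lemma adapted_random_variable:
  assumes "r < R" "adapted r k f" shows "(\<lambda>\<omega>. f (Xi \<omega>)) \<in> borel_measurable P"
  using measurable_compose[OF tup_measurable[OF past_subset[OF assms(1)]] adapted_measurable[OF assms(2) order_refl]]
  by (simp add: adapted_tup[OF assms(2)])

lemma sample_distr:
  fixes h :: "'a \<Rightarrow> real"
  assumes r: "r < R" "k < K" "m < M" and h: "h \<in> borel_measurable (D m)"
  shows "integrable (distr P (PiM {(r, k, m)} DD) (tup {(r, k, m)})) (\<lambda>y. h (y (r, k, m))) \<longleftrightarrow> integrable (D m) h"
    and "(\<integral>y. h (y (r, k, m)) \<partial>distr P (PiM {(r, k, m)} DD) (tup {(r, k, m)})) = (\<integral>x. h x \<partial>D m)"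
proof -
  have t: "tup {(r, k, m)} \<in> measurable P (PiM {(r, k, m)} DD)" using r by (intro tup_measurable) auto
  have c: "(\<lambda>y. y (r, k, m)) \<in> measurable (PiM {(r, k, m)} DD) (D m)"
    using measurable_component_singleton[of "(r, k, m)" "{(r, k, m)}" DD] by simp
  have h': "(\<lambda>y. h (y (r, k, m))) \<in> borel_measurable (PiM {(r, k, m)} DD)"
    using c h by (rule measurable_compose)
  have tx: "tup {(r, k, m)} \<omega> (r, k, m) = \<xi> r k m \<omega>" for \<omega> by (simp add: tup_def)
  have D: "integrable (D m) h \<longleftrightarrow> integrable P (\<lambda>\<omega>. h (\<xi> r k m \<omega>))"
    "(\<integral>x. h x \<partial>D m) = (\<integral>\<omega>. h (\<xi> r k m \<omega>) \<partial>P)"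
    using integrable_distr_eq[OF xi_measurable[OF r], of h] integral_distr[OF xi_measurable[OF r], of h] h
    by (simp_all add: fresh_samples(2)[OF r])
  show "integrable (distr P (PiM {(r, k, m)} DD) (tup {(r, k, m)})) (\<lambda>y. h (y (r, k, m))) \<longleftrightarrow> integrable (D m) h"
    using integrable_distr_eq[OF t, of "\<lambda>y. h (y (r, k, m))"] h' by (simp add: D tx)
  show "(\<integral>y. h (y (r, k, m)) \<partial>distr P (PiM {(r, k, m)} DD) (tup {(r, k, m)})) = (\<integral>x. h x \<partial>D m)"
    using integral_distr[OF t, of "\<lambda>y. h (y (r, k, m))"] h' by (simp add: D tx)
qed

text \<open>\<open>past r k\<close> does not contain \<open>(r, k, m)\<close>, so the two tuples are
  built from disjoint sets of independent samples.\<close>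

lemma indep_past:
  assumes r: "r < R" "k < K" "m < M"
  shows "prob_space.indep_var P (PiM (past r k) DD) (tup (past r k)) (PiM {(r, k, m)} DD) (tup {(r, k, m)})"
proof -
  interpret prob_space P by (rule probability_space)
  have "indep_var (PiM (past r k) DD) (\<lambda>\<omega>. restrict (\<lambda>i. (case i of (r, k, m) \<Rightarrow> \<xi> r k m) \<omega>) (past r k))
     (PiM {(r, k, m)} DD) (\<lambda>\<omega>. restrict (\<lambda>i. (case i of (r, k, m) \<Rightarrow> \<xi> r k m) \<omega>) {(r, k, m)})"
    using r past_subset[OF r(1), of k] by (intro indep_var_restrict[OF fresh_samples(1)]) (auto simp: past_def)
  then show ?thesis unfolding tup_def .
qed

lemma noise_tup:
  assumes r: "r < R" "k < K" "m < M"
  shows "sg (wf (untuple (tup (past r k) \<omega>)) r k m) (tup {(r, k, m)} \<omega> (r, k, m)) i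
      - Gr m (wf (untuple (tup (past r k) \<omega>)) r k m) i = noise (Xi \<omega>) r k m i"
proof -
  have "wf (untuple (tup (past r k) \<omega>)) r k m j = wf (Xi \<omega>) r k m j" for j
    by (rule adapted_tup[OF adapted_wf[OF r(3)] order_refl]) (use r in simp)
  then have "wf (untuple (tup (past r k) \<omega>)) r k m = wf (Xi \<omega>) r k m" by auto
  then show ?thesis by (simp add: noise_def tup_def)
qed

lemma noise_pair_measurable:
  assumes r: "r < R" "k < K" "m < M"
  shows "(\<lambda>z. sg (wf (untuple (fst z)) r k m) (snd z (r, k, m)) i - Gr m (wf (untuple (fst z)) r k m) i)
    \<in> borel_measurable (PiM (past r k) DD \<Otimes>\<^sub>M PiM {(r, k, m)} DD)"
proof -
  have "(\<lambda>a. wf (untuple a) r k m j) \<in> borel_measurable (PiM (past r k) DD)" for j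
    using r by (intro adapted_measurable[OF adapted_wf]) auto
  from measurable_compose[OF measurable_fst this]
  have w: "(\<lambda>z. wf (untuple (fst z)) r k m j) \<in> borel_measurable (PiM (past r k) DD \<Otimes>\<^sub>M PiM {(r, k, m)} DD)" for j .
  have "(\<lambda>y. y (r, k, m)) \<in> measurable (PiM {(r, k, m)} DD) (D m)"
    using measurable_component_singleton[of "(r, k, m)" "{(r, k, m)}" DD] by simp
  from measurable_compose[OF measurable_snd this]
  have x: "(\<lambda>z. snd z (r, k, m)) \<in> measurable (PiM (past r k) DD \<Otimes>\<^sub>M PiM {(r, k, m)} DD) (D m)" .
  show ?thesis using r w x by (intro borel_measurable_diff sg_measurable Gr_measurable) auto
qed

text \<open>With the past frozen the iterate is a fixed point, and
  \<open>noise_second_moment\<close> is uniform in that point.\<close>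

lemma noise_bound:
  assumes r: "r < R" "k < K" "m < M"
  shows "integrable P (\<lambda>\<omega>. (nrm d p (noise (Xi \<omega>) r k m))\<^sup>2)" "(\<integral>\<omega>. (nrm d p (noise (Xi \<omega>) r k m))\<^sup>2 \<partial>P) \<le> \<nu>"
proof -
  interpret prob_space P by (rule probability_space)
  define n where "n a y i = sg (wf (untuple a) r k m) (y (r, k, m)) i - Gr m (wf (untuple a) r k m) i"
    for a y :: "nat \<times> nat \<times> nat \<Rightarrow> 'a" and i
  have n: "n (tup (past r k) \<omega>) (tup {(r, k, m)} \<omega>) = noise (Xi \<omega>) r k m" for \<omega>
    unfolding n_def using noise_tup[OF r] by (intro ext)
  have "integrable P (\<lambda>\<omega>. (nrm d p (n (tup (past r k) \<omega>) (tup {(r, k, m)} \<omega>)))\<^sup>2) \<and>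
    expectation (\<lambda>\<omega>. (nrm d p (n (tup (past r k) \<omega>) (tup {(r, k, m)} \<omega>)))\<^sup>2) \<le> \<nu>"
  proof (rule indep_expectation_le[where g = "\<lambda>a y. (nrm d p (n a y))\<^sup>2", OF indep_past[OF r]])
    have "(\<lambda>z. (nrm d p (n (fst z) (snd z)))\<^sup>2) \<in> borel_measurable (PiM (past r k) DD \<Otimes>\<^sub>M PiM {(r, k, m)} DD)"
      unfolding n_def by (intro borel_measurable_power nrm_measurable noise_pair_measurable r)
    then show "(\<lambda>(a, y). (nrm d p (n a y))\<^sup>2) \<in> borel_measurable (PiM (past r k) DD \<Otimes>\<^sub>M PiM {(r, k, m)} DD)"
      by (simp only: case_prod_unfold)
    show "0 \<le> \<nu>" by (simp add: \<nu>_def)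
  next
    fix a :: "nat \<times> nat \<times> nat \<Rightarrow> 'a"
    let ?h = "\<lambda>x. (nrm d p (\<lambda>i. sg (wf (untuple a) r k m) x i - Gr m (wf (untuple a) r k m) i))\<^sup>2"
    note sd = sample_distr[OF r noise_sq_measurable[OF r(3), of "wf (untuple a) r k m"]]
    show "integrable (distr P (PiM {(r, k, m)} DD) (tup {(r, k, m)})) (\<lambda>y. (nrm d p (n a y))\<^sup>2)"
      using sd(1) noise_second_moment(1)[OF r(3)] unfolding n_def by simp
    show "(\<integral>y. (nrm d p (n a y))\<^sup>2 \<partial>distr P (PiM {(r, k, m)} DD) (tup {(r, k, m)})) \<le> \<nu>"
      using sd(2) noise_second_moment(2)[OF r(3)] unfolding n_def by simp
  qed simp
  then show "integrable P (\<lambda>\<omega>. (nrm d p (noise (Xi \<omega>) r k m))\<^sup>2)" "(\<integral>\<omega>. (nrm d p (noise (Xi \<omega>) r k m))\<^sup>2 \<partial>P) \<le> \<nu>"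
    unfolding n by auto
qed

lemma noise_square_integrable:
  assumes r: "r < R" "k < K" "m < M"
  shows "square_integrable P (\<lambda>\<omega>. noise (Xi \<omega>) r k m i)"
proof (cases "i < d")
  case True
  have m: "(\<lambda>\<omega>. noise (Xi \<omega>) r k m i) \<in> borel_measurable P"
    using r by (intro adapted_random_variable[OF r(1) adapted_noise])
  have int: "integrable P (\<lambda>\<omega>. (nrm d p (noise (Xi \<omega>) r k m))\<^sup>2)" by (rule noise_bound[OF r])
  have "square_integrable P (\<lambda>\<omega>. nrm d p (noise (Xi \<omega>) r k m))"
    unfolding square_integrable_def
  proof
    show "(\<lambda>\<omega>. nrm d p (noise (Xi \<omega>) r k m)) \<in> borel_measurable P"
      using r by (intro nrm_measurable adapted_random_variable[OF r(1) adapted_noise])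
  qed (rule int)
  then show ?thesis using m
    by (rule square_integrable_bound) (use True p_gt_2 in \<open>auto intro: abs_le_nrm\<close>)
next
  case False
  then show ?thesis
    using square_integrable_const[OF probability_space, of 0] by (simp add: noise_def sg_def Gr_def)
qed

text \<open>With the past frozen, \<open>H\<close> is a constant factor and the noise has mean
  zero.\<close>

lemma noise_orthogonal:
  assumes r: "r < R" "k < K" "m < M" and H: "adapted r k H"
    and SI: "square_integrable P (\<lambda>\<omega>. H (Xi \<omega>))"
  shows "integrable P (\<lambda>\<omega>. H (Xi \<omega>) * noise (Xi \<omega>) r k m i)"
    and "(\<integral>\<omega>. H (Xi \<omega>) * noise (Xi \<omega>) r k m i \<partial>P) = 0"
proof -
  interpret prob_space P by (rule probability_space)
  show int: "integrable P (\<lambda>\<omega>. H (Xi \<omega>) * noise (Xi \<omega>) r k m i)"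
    by (rule square_integrable_mult[OF SI noise_square_integrable[OF r]])
  define g where "g a y = H (untuple a) * (sg (wf (untuple a) r k m) (y (r, k, m)) i - Gr m (wf (untuple a) r k m) i)"
    for a y :: "nat \<times> nat \<times> nat \<Rightarrow> 'a"
  have g: "g (tup (past r k) \<omega>) (tup {(r, k, m)} \<omega>) = H (Xi \<omega>) * noise (Xi \<omega>) r k m i" for \<omega>
    unfolding g_def noise_tup[OF r] adapted_tup[OF H order_refl] ..
  have "expectation (\<lambda>\<omega>. g (tup (past r k) \<omega>) (tup {(r, k, m)} \<omega>)) = 0"
  proof (rule indep_expectation_zero[OF indep_past[OF r]])
    have "(\<lambda>z. H (untuple (fst z))) \<in> borel_measurable (PiM (past r k) DD \<Otimes>\<^sub>M PiM {(r, k, m)} DD)"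
      using measurable_compose[OF measurable_fst adapted_measurable[OF H order_refl]] .
    then have "(\<lambda>z. g (fst z) (snd z)) \<in> borel_measurable (PiM (past r k) DD \<Otimes>\<^sub>M PiM {(r, k, m)} DD)"
      unfolding g_def by (intro borel_measurable_times noise_pair_measurable r)
    then show "(\<lambda>(a, y). g a y) \<in> borel_measurable (PiM (past r k) DD \<Otimes>\<^sub>M PiM {(r, k, m)} DD)"
      by (simp only: case_prod_unfold)
    show "integrable P (\<lambda>\<omega>. g (tup (past r k) \<omega>) (tup {(r, k, m)} \<omega>))" unfolding g by (rule int)
  next
    fix a :: "nat \<times> nat \<times> nat \<Rightarrow> 'a"
    have meas: "(\<lambda>x. sg (wf (untuple a) r k m) x i - Gr m (wf (untuple a) r k m) i) \<in> borel_measurable (D m)"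
      using noise_mean(1)[OF r(3)] by (rule borel_measurable_integrable)
    show "(\<integral>y. g a y \<partial>distr P (PiM {(r, k, m)} DD) (tup {(r, k, m)})) = 0"
      using sample_distr(2)[OF r meas] noise_mean(2)[OF r(3)] by (simp add: g_def)
  qed
  then show "(\<integral>\<omega>. H (Xi \<omega>) * noise (Xi \<omega>) r k m i \<partial>P) = 0" unfolding g .
qed

text \<open>Mirror step and client gradients grow at most linearly, which is how square
  integrability passes from one iterate to the next.\<close>

lemma square_integrable_linear_growth:
  assumes V: "\<And>i. i < d \<Longrightarrow> square_integrable P (\<lambda>\<omega>. V \<omega> i)" and f: "f \<in> borel_measurable P"
    and le: "\<And>\<omega>. \<bar>f \<omega>\<bar> \<le> c + b * (\<Sum>j<d. \<bar>V \<omega> j\<bar>)"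
  shows "square_integrable P f"
proof (rule square_integrable_bound[OF _ f])
  show "square_integrable P (\<lambda>\<omega>. c + b * (\<Sum>j<d. \<bar>V \<omega> j\<bar>))"
    by (intro square_integrable_add square_integrable_scale square_integrable_sum square_integrable_abs
        square_integrable_const probability_space V) simp
qed (rule le)

lemma abs_dualv_le: "i < d \<Longrightarrow> \<bar>dualv d p v i\<bar> \<le> (\<Sum>j<d. \<bar>v j\<bar>)"
proof -
  assume "i < d"
  then have "\<bar>dualv d p v i\<bar> \<le> nrm d q (dualv d p v)"
    using pq by (intro abs_le_nrm) (auto simp: conjugate_exponents_def)
  also have "\<dots> = nrm d p v" by (rule nrm_dualv[OF pq])
  also have "\<dots> \<le> (\<Sum>j<d. \<bar>v j\<bar>)" using p_gt_2 by (intro nrm_le_sum_abs) simp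
  finally show ?thesis .
qed

lemma abs_Gr_le:
  assumes "m < M" shows "\<bar>Gr m v i\<bar> \<le> \<bar>Gr m (\<lambda>_. 0) i\<bar> + L * (\<Sum>j<d. \<bar>v j\<bar>)"
proof (cases "i < d")
  case True
  have "\<bar>Gr m v i - Gr m (\<lambda>_. 0) i\<bar> \<le> L * (\<Sum>j<d. \<bar>v j\<bar>)"
    using Gr_lipschitz_inf[OF assms True, of v "\<lambda>_. 0"] by (simp add: nrm_1)
  then show ?thesis by linarith
next
  case False
  then show ?thesis using parameters by (simp add: Gr_def sum_nonneg)
qed

lemma square_integrable_dualv:
  assumes "r < R" "\<And>i. adapted r k (\<lambda>x. V x i)" "\<And>i. i < d \<Longrightarrow> square_integrable P (\<lambda>\<omega>. V (Xi \<omega>) i)" "i < d"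
  shows "square_integrable P (\<lambda>\<omega>. dualv d p (V (Xi \<omega>)) i)"
proof (rule square_integrable_linear_growth[of "\<lambda>\<omega>. V (Xi \<omega>)" _ 0 1])
  show "(\<lambda>\<omega>. dualv d p (V (Xi \<omega>)) i) \<in> borel_measurable P"
    using assms by (intro adapted_random_variable[OF assms(1) adapted_dualv])
qed (use assms abs_dualv_le in auto)

lemma square_integrable_wf:
  assumes r: "r < R" "k \<le> K" "m < M" and z: "\<And>i. i < d \<Longrightarrow> square_integrable P (\<lambda>\<omega>. zf (Xi \<omega>) r k m i)" and i: "i < d"
  shows "square_integrable P (\<lambda>\<omega>. wf (Xi \<omega>) r k m i)"
proof -
  have "square_integrable P (\<lambda>\<omega>. 1 / (p - 1) * dualv d p (zf (Xi \<omega>) r k m) i)"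
    by (intro square_integrable_scale square_integrable_dualv[where V = "\<lambda>x. zf x r k m", OF r(1) adapted_zf[OF r(3,2)] z i])
  then show ?thesis by (simp add: wf_def mgrad_def)
qed

lemma square_integrable_Gr_wf:
  assumes r: "r < R" "k \<le> K" "m < M" and w: "\<And>i. i < d \<Longrightarrow> square_integrable P (\<lambda>\<omega>. wf (Xi \<omega>) r k m i)"
  shows "square_integrable P (\<lambda>\<omega>. Gr m (wf (Xi \<omega>) r k m) i)"
proof (rule square_integrable_linear_growth[where V = "\<lambda>\<omega>. wf (Xi \<omega>) r k m"])
  show "(\<lambda>\<omega>. Gr m (wf (Xi \<omega>) r k m) i) \<in> borel_measurable P"
    using w r(3) by (intro Gr_measurable) (simp_all add: square_integrable_def)
  show "\<bar>Gr m (wf (Xi \<omega>) r k m) i\<bar> \<le> \<bar>Gr m (\<lambda>_. 0) i\<bar> + L * (\<Sum>j<d. \<bar>wf (Xi \<omega>) r k m j\<bar>)" for \<omega>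
    by (rule abs_Gr_le[OF r(3)])
qed (rule w)

lemma square_integrable_zf_Suc:
  assumes r: "r < R" "k < K" "m < M" and z: "\<And>i. i < d \<Longrightarrow> square_integrable P (\<lambda>\<omega>. zf (Xi \<omega>) r k m i)" and i: "i < d"
  shows "square_integrable P (\<lambda>\<omega>. zf (Xi \<omega>) r (Suc k) m i)"
proof -
  define Y where "Y \<omega> = zf (Xi \<omega>) r k m i - \<eta> * (Gr m (wf (Xi \<omega>) r k m) i + noise (Xi \<omega>) r k m i)" for \<omega>
  have w: "square_integrable P (\<lambda>\<omega>. wf (Xi \<omega>) r k m i)" if "i < d" for i
    by (rule square_integrable_wf[OF _ _ _ z that]) (use r in simp_all)
  have "square_integrable P (\<lambda>\<omega>. Gr m (wf (Xi \<omega>) r k m) i)"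
    by (rule square_integrable_Gr_wf[OF _ _ _ w]) (use r in simp_all)
  from square_integrable_diff[OF z[OF i] square_integrable_scale[OF square_integrable_add[OF this noise_square_integrable[OF r]]]]
  have "square_integrable P Y" unfolding Y_def .
  then show ?thesis
  \<comment> \<open>\<open>Y\<close> is known to agree with the iterate only on
    \<open>space P\<close>, where the samples are valid; hence a bound by \<open>Y\<close> instead
    of a rewriting.\<close>
  proof (rule square_integrable_bound[OF square_integrable_abs])
    show "(\<lambda>\<omega>. zf (Xi \<omega>) r (Suc k) m i) \<in> borel_measurable P"
      by (rule adapted_random_variable[OF r(1) adapted_zf]) (use r in simp_all)
    fix \<omega> assume "\<omega> \<in> space P"
    then have v: "valid (Xi \<omega>)" by (rule valid_Xi)
    have "zf (Xi \<omega>) r (Suc k) m i = Y \<omega>"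
      unfolding Y_def by (subst zf_Suc[OF r(3)]) (use v r in \<open>auto simp: valid_def\<close>)
    then show "\<bar>zf (Xi \<omega>) r (Suc k) m i\<bar> \<le> \<bar>Y \<omega>\<bar>" by simp
  qed
qed

lemma square_integrable_zf_local:
  assumes r: "r < R" "m < M" and base: "\<And>i. i < d \<Longrightarrow> square_integrable P (\<lambda>\<omega>. zf (Xi \<omega>) r 0 m i)"
  shows "k \<le> K \<Longrightarrow> i < d \<Longrightarrow> square_integrable P (\<lambda>\<omega>. zf (Xi \<omega>) r k m i)"
proof (induction k arbitrary: i)
  case 0
  then show ?case by (intro base)
next
  case (Suc k)
  show ?case
    by (rule square_integrable_zf_Suc[OF r(1) _ r(2) Suc.IH]) (use Suc.prems in simp_all)
qed

lemma square_integrable_zf: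
  assumes "r < R" "m < M" "k \<le> K" "i < d"
  shows "square_integrable P (\<lambda>\<omega>. zf (Xi \<omega>) r k m i)"
  using assms
proof (induction r arbitrary: k m i)
  case 0
  have "square_integrable P (\<lambda>\<omega>. zf (Xi \<omega>) 0 0 m i)" for i
    unfolding zf_start by (rule square_integrable_const[OF probability_space])
  then show ?case by (rule square_integrable_zf_local[OF 0(1,2) _ 0(3,4)])
next
  case (Suc r)
  have IH: "square_integrable P (\<lambda>\<omega>. zf (Xi \<omega>) r K j i)" if "j < M" "i < d" for i j
    using Suc.prems(1) that by (intro Suc.IH) auto
  have "square_integrable P (\<lambda>\<omega>. zf (Xi \<omega>) (Suc r) 0 m i)" if "i < d" for i
    unfolding zf_round
    by (rule square_integrable_sum[OF probability_space], rule square_integrable_scale, rule IH) (use that in auto)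
  then show ?case by (rule square_integrable_zf_local[OF Suc.prems(1,2) _ Suc.prems(3,4)])
qed

lemma square_integrable_noise_sum:
  assumes "r < R" "k \<le> K" "m < M"
  shows "square_integrable P (\<lambda>\<omega>. \<Sum>l<k. noise (Xi \<omega>) r l m i)"
  using assms by (intro square_integrable_sum probability_space noise_square_integrable) auto

lemma nrm_sq_integrable:
  assumes "\<And>i. i < d \<Longrightarrow> square_integrable P (\<lambda>\<omega>. V \<omega> i)" "1 \<le> p'"
  shows "integrable P (\<lambda>\<omega>. (nrm d p' (V \<omega>))\<^sup>2)"
proof -
  have "square_integrable P (\<lambda>\<omega>. nrm d p' (V \<omega>))"
  proof (rule square_integrable_linear_growth[of V _ 0 1])
    show "(\<lambda>\<omega>. nrm d p' (V \<omega>)) \<in> borel_measurable P"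
      using assms by (intro nrm_measurable) (simp add: square_integrable_def)
  qed (use assms nrm_le_sum_abs in auto)
  then show ?thesis by (simp add: square_integrable_def)
qed

lemma ip_integrable:
  assumes "\<And>i. i < d \<Longrightarrow> square_integrable P (\<lambda>\<omega>. V \<omega> i)" "\<And>i. i < d \<Longrightarrow> square_integrable P (\<lambda>\<omega>. W \<omega> i)"
  shows "integrable P (\<lambda>\<omega>. ip d (V \<omega>) (W \<omega>))"
  unfolding ip_def using assms by (intro Bochner_Integration.integrable_sum square_integrable_mult) auto

lemma noise_ip_orthogonal:
  assumes r: "r < R" "k < K" "m < M" and H: "\<And>i. adapted r k (\<lambda>x. H x i)"
    and SI: "\<And>i. i < d \<Longrightarrow> square_integrable P (\<lambda>\<omega>. H (Xi \<omega>) i)"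
  shows "integrable P (\<lambda>\<omega>. ip d (H (Xi \<omega>)) (noise (Xi \<omega>) r k m))"
    and "(\<integral>\<omega>. ip d (H (Xi \<omega>)) (noise (Xi \<omega>) r k m) \<partial>P) = 0"
proof -
  show "integrable P (\<lambda>\<omega>. ip d (H (Xi \<omega>)) (noise (Xi \<omega>) r k m))"
    by (rule ip_integrable[OF SI noise_square_integrable[OF r]])
  have orth: "integrable P (\<lambda>\<omega>. H (Xi \<omega>) i * noise (Xi \<omega>) r k m i)"
    "(\<integral>\<omega>. H (Xi \<omega>) i * noise (Xi \<omega>) r k m i \<partial>P) = 0" if "i < d" for i
    using noise_orthogonal[where H = "\<lambda>x. H x i", OF r H SI[OF that]] by blast+
  have "(\<integral>\<omega>. ip d (H (Xi \<omega>)) (noise (Xi \<omega>) r k m) \<partial>P) =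
      (\<Sum>i<d. \<integral>\<omega>. H (Xi \<omega>) i * noise (Xi \<omega>) r k m i \<partial>P)"
    unfolding ip_def by (rule Bochner_Integration.integral_sum) (simp add: orth(1))
  also have "\<dots> = 0" by (rule sum.neutral) (simp add: orth(2))
  finally show "(\<integral>\<omega>. ip d (H (Xi \<omega>)) (noise (Xi \<omega>) r k m) \<partial>P) = 0" .
qed

text \<open>Takes the place of the Pythagorean identity: the new noise vector is orthogonal to the
  dual vector of the sum so far and adds its own second moment times \<open>p - 1\<close>.\<close>

lemma martingale_bound:
  assumes r: "r < R" "m < M"
  shows "k \<le> K \<Longrightarrow> (\<integral>\<omega>. (nrm d p (\<lambda>i. \<Sum>l<k. noise (Xi \<omega>) r l m i))\<^sup>2 \<partial>P) \<le> real k * ((p - 1) * \<nu>)"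
proof (induction k)
  case (Suc k)
  define V where "V x i = (\<Sum>l<k. noise x r l m i)" for x i
  have k: "k < K" using Suc.prems by simp
  have VSI: "square_integrable P (\<lambda>\<omega>. V (Xi \<omega>) i)" for i
    unfolding V_def using r k by (intro square_integrable_noise_sum) auto
  have Vad: "adapted r k (\<lambda>x. V x i)" for i
    unfolding V_def using r k by (intro adapted_noise_sum) auto
  have dSI: "square_integrable P (\<lambda>\<omega>. dualv d p (V (Xi \<omega>)) i)" if "i < d" for i
    by (rule square_integrable_dualv[OF r(1) Vad VSI that])
  have dad: "adapted r k (\<lambda>x. dualv d p (V x) i)" for i by (rule adapted_dualv[OF Vad])
  note orth = noise_ip_orthogonal[OF r(1) k r(2), where H = "\<lambda>x. dualv d p (V x)", OF dad dSI]
  note nb = noise_bound[OF r(1) k r(2)]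
  have i1: "integrable P (\<lambda>\<omega>. (nrm d p (V (Xi \<omega>)))\<^sup>2)"
    using p_gt_2 VSI by (intro nrm_sq_integrable) auto
  have "(\<integral>\<omega>. (nrm d p (\<lambda>i. \<Sum>l<Suc k. noise (Xi \<omega>) r l m i))\<^sup>2 \<partial>P) \<le>
    (\<integral>\<omega>. (nrm d p (V (Xi \<omega>)))\<^sup>2 + 2 * ip d (dualv d p (V (Xi \<omega>))) (noise (Xi \<omega>) r k m)
       + (p - 1) * (nrm d p (noise (Xi \<omega>) r k m))\<^sup>2 \<partial>P)"
  proof (rule integral_mono)
    show "integrable P (\<lambda>\<omega>. (nrm d p (\<lambda>i. \<Sum>l<Suc k. noise (Xi \<omega>) r l m i))\<^sup>2)"
      using p_gt_2 r Suc.prems by (intro nrm_sq_integrable square_integrable_noise_sum) auto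
    show "integrable P (\<lambda>\<omega>. (nrm d p (V (Xi \<omega>)))\<^sup>2 + 2 * ip d (dualv d p (V (Xi \<omega>))) (noise (Xi \<omega>) r k m)
       + (p - 1) * (nrm d p (noise (Xi \<omega>) r k m))\<^sup>2)"
      using i1 orth(1) nb(1) by auto
    show "(nrm d p (\<lambda>i. \<Sum>l<Suc k. noise (Xi \<omega>) r l m i))\<^sup>2 \<le> (nrm d p (V (Xi \<omega>)))\<^sup>2
       + 2 * ip d (dualv d p (V (Xi \<omega>))) (noise (Xi \<omega>) r k m) + (p - 1) * (nrm d p (noise (Xi \<omega>) r k m))\<^sup>2" for \<omega>
      using nrm_sq_smooth[OF p_gt_2, of d "V (Xi \<omega>)" "noise (Xi \<omega>) r k m"] by (simp add: V_def)
  qed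
  also have "\<dots> = (\<integral>\<omega>. (nrm d p (V (Xi \<omega>)))\<^sup>2 \<partial>P) + (p - 1) * (\<integral>\<omega>. (nrm d p (noise (Xi \<omega>) r k m))\<^sup>2 \<partial>P)"
    using i1 orth nb(1) by simp
  also have "\<dots> \<le> real k * ((p - 1) * \<nu>) + (p - 1) * \<nu>"
    using Suc p_gt_2 nb(2) unfolding V_def by (intro add_mono mult_left_mono) auto
  finally show ?case by (simp add: algebra_simps)
qed simp

lemma nu_nonneg: "0 \<le> \<nu>" by (simp add: \<nu>_def)

text \<open>The objective lies between its tangent at 0 and the quadratic upper bound there, both
  integrable.\<close>

lemma cf_integrable:
  assumes m: "m < M" and V: "\<And>i. i < d \<Longrightarrow> square_integrable P (\<lambda>\<omega>. V \<omega> i)"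
  shows "integrable P (\<lambda>\<omega>. cf m (V \<omega>))"
proof -
  interpret smooth_clients d M p q "exp 1 * L" cf Gr wsf by (rule smooth_clients)
  define c where "c = cf m (\<lambda>_. 0)"
  define g where "g = Gr m (\<lambda>_. 0)"
  show ?thesis
  proof (rule Bochner_Integration.integrable_bound)
    have n: "integrable P (\<lambda>\<omega>. (nrm d q (V \<omega>))\<^sup>2)"
      by (rule nrm_sq_integrable[OF V]) (use qp in \<open>auto simp: conjugate_exponents_def\<close>)
    have ip: "integrable P (\<lambda>\<omega>. ip d g (V \<omega>))"
      by (rule ip_integrable[OF square_integrable_const[OF probability_space] V])
    have c: "integrable P (\<lambda>\<omega>. \<bar>c\<bar>)"
      by (rule square_integrable_integrable[OF probability_space square_integrable_const[OF probability_space]])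
    show "integrable P (\<lambda>\<omega>. \<bar>c\<bar> + \<bar>ip d g (V \<omega>)\<bar> + exp 1 * L * (nrm d q (V \<omega>))\<^sup>2)"
      by (rule Bochner_Integration.integrable_add[OF
            Bochner_Integration.integrable_add[OF c integrable_abs[OF ip]] integrable_mult_right[OF n]])
    show "(\<lambda>\<omega>. cf m (V \<omega>)) \<in> borel_measurable P"
      using m V by (intro cf_measurable) (auto simp: square_integrable_def)
    show "AE \<omega> in P. norm (cf m (V \<omega>)) \<le> norm (\<bar>c\<bar> + \<bar>ip d g (V \<omega>)\<bar> + exp 1 * L * (nrm d q (V \<omega>))\<^sup>2)"
    proof (rule AE_I2)
      fix \<omega>
      have "c + ip d g (V \<omega>) \<le> cf m (V \<omega>)"
        using convex[OF m, of "\<lambda>_. 0" "V \<omega>"] by (simp add: c_def g_def)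
      moreover have "cf m (V \<omega>) \<le> c + ip d g (V \<omega>) + exp 1 * L * (nrm d q (V \<omega>))\<^sup>2"
        using upper[OF m, of "V \<omega>" "\<lambda>_. 0"] by (simp add: c_def g_def)
      moreover have "0 \<le> exp 1 * L * (nrm d q (V \<omega>))\<^sup>2" using parameters by simp
      ultimately show "norm (cf m (V \<omega>)) \<le> norm (\<bar>c\<bar> + \<bar>ip d g (V \<omega>)\<bar> + exp 1 * L * (nrm d q (V \<omega>))\<^sup>2)"
        unfolding real_norm_def by linarith
    qed
  qed
qed

lemma avg_iterate_eq:
  assumes "valid x" "m < M"
  shows "avg_iterate d M K R p \<eta> F U w0 x m = vec d (\<lambda>i. (\<Sum>r<R. wf x r 0 m i) / real R)"
proof -
  have "mirror_inv d p (round_dual d M K p \<eta> F U w0 x r m) = vec d (wf x r 0 m)" for r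
  proof -
    have "Zd x r 0 m = vec d (zf x r 0 m)" using assms by (intro Zd_zf Zd_carrier) auto
    then show ?thesis using mirror_inv_vec[OF p_gt_2, of d "zf x r 0 m"] by (simp add: Zd_def wf_def)
  qed
  then show ?thesis unfolding avg_iterate_def by (intro eq_vecI) auto
qed

definition fb :: "(nat \<Rightarrow> real) \<Rightarrow> real" where "fb x = (\<Sum>m<M. cf m x) / real M"

text \<open>The tangent inequalities at the mean are summed over the rounds, and the linear terms
  cancel.\<close>

lemma fb_jensen: "fb (\<lambda>i. (\<Sum>r<R. y r i) / real R) \<le> (\<Sum>r<R. fb (y r)) / real R"
proof -
  define yb where "yb = (\<lambda>i. (\<Sum>r<R. y r i) / real R)"
  have R: "0 < real R" using sizes by simp
  have "cf m yb \<le> (\<Sum>r<R. cf m (y r)) / real R" if m: "m < M" for m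
  proof -
    have "(\<Sum>r<R. cf m yb + ip d (Gr m yb) (\<lambda>i. y r i - yb i)) \<le> (\<Sum>r<R. cf m (y r))"
      by (intro sum_mono cf_convex m)
    moreover have "(\<Sum>r<R. ip d (Gr m yb) (\<lambda>i. y r i - yb i)) = 0"
    proof -
      have "(\<Sum>r<R. y r i - yb i) = 0" for i using R by (simp add: yb_def sum_subtractf)
      then show ?thesis unfolding ip_sum_right[symmetric] by (simp add: ip_def)
    qed
    ultimately show ?thesis using R by (simp add: sum.distrib pos_le_divide_eq mult.commute)
  qed
  then have "(\<Sum>m<M. cf m yb) \<le> (\<Sum>m<M. (\<Sum>r<R. cf m (y r)) / real R)" by (intro sum_mono) auto
  also have "\<dots> = (\<Sum>r<R. \<Sum>m<M. cf m (y r)) / real R"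
    by (subst sum.swap) (simp add: sum_divide_distrib)
  finally have "fb yb \<le> (\<Sum>r<R. \<Sum>m<M. cf m (y r)) / real R / real M"
    unfolding fb_def by (intro divide_right_mono) auto
  then show ?thesis by (simp add: yb_def fb_def sum_divide_distrib[symmetric] divide_divide_eq_left mult.commute)
qed

lemma subopt_eq:
  assumes "\<omega> \<in> space P" "m < M"
  shows "subopt d M K R p \<eta> D F U \<xi> w0 wstar m \<omega> = fb (\<lambda>i. (\<Sum>r<R. wf (Xi \<omega>) r 0 m i) / real R) - fb wsf"
  unfolding subopt_def avg_iterate_eq[OF valid_Xi[OF assms(1)] assms(2)]
  using global_obj_vec[of wsf] by (simp add: global_obj_vec fb_def vec_wsf)

lemma fb_integrable:
  assumes "\<And>i. i < d \<Longrightarrow> square_integrable P (\<lambda>\<omega>. V \<omega> i)"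
  shows "integrable P (\<lambda>\<omega>. fb (V \<omega>))"
  unfolding fb_def using assms by (intro integrable_divide Bochner_Integration.integrable_sum cf_integrable) auto

lemma square_integrable_wf': "r < R \<Longrightarrow> k \<le> K \<Longrightarrow> m < M \<Longrightarrow> i < d \<Longrightarrow> square_integrable P (\<lambda>\<omega>. wf (Xi \<omega>) r k m i)"
  by (rule square_integrable_wf[OF _ _ _ square_integrable_zf]) auto

lemma subopt_integrable:
  assumes m: "m < M"
  shows "integrable P (subopt d M K R p \<eta> D F U \<xi> w0 wstar m)"
proof -
  have c: "integrable P (\<lambda>\<omega>. fb wsf)"
    using square_integrable_integrable[OF probability_space square_integrable_const[OF probability_space]] .
  have "square_integrable P (\<lambda>\<omega>. 1 / real R * (\<Sum>r<R. wf (Xi \<omega>) r 0 m i))" if "i < d" for i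
    using m that by (intro square_integrable_scale square_integrable_sum probability_space square_integrable_wf') auto
  then have "integrable P (\<lambda>\<omega>. fb (\<lambda>i. (\<Sum>r<R. wf (Xi \<omega>) r 0 m i) / real R) - fb wsf)"
    by (intro Bochner_Integration.integrable_diff[OF fb_integrable c]) simp
  then show ?thesis
    using Bochner_Integration.integrable_cong[OF refl subopt_eq[OF _ m], of P "\<lambda>\<omega>. \<omega>"] by simp
qed

end

section \<open>From the path bound to the expected gap\<close>

context dfedda_run
begin

text \<open>At the dual starting point the Fenchel gap becomes the Bregman divergence by
  \<open>mconj_mgrad\<close>, and the assumption on \<open>w0\<close> applies.\<close>

lemma potential_z0: "(nrm d q wsf)\<^sup>2 / (2 * (q - 1)) + mconj d p z0 - ip d z0 wsf = bregman d (mirror_map p) wstar w0"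
proof -
  have p1: "1 < p" using p_gt_2 by simp
  have "bregman d (mirror_map p) (vec d wsf) (vec d w0f)
      = mconj d q wsf - mconj d q w0f - ip d z0 (\<lambda>i. wsf i - w0f i)"
    unfolding bregman_def gradient_mirror_map[OF p_gt_2] mirror_map_vec[OF p1] q_def[symmetric] vec_diff_vec scalar_prod_vec
    by (simp add: z0_def)
  then show ?thesis
    using mconj_mgrad[OF pq, of d w0f]
    by (simp add: vec_wsf vec_w0f z0_def ip_diff_right mconj_def[of d q wsf])
qed

text \<open>\<open>wbar\<close>, \<open>NN\<close> and \<open>IN\<close> repeat \<open>wb\<close>,
  \<open>Nz\<close> and \<open>I\<close> of the path analysis as functionals of the sample array:
  those constants belong to one fixed array, while expectations range over all of them.\<close>

definition wbar :: "(nat \<Rightarrow> nat \<Rightarrow> nat \<Rightarrow> 'a) \<Rightarrow> nat \<Rightarrow> nat \<Rightarrow> real" where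
  "wbar x r = mgrad d p (\<lambda>i. (\<Sum>m<M. zf x r 0 m i) / real M)"

definition NN :: "(nat \<Rightarrow> nat \<Rightarrow> nat \<Rightarrow> 'a) \<Rightarrow> nat \<Rightarrow> nat \<Rightarrow> real" where
  "NN x r k = (\<Sum>m<M. (nrm d p (\<lambda>i. \<Sum>l<k. noise x r l m i))\<^sup>2) / real M"

definition IN :: "(nat \<Rightarrow> nat \<Rightarrow> nat \<Rightarrow> 'a) \<Rightarrow> nat \<Rightarrow> real" where
  "IN x r = (\<Sum>k<K. (\<Sum>m<M. ip d (\<lambda>i. wbar x r i - wsf i) (noise x r k m)) / real M)"

abbreviation "kap \<equiv> 9 * mixing_time M U"
abbreviation "het \<equiv> heterogeneity d M p D F wstar"
abbreviation "BB \<equiv> exp 1 * L"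

lemma path_bound_valid:
  assumes x: "valid x"
  shows "(\<Sum>r<R. (\<Sum>m<M. fb (wf x r 0 m) - fb wsf) / real M) \<le>
     2 * mirror_map p wstar / (\<eta> * K) + 48 * \<eta>\<^sup>2 * BB * K\<^sup>2 * kap\<^sup>2 * R * het
     + (40 * \<eta>\<^sup>2 * BB * kap\<^sup>2 + 2 * \<eta> / K) * (\<Sum>r<R. NN x r K)
     + 8 * \<eta>\<^sup>2 * BB / K * (\<Sum>r<R. \<Sum>k<K. NN x r k) - 2 / K * (\<Sum>r<R. IN x r)"
proof -
  interpret path: dfedda_path d M p q BB cf Gr wsf U K R \<eta> "noise x" "zf x" z0
    by (rule path[OF x])
  have "path.potential z0 \<le> mirror_map p wstar"
    using potential_z0 start(2) by (simp add: path.potential_def)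
  then have "2 * path.potential z0 / (\<eta> * K) \<le> 2 * mirror_map p wstar / (\<eta> * K)"
    using eta by (intro divide_right_mono) auto
  moreover have "path.fbar = fb" by (simp add: fun_eq_iff path.fbar_def fb_def path.av_def)
  moreover have "path.Nz r k = NN x r k" for r k by (simp add: path.Nz_def NN_def path.av_def)
  moreover have "path.I r = IN x r" for r
    by (simp add: path.I_def IN_def path.av_def path.wb_def path.zb_def wbar_def)
  moreover have "path.E = het" by (simp add: path.E_def path.av_def heterogeneity_eq)
  ultimately show ?thesis using path.path_bound by (simp add: path.av_def path.\<kappa>_def wf_def)
qed

lemma NN_expectation:
  assumes "r < R" "k \<le> K"
  shows "integrable P (\<lambda>\<omega>. NN (Xi \<omega>) r k)" "(\<integral>\<omega>. NN (Xi \<omega>) r k \<partial>P) \<le> real K * ((p - 1) * \<nu>)"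
proof -
  have int: "integrable P (\<lambda>\<omega>. (nrm d p (\<lambda>i. \<Sum>l<k. noise (Xi \<omega>) r l m i))\<^sup>2)" if "m < M" for m
    by (rule nrm_sq_integrable[OF square_integrable_noise_sum]) (use assms that p_gt_2 in auto)
  then show "integrable P (\<lambda>\<omega>. NN (Xi \<omega>) r k)"
    unfolding NN_def by (intro integrable_divide Bochner_Integration.integrable_sum) auto
  have "(\<integral>\<omega>. NN (Xi \<omega>) r k \<partial>P) = (\<Sum>m<M. \<integral>\<omega>. (nrm d p (\<lambda>i. \<Sum>l<k. noise (Xi \<omega>) r l m i))\<^sup>2 \<partial>P) / real M"
    unfolding NN_def using int by (simp add: Bochner_Integration.integral_sum)
  also have "\<dots> \<le> (\<Sum>m<M. real K * ((p - 1) * \<nu>)) / real M"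
  proof (intro divide_right_mono sum_mono)
    fix m assume "m \<in> {..<M}"
    then have "(\<integral>\<omega>. (nrm d p (\<lambda>i. \<Sum>l<k. noise (Xi \<omega>) r l m i))\<^sup>2 \<partial>P) \<le> real k * ((p - 1) * \<nu>)"
      using assms by (intro martingale_bound) auto
    also have "\<dots> \<le> real K * ((p - 1) * \<nu>)"
      using assms p_gt_2 nu_nonneg by (intro mult_right_mono) auto
    finally show "(\<integral>\<omega>. (nrm d p (\<lambda>i. \<Sum>l<k. noise (Xi \<omega>) r l m i))\<^sup>2 \<partial>P) \<le> real K * ((p - 1) * \<nu>)" .
  qed simp
  also have "\<dots> = real K * ((p - 1) * \<nu>)" using sizes by simp
  finally show "(\<integral>\<omega>. NN (Xi \<omega>) r k \<partial>P) \<le> real K * ((p - 1) * \<nu>)" .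
qed

text \<open>The averaged iterate of round \<open>r\<close> depends on earlier rounds only, so it is
  orthogonal to the noise of every local step of the round.\<close>

lemma IN_expectation:
  assumes r: "r < R"
  shows "integrable P (\<lambda>\<omega>. IN (Xi \<omega>) r)" "(\<integral>\<omega>. IN (Xi \<omega>) r \<partial>P) = 0"
proof -
  define zb where "zb x i = 1 / real M * (\<Sum>m<M. zf x r 0 m i)" for x i
  define H where "H x i = wbar x r i - wsf i" for x i
  have zb_ad: "adapted r 0 (\<lambda>x. zb x i)" for i
    unfolding zb_def by (rule adapted_scale, rule adapted_sum, rule adapted_zf) auto
  have zb_SI: "square_integrable P (\<lambda>\<omega>. zb (Xi \<omega>) i)" if "i < d" for i
    unfolding zb_def
    by (rule square_integrable_scale, rule square_integrable_sum[OF probability_space], rule square_integrable_zf)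
       (use r that in auto)
  have w: "wbar x r = mgrad d p (zb x)" for x by (simp add: wbar_def zb_def[abs_def])
  have "adapted r 0 (\<lambda>x. H x i)" for i
    unfolding H_def w by (rule adapted_diff[OF adapted_mgrad[OF zb_ad] adapted_const])
  then have H_ad: "adapted r k (\<lambda>x. H x i)" for i k
    by (rule adapted_mono) (simp add: past_mono)
  have H_SI: "square_integrable P (\<lambda>\<omega>. H (Xi \<omega>) i)" if "i < d" for i
  proof -
    have "square_integrable P (\<lambda>\<omega>. 1 / (p - 1) * dualv d p (zb (Xi \<omega>)) i - wsf i)"
      by (rule square_integrable_diff[OF square_integrable_scale[OF square_integrable_dualv[OF r zb_ad zb_SI that]]
            square_integrable_const[OF probability_space]])
    then show ?thesis by (simp add: H_def w mgrad_def)
  qed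
  have ip: "integrable P (\<lambda>\<omega>. ip d (H (Xi \<omega>)) (noise (Xi \<omega>) r k m))"
    "(\<integral>\<omega>. ip d (H (Xi \<omega>)) (noise (Xi \<omega>) r k m) \<partial>P) = 0" if "k < K" "m < M" for k m
    using noise_ip_orthogonal[OF r that, where H = H, OF H_ad H_SI] by blast+
  have IN: "IN x r = (\<Sum>k<K. (\<Sum>m<M. ip d (H x) (noise x r k m)) / real M)" for x
    by (simp add: IN_def H_def[abs_def])
  show "integrable P (\<lambda>\<omega>. IN (Xi \<omega>) r)"
    unfolding IN by (intro Bochner_Integration.integrable_sum integrable_divide ip) auto
  have "(\<integral>\<omega>. IN (Xi \<omega>) r \<partial>P) = (\<Sum>k<K. \<integral>\<omega>. (\<Sum>m<M. ip d (H (Xi \<omega>)) (noise (Xi \<omega>) r k m)) / real M \<partial>P)"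
    unfolding IN by (rule Bochner_Integration.integral_sum)
      (intro Bochner_Integration.integrable_sum integrable_divide ip, auto)
  also have "\<dots> = (\<Sum>k<K. (\<Sum>m<M. \<integral>\<omega>. ip d (H (Xi \<omega>)) (noise (Xi \<omega>) r k m) \<partial>P) / real M)"
    using ip(1) by (intro sum.cong refl) (simp add: Bochner_Integration.integral_sum)
  also have "\<dots> = 0" using ip(2) by simp
  finally show "(\<integral>\<omega>. IN (Xi \<omega>) r \<partial>P) = 0" .
qed

text \<open>Jensen's inequality passes from the averaged point to the rounds, the path bound holds
  at every outcome, and integration removes the linear noise term.\<close>

lemma expected_gap_raw:
  "expected_gap d M K R p \<eta> D F U P \<xi> w0 wstar \<le>
     (2 * mirror_map p wstar / (\<eta> * K) + 48 * \<eta>\<^sup>2 * BB * K\<^sup>2 * kap\<^sup>2 * R * het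
     + (40 * \<eta>\<^sup>2 * BB * kap\<^sup>2 + 2 * \<eta> / K) * (R * (K * ((p - 1) * \<nu>)))
     + 8 * \<eta>\<^sup>2 * BB / K * (R * (K * (K * ((p - 1) * \<nu>))))) / R"
proof -
  interpret PP: prob_space P by (rule probability_space)
  define c0 where "c0 = 2 * mirror_map p wstar / (\<eta> * K) + 48 * \<eta>\<^sup>2 * BB * K\<^sup>2 * kap\<^sup>2 * R * het"
  define c1 where "c1 = 40 * \<eta>\<^sup>2 * BB * kap\<^sup>2 + 2 * \<eta> / K"
  define c2 where "c2 = 8 * \<eta>\<^sup>2 * BB / K"
  have c: "0 \<le> c1" "0 \<le> c2" using eta parameters by (auto simp: c1_def c2_def)
  have R: "0 < real R" and M: "0 < real M" using sizes by auto
  let ?Y = "\<lambda>\<omega>. c0 + c1 * (\<Sum>r<R. NN (Xi \<omega>) r K) + c2 * (\<Sum>r<R. \<Sum>k<K. NN (Xi \<omega>) r k) - 2 / K * (\<Sum>r<R. IN (Xi \<omega>) r)"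
  have i1: "integrable P (\<lambda>\<omega>. \<Sum>r<R. NN (Xi \<omega>) r K)"
    by (intro Bochner_Integration.integrable_sum NN_expectation) auto
  have i2: "integrable P (\<lambda>\<omega>. \<Sum>r<R. \<Sum>k<K. NN (Xi \<omega>) r k)"
    by (intro Bochner_Integration.integrable_sum NN_expectation) auto
  have i3: "integrable P (\<lambda>\<omega>. \<Sum>r<R. IN (Xi \<omega>) r)"
    by (intro Bochner_Integration.integrable_sum IN_expectation) auto
  have e1: "(\<integral>\<omega>. (\<Sum>r<R. NN (Xi \<omega>) r K) \<partial>P) \<le> R * (K * ((p - 1) * \<nu>))"
  proof -
    have "(\<integral>\<omega>. (\<Sum>r<R. NN (Xi \<omega>) r K) \<partial>P) = (\<Sum>r<R. \<integral>\<omega>. NN (Xi \<omega>) r K \<partial>P)"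
      by (intro Bochner_Integration.integral_sum NN_expectation) auto
    also have "\<dots> \<le> (\<Sum>r<R. K * ((p - 1) * \<nu>))" by (intro sum_mono NN_expectation) auto
    finally show ?thesis by simp
  qed
  have e2: "(\<integral>\<omega>. (\<Sum>r<R. \<Sum>k<K. NN (Xi \<omega>) r k) \<partial>P) \<le> R * (K * (K * ((p - 1) * \<nu>)))"
  proof -
    have "(\<integral>\<omega>. (\<Sum>r<R. \<Sum>k<K. NN (Xi \<omega>) r k) \<partial>P) = (\<Sum>r<R. \<integral>\<omega>. (\<Sum>k<K. NN (Xi \<omega>) r k) \<partial>P)"
      by (intro Bochner_Integration.integral_sum Bochner_Integration.integrable_sum NN_expectation) auto
    also have "\<dots> = (\<Sum>r<R. \<Sum>k<K. \<integral>\<omega>. NN (Xi \<omega>) r k \<partial>P)"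
      by (intro sum.cong refl Bochner_Integration.integral_sum NN_expectation) auto
    also have "\<dots> \<le> (\<Sum>r<R. \<Sum>k<K. K * ((p - 1) * \<nu>))" by (intro sum_mono NN_expectation) auto
    finally show ?thesis by simp
  qed
  have e3: "(\<integral>\<omega>. (\<Sum>r<R. IN (Xi \<omega>) r) \<partial>P) = 0"
  proof -
    have "(\<integral>\<omega>. (\<Sum>r<R. IN (Xi \<omega>) r) \<partial>P) = (\<Sum>r<R. \<integral>\<omega>. IN (Xi \<omega>) r \<partial>P)"
      by (intro Bochner_Integration.integral_sum IN_expectation) auto
    then show ?thesis using IN_expectation(2) by simp
  qed
  have Yint: "integrable P ?Y" using i1 i2 i3 by simp
  have "expected_gap d M K R p \<eta> D F U P \<xi> w0 wstar
    = (\<integral>\<omega>. (\<Sum>m<M. subopt d M K R p \<eta> D F U \<xi> w0 wstar m \<omega>) / M \<partial>P)"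
    unfolding expected_gap_def integral_divide_zero
    by (subst Bochner_Integration.integral_sum) (simp_all add: subopt_integrable)
  also have "\<dots> \<le> (\<integral>\<omega>. ?Y \<omega> / R \<partial>P)"
  proof (rule integral_mono)
    show "integrable P (\<lambda>\<omega>. (\<Sum>m<M. subopt d M K R p \<eta> D F U \<xi> w0 wstar m \<omega>) / M)"
      by (intro integrable_divide Bochner_Integration.integrable_sum subopt_integrable) auto
    show "integrable P (\<lambda>\<omega>. ?Y \<omega> / R)" using Yint by (rule integrable_divide)
    fix \<omega> assume w: "\<omega> \<in> space P"
    have "(\<Sum>m<M. subopt d M K R p \<eta> D F U \<xi> w0 wstar m \<omega>) \<le> (\<Sum>m<M. (\<Sum>r<R. fb (wf (Xi \<omega>) r 0 m) - fb wsf) / R)"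
    proof (intro sum_mono)
      fix m assume "m \<in> {..<M}"
      then have "subopt d M K R p \<eta> D F U \<xi> w0 wstar m \<omega> \<le> (\<Sum>r<R. fb (wf (Xi \<omega>) r 0 m)) / R - fb wsf"
        using fb_jensen[of "\<lambda>r. wf (Xi \<omega>) r 0 m"] by (simp add: subopt_eq[OF w])
      also have "\<dots> = (\<Sum>r<R. fb (wf (Xi \<omega>) r 0 m) - fb wsf) / R"
        using R by (simp add: sum_subtractf diff_divide_distrib)
      finally show "subopt d M K R p \<eta> D F U \<xi> w0 wstar m \<omega> \<le> (\<Sum>r<R. fb (wf (Xi \<omega>) r 0 m) - fb wsf) / R" .
    qed
    also have "\<dots> = (\<Sum>r<R. \<Sum>m<M. fb (wf (Xi \<omega>) r 0 m) - fb wsf) / R"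
      by (subst sum.swap) (simp add: sum_divide_distrib)
    finally have "(\<Sum>m<M. subopt d M K R p \<eta> D F U \<xi> w0 wstar m \<omega>) / M \<le>
       (\<Sum>r<R. \<Sum>m<M. fb (wf (Xi \<omega>) r 0 m) - fb wsf) / R / M" by (intro divide_right_mono) auto
    also have "\<dots> = (\<Sum>r<R. (\<Sum>m<M. fb (wf (Xi \<omega>) r 0 m) - fb wsf) / M) / R"
      by (simp add: sum_divide_distrib[symmetric] mult.commute)
    also have "\<dots> \<le> ?Y \<omega> / R"
      using path_bound_valid[OF valid_Xi[OF w]] unfolding c0_def c1_def c2_def by (intro divide_right_mono) auto
    finally show "(\<Sum>m<M. subopt d M K R p \<eta> D F U \<xi> w0 wstar m \<omega>) / M \<le> ?Y \<omega> / R" .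
  qed
  also have "\<dots> = (\<integral>\<omega>. ?Y \<omega> \<partial>P) / R" by simp
  also have "(\<integral>\<omega>. ?Y \<omega> \<partial>P) = c0 + c1 * (\<integral>\<omega>. (\<Sum>r<R. NN (Xi \<omega>) r K) \<partial>P)
      + c2 * (\<integral>\<omega>. (\<Sum>r<R. \<Sum>k<K. NN (Xi \<omega>) r k) \<partial>P) - 2 / K * (\<integral>\<omega>. (\<Sum>r<R. IN (Xi \<omega>) r) \<partial>P)"
    using i1 i2 i3 by (simp add: PP.prob_space)
  also have "\<dots> / R \<le> (c0 + c1 * (R * (K * ((p - 1) * \<nu>))) + c2 * (R * (K * (K * ((p - 1) * \<nu>))))) / R"
    unfolding e3 using e1 e2 c by (intro divide_right_mono) (auto intro!: add_mono mult_left_mono)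
  finally show ?thesis by (simp add: c0_def c1_def c2_def)
qed

end

lemma (in dfedda_run) expected_gap_le:
  "expected_gap d M K R p \<eta> D F U P \<xi> w0 wstar \<le> 12000 *
     (mirror_map p wstar / (real R * real K * \<eta>) + mixing_time M U * ln (real d) ^ 4 * \<sigma>\<^sup>2 * \<eta>
      + (mixing_time M U)\<^sup>2 * L * (real K)\<^sup>2 * het * \<eta>\<^sup>2)"
proof -
  interpret gossip_matrix M U by (rule gossip_matrix)
  define t where "t = ln (real d)"
  define \<tau> where "\<tau> = mixing_time M U"
  define V where "V = (p - 1) * \<nu>"
  define H where "H = mirror_map p wstar"
  have t: "1 \<le> t" using ln_d by (simp add: t_def)
  have tau: "1 \<le> \<tau>" using mixing_time_ge_1 by (simp add: \<tau>_def)
  have K: "0 < real K" and R: "0 < real R" using sizes by auto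
  have BB: "0 < BB" "BB \<le> 3 * L" using parameters exp_le by auto
  have het: "0 \<le> het" by (simp add: heterogeneity_def sum_nonneg)
  have H: "0 \<le> H" using qp by (simp add: H_def mirror_map_def Let_def q_def[symmetric] conjugate_exponents_def)
  have V0: "0 \<le> V" using p_gt_2 nu_nonneg by (simp add: V_def)
  have V: "V \<le> 102 * t ^ 4 * \<sigma>\<^sup>2"
  proof -
    have "\<nu> \<le> 3 * (17 * t\<^sup>2 * \<sigma>\<^sup>2)"
      unfolding \<nu>_def t_def using exp_le by (intro mult_right_mono) auto
    then have "V \<le> (2 * t) * (3 * (17 * t\<^sup>2 * \<sigma>\<^sup>2))"
      unfolding V_def using exponent p_gt_2 nu_nonneg t by (intro mult_mono) (auto simp: t_def)
    also have "\<dots> = 102 * t ^ 3 * \<sigma>\<^sup>2" by (simp add: power3_eq_cube power2_eq_square)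
    \<comment> \<open>The cube consists of two powers of \<open>ln d\<close> from the maximum over
      coordinates and one from \<open>p - 1\<close>; it is enlarged to the fourth power of the
      claim.\<close>
    also have "\<dots> \<le> 102 * t ^ 4 * \<sigma>\<^sup>2"
      using t by (intro mult_right_mono mult_left_mono power_increasing) auto
    finally show ?thesis .
  qed
  \<comment> \<open>\<theta> is the smallness quantity of the path analysis. It absorbs one of the
    two factors \<open>9 * \<tau>\<close> in the noise coefficient, so the noise term stays linear
    in \<tau>.\<close>
  define \<theta> where "\<theta> = \<eta> * BB * K * (9 * \<tau>)"
  have th: "0 \<le> \<theta>" "\<theta> \<le> 1 / 32" using small eta BB tau by (auto simp: \<theta>_def \<tau>_def mult.assoc)
  have a: "\<eta> * BB * K * 1 \<le> \<theta>"
    unfolding \<theta>_def using eta BB tau by (intro mult_left_mono) auto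
  have "expected_gap d M K R p \<eta> D F U P \<xi> w0 wstar \<le>
     (2 * H / (\<eta> * K) + 48 * \<eta>\<^sup>2 * BB * K\<^sup>2 * (9 * \<tau>)\<^sup>2 * R * het
     + (40 * \<eta>\<^sup>2 * BB * (9 * \<tau>)\<^sup>2 + 2 * \<eta> / K) * (R * (K * V))
     + 8 * \<eta>\<^sup>2 * BB / K * (R * (K * (K * V)))) / R"
    using expected_gap_raw by (simp only: V_def H_def \<tau>_def)
  also have "\<dots> = 2 * (H / (R * K * \<eta>)) + 48 * 81 * BB * (\<tau>\<^sup>2 * K\<^sup>2 * het * \<eta>\<^sup>2)
     + \<eta> * V * (40 * \<theta> * (9 * \<tau>) + 2 + 8 * (\<eta> * BB * K))"
    using K R eta by (simp add: \<theta>_def field_simps power2_eq_square)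
  also have "\<dots> \<le> 12000 * (H / (R * K * \<eta>)) + 48 * 81 * (3 * L) * (\<tau>\<^sup>2 * K\<^sup>2 * het * \<eta>\<^sup>2)
     + \<eta> * (102 * t ^ 4 * \<sigma>\<^sup>2) * (\<tau> * 40)"
  proof (intro add_mono mult_mono)
    show "40 * \<theta> * (9 * \<tau>) + 2 + 8 * (\<eta> * BB * K) \<le> \<tau> * 40"
    proof -
      have "\<theta> * \<tau> \<le> 1 / 32 * \<tau>" using th tau by (intro mult_right_mono) auto
      then have "40 * \<theta> * (9 * \<tau>) \<le> 360 / 32 * \<tau>" by (simp add: mult_ac)
      then show ?thesis using th(2) a tau by linarith
    qed
    show "0 \<le> 40 * \<theta> * (9 * \<tau>) + 2 + 8 * (\<eta> * BB * K)"
      using th tau eta BB by (intro add_nonneg_nonneg mult_nonneg_nonneg) auto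
  qed (use exp_le V V0 BB eta K R H het t in auto)
  \<comment> \<open>The heterogeneity factor \<open>48 * 81 * 3 = 11664\<close> determines 12000;
    the noise term has \<open>102 * 40 = 4080\<close>.\<close>
  also have "\<dots> \<le> 12000 * (H / (R * K * \<eta>)) + 12000 * (\<tau>\<^sup>2 * L * K\<^sup>2 * het * \<eta>\<^sup>2) + 12000 * (\<tau> * t ^ 4 * \<sigma>\<^sup>2 * \<eta>)"
  proof -
    have "0 \<le> \<tau>\<^sup>2 * L * K\<^sup>2 * het * \<eta>\<^sup>2" "0 \<le> \<tau> * t ^ 4 * \<sigma>\<^sup>2 * \<eta>"
      using tau parameters het eta t by auto
    then show ?thesis by (simp add: mult_ac)
  qed
  finally show ?thesis by (simp add: H_def \<tau>_def t_def algebra_simps)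
qed

lemma powr_third_cubed: "0 \<le> (x :: real) \<Longrightarrow> (x powr (1 / 3)) ^ 3 = x"
  by (cases "x = 0") (simp_all add: powr_power)

text \<open>Whichever candidate equals \<eta> turns the first summand into its matching term on the
  right, up to \<open>1 / c\<close>; the upper bounds \<open>le2\<close> and \<open>le3\<close>
  control the other two summands.\<close>

lemma tuned_bound:
  fixes \<tau> L E H \<sigma> t c \<eta> K R :: real
  assumes pos: "0 < \<tau>" "0 < L" "0 < K" "0 < R" "1 \<le> t" "0 < c" "c \<le> 1" "0 \<le> \<sigma>" "0 \<le> E" "0 < H"
    and eta: "\<eta> \<in> {c / (\<tau> * L * K)}
      \<union> (if E = 0 then {} else {H powr (1/3) / ((\<tau>\<^sup>2 * L * R * E) powr (1/3) * K)})
      \<union> (if \<sigma> = 0 then {} else {H powr (1/2) / ((\<tau> * R * K) powr (1/2) * t\<^sup>2 * \<sigma>)})"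
    and le2: "E \<noteq> 0 \<Longrightarrow> \<eta> \<le> H powr (1/3) / ((\<tau>\<^sup>2 * L * R * E) powr (1/3) * K)"
    and le3: "\<sigma> \<noteq> 0 \<Longrightarrow> \<eta> \<le> H powr (1/2) / ((\<tau> * R * K) powr (1/2) * t\<^sup>2 * \<sigma>)"
    and eta0: "0 < \<eta>"
  shows "H / (R * K * \<eta>) + \<tau> * t ^ 4 * \<sigma>\<^sup>2 * \<eta> + \<tau>\<^sup>2 * L * K\<^sup>2 * E * \<eta>\<^sup>2 \<le>
    3 / c * (\<tau> * L * H / R + (\<tau>\<^sup>2 * L * E * H\<^sup>2) powr (1/3) / R powr (2/3)
      + (\<tau> * H) powr (1/2) * t\<^sup>2 * \<sigma> / (R * K) powr (1/2))"
proof -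
  \<comment> \<open>Naming the cube roots makes the identities for the heterogeneity term
    rational.\<close>
  define h where "h = H powr (1/3)"
  define g where "g = (\<tau>\<^sup>2 * L * E) powr (1/3)"
  define \<rho> where "\<rho> = R powr (1/3)"
  define e2 where "e2 = (\<tau>\<^sup>2 * L * E * H\<^sup>2) powr (1/3) / R powr (2/3)"
  define e3 where "e3 = (\<tau> * H) powr (1/2) * t\<^sup>2 * \<sigma> / (R * K) powr (1/2)"
  have h: "0 < h" "h ^ 3 = H" using pos powr_third_cubed[of H] by (auto simp: h_def)
  have g: "0 \<le> g" "g ^ 3 = \<tau>\<^sup>2 * L * E" using pos powr_third_cubed[of "\<tau>\<^sup>2 * L * E"] by (auto simp: g_def)
  have r: "0 < \<rho>" "\<rho> ^ 3 = R" using pos powr_third_cubed[of R] by (auto simp: \<rho>_def)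
  have step2: "(\<tau>\<^sup>2 * L * R * E) powr (1/3) = g * \<rho>"
  proof -
    have "\<tau>\<^sup>2 * L * R * E = (\<tau>\<^sup>2 * L * E) * R" by simp
    then show ?thesis using pos by (simp only: g_def \<rho>_def powr_mult)
  qed
  have e2: "e2 = g * h\<^sup>2 / \<rho>\<^sup>2"
  proof -
    have "(H\<^sup>2) powr (1/3) = h\<^sup>2" "R powr (2/3) = \<rho>\<^sup>2"
      using pos by (simp_all add: h_def \<rho>_def powr_power powr_powr flip: powr_numeral)
    then show ?thesis using pos by (simp add: e2_def g_def powr_mult)
  qed
  have sq: "x powr (1/2) = sqrt x" if "0 \<le> x" for x :: real using that by (rule powr_half_sqrt)
  have step3: "H powr (1/2) / ((\<tau> * R * K) powr (1/2) * t\<^sup>2 * \<sigma>) = sqrt H / (sqrt \<tau> * sqrt R * sqrt K * t\<^sup>2 * \<sigma>)"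
    using pos by (simp add: sq real_sqrt_mult)
  have e3: "e3 = sqrt \<tau> * sqrt H * t\<^sup>2 * \<sigma> / (sqrt R * sqrt K)"
    using pos by (simp add: e3_def sq real_sqrt_mult)
  have e0: "0 \<le> \<tau> * L * H / R" "0 \<le> e2" "0 \<le> e3"
    unfolding e2 e3 using pos g h by auto
  define X where "X = \<tau> * L * H / R + e2 + e3"
  have X: "\<tau> * L * H / R \<le> X" "e2 \<le> X" "e3 \<le> X" using e0 by (auto simp: X_def)
  have c1: "x \<le> 1 / c * X" if "x \<le> X" "0 \<le> X" for x
  proof -
    have "X * c \<le> X * 1" using that pos by (intro mult_left_mono) auto
    then show ?thesis using that pos by (simp add: pos_le_divide_eq) (meson mult_right_mono order_trans less_imp_le)
  qed
  have X0: "0 \<le> X" using e0 by (simp add: X_def)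
  have T1: "H / (R * K * \<eta>) \<le> 1 / c * X"
  proof -
    consider "\<eta> = c / (\<tau> * L * K)" | "E \<noteq> 0" "\<eta> = h / (g * \<rho> * K)"
      | "\<sigma> \<noteq> 0" "\<eta> = sqrt H / (sqrt \<tau> * sqrt R * sqrt K * t\<^sup>2 * \<sigma>)"
      using eta unfolding step2 step3 h_def[symmetric] by (auto split: if_splits)
    then show ?thesis
    proof cases
      case 1
      have "H / (R * K * \<eta>) = 1 / c * (\<tau> * L * H / R)"
        unfolding 1 using pos by (simp add: field_simps)
      also have "\<dots> \<le> 1 / c * X" using X(1) pos by (intro mult_left_mono) auto
      finally show ?thesis .
    next
      case 2
      have "g \<noteq> 0" using 2 g pos by auto
      then have "H / (R * K * \<eta>) = e2"
        unfolding 2 e2 h(2)[symmetric] r(2)[symmetric] using pos h r by (simp add: field_simps power2_eq_square power3_eq_cube)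
      then show ?thesis using c1 X X0 by simp
    next
      case 3
      have "H / (R * K * \<eta>) = (sqrt H * sqrt H) / ((sqrt R * sqrt R) * (sqrt K * sqrt K) * \<eta>)" using pos by simp
      also have "\<dots> = e3" unfolding 3(2) e3 using 3(1) pos by (simp add: field_simps del: real_sqrt_mult_self real_sqrt_mult_self)
      finally show ?thesis using c1 X X0 by simp
    qed
  qed
  have T2: "\<tau> * t ^ 4 * \<sigma>\<^sup>2 * \<eta> \<le> X"
  proof (cases "\<sigma> = 0")
    case False
    have "\<tau> * t ^ 4 * \<sigma>\<^sup>2 * \<eta> \<le> \<tau> * t ^ 4 * \<sigma>\<^sup>2 * (sqrt H / (sqrt \<tau> * sqrt R * sqrt K * t\<^sup>2 * \<sigma>))"
      using le3[OF False] pos unfolding step3 by (intro mult_left_mono) auto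
    also have "\<dots> = (sqrt \<tau> * sqrt \<tau>) * t ^ 4 * \<sigma>\<^sup>2 * (sqrt H / (sqrt \<tau> * sqrt R * sqrt K * t\<^sup>2 * \<sigma>))"
      using pos by simp
    also have "\<dots> = e3"
      unfolding e3 using False pos by (simp add: field_simps power2_eq_square power4_eq_xxxx del: real_sqrt_mult_self)
    finally show ?thesis using X by simp
  qed (use X0 in simp)
  have T3: "\<tau>\<^sup>2 * L * K\<^sup>2 * E * \<eta>\<^sup>2 \<le> X"
  proof (cases "E = 0")
    case False
    then have "g \<noteq> 0" using g pos by auto
    have "\<tau>\<^sup>2 * L * K\<^sup>2 * E * \<eta>\<^sup>2 \<le> \<tau>\<^sup>2 * L * K\<^sup>2 * E * (h / (g * \<rho> * K))\<^sup>2"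
      using le2[OF False] pos eta0 unfolding step2 h_def[symmetric] by (intro mult_left_mono power_mono) auto
    also have "\<dots> = g ^ 3 * K\<^sup>2 * (h / (g * \<rho> * K))\<^sup>2" unfolding g(2) by simp
    also have "\<dots> = e2"
      unfolding e2 using \<open>g \<noteq> 0\<close> pos r by (simp add: field_simps power2_eq_square power3_eq_cube)
    finally show ?thesis using X by simp
  qed (use X0 in simp)
  have "H / (R * K * \<eta>) + \<tau> * t ^ 4 * \<sigma>\<^sup>2 * \<eta> + \<tau>\<^sup>2 * L * K\<^sup>2 * E * \<eta>\<^sup>2 \<le> 1 / c * X + 1 / c * X + 1 / c * X"
    by (intro add_mono T1 c1 T2 T3 X0)
  also have "\<dots> = 3 / c * X" by simp
  finally show ?thesis by (simp add: X_def e2_def e3_def)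
qed

section \<open>Choice of the step size\<close>

lemma tuned_step_cases:
  fixes c L \<sigma> \<tau> E H :: real and d K R :: nat
  defines "\<eta> \<equiv> tuned_step c d K R L \<sigma> \<tau> E H"
  shows "\<eta> \<in> {c / (\<tau> * L * real K)}
      \<union> (if E = 0 then {} else {H powr (1/3) / ((\<tau>\<^sup>2 * L * real R * E) powr (1/3) * real K)})
      \<union> (if \<sigma> = 0 then {} else {H powr (1/2) / ((\<tau> * real R * real K) powr (1/2) * (ln (real d))\<^sup>2 * \<sigma>)})"
    and "\<eta> \<le> c / (\<tau> * L * real K)"
    and "E \<noteq> 0 \<Longrightarrow> \<eta> \<le> H powr (1/3) / ((\<tau>\<^sup>2 * L * real R * E) powr (1/3) * real K)"
    and "\<sigma> \<noteq> 0 \<Longrightarrow> \<eta> \<le> H powr (1/2) / ((\<tau> * real R * real K) powr (1/2) * (ln (real d))\<^sup>2 * \<sigma>)"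
  unfolding \<eta>_def tuned_step_def by (rule Min_in, simp, simp) (rule Min_le, simp, simp)+

context dfedda_setting
begin

lemma mirror_map_nonneg: "0 \<le> mirror_map p w"
  using qp by (simp add: mirror_map_def Let_def q_def[symmetric] conjugate_exponents_def)

lemma mixing_time_pos: "1 \<le> mixing_time M U"
  by (simp add: mixing_time_def)

lemma heterogeneity_nonneg: "0 \<le> heterogeneity d M p D F wstar"
  by (simp add: heterogeneity_def sum_nonneg)

text \<open>\<open>864 = 9 * 3 * 32\<close>: the bound on the summed mixing rates, a bound for
  \<open>exp 1\<close>, and the smallness required along a path.\<close>

lemma dfedda_run_small_step:
  assumes "0 < \<eta>" "\<eta> \<le> (1 / 864) / (mixing_time M U * L * real K)"
  shows "dfedda_run d M K R s L \<sigma> Q \<mu> p D F U P \<xi> w0 wstar \<eta>"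
proof
  define a where "a = mixing_time M U * L * real K"
  have a: "0 < a" using mixing_time_pos parameters sizes by (simp add: a_def)
  have "\<eta> * a \<le> 1 / 864" using assms(2) a by (simp add: a_def[symmetric] pos_le_divide_eq)
  then have "9 * (\<eta> * a) * exp 1 \<le> 9 * (1 / 864) * 3" using exp_le a assms(1) by (intro mult_mono) auto
  then show "\<eta> * (exp 1 * L) * real K * (9 * mixing_time M U) \<le> 1 / 32"
    by (simp add: a_def mult_ac)
qed (rule assms)

lemma small_step_bound:
  assumes "0 < \<eta>" "\<eta> \<le> (1 / 864) / (mixing_time M U * L * real K)"
  shows "(\<forall>m<M. integrable P (subopt d M K R p \<eta> D F U \<xi> w0 wstar m)) \<and>
    expected_gap d M K R p \<eta> D F U P \<xi> w0 wstar \<le> 12000 *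
     (mirror_map p wstar / (real R * real K * \<eta>) + mixing_time M U * ln (real d) ^ 4 * \<sigma>\<^sup>2 * \<eta>
      + (mixing_time M U)\<^sup>2 * L * (real K)\<^sup>2 * heterogeneity d M p D F wstar * \<eta>\<^sup>2)"
proof -
  interpret dfedda_run d M K R s L \<sigma> Q \<mu> p D F U P \<xi> w0 wstar \<eta>
    by (rule dfedda_run_small_step[OF assms])
  show ?thesis using subopt_integrable expected_gap_le by blast
qed

lemma mconj_eq_0: assumes "1 < r" "mconj d r (\<lambda>i. w $ i) \<le> 0" "w \<in> carrier_vec d" shows "w = 0\<^sub>v d"
proof -
  have "(nrm d r (\<lambda>i. w $ i))\<^sup>2 \<le> 0"
    using assms(1,2) by (simp add: mconj_def divide_le_0_iff)
  then have "nrm d r (\<lambda>i. w $ i) = 0" by simp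
  then show ?thesis using assms(3) nrm_eq_0[of d r "\<lambda>i. w $ i"] by (intro eq_vecI) auto
qed

text \<open>A vanishing mirror map forces \<open>wstar = 0\<close>. By Euler's identity the
  divergence of 0 from \<open>w0\<close> is the mirror map at \<open>w0\<close>, so the starting
  assumption forces \<open>w0 = 0\<close> too.\<close>

lemma start_at_zero:
  assumes "mirror_map p wstar = 0" shows "wstar = 0\<^sub>v d" "w0 = 0\<^sub>v d"
proof -
  have p1: "1 < p" and q1: "1 < q" using p_gt_2 qp by (auto simp: conjugate_exponents_def)
  have map: "mirror_map p w = mconj d q (\<lambda>i. w $ i)" if "w \<in> carrier_vec d" for w
    using mirror_map_vec[OF p1, of d "\<lambda>i. w $ i"] carrier_eq_vec[OF that] by (simp add: q_def)
  show ws: "wstar = 0\<^sub>v d"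
    using assms map[OF minimizer(1)] minimizer(1) q1 by (intro mconj_eq_0[of q]) auto
  define x where "x = (\<lambda>i. w0 $ i)"
  have x: "vec d x = w0" using carrier_eq_vec[OF start(1)] by (simp add: x_def)
  have "bregman d (mirror_map p) (vec d (\<lambda>_. 0)) (vec d x) = mconj d q (\<lambda>_. 0) - mconj d q x + ip d (mgrad d q x) x"
    unfolding bregman_def gradient_mirror_map[OF p_gt_2] mirror_map_vec[OF p1] q_def[symmetric] vec_diff_vec scalar_prod_vec
    by (simp add: ip_def sum_negf)
  also have "\<dots> = mconj d q x" using mconj_mgrad(2)[OF pq, of d x] by (simp add: mconj_def)
  finally have "mconj d q x = bregman d (mirror_map p) wstar w0"
    by (simp add: x ws zero_vec_def)
  then show "w0 = 0\<^sub>v d" using start assms q1 by (intro mconj_eq_0[of q]) (auto simp: x_def)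
qed

text \<open>If \<open>h(w\<^sup>*) = 0\<close>, the tuned step size may be 0, which the analysis above excludes; the
  iterates then stay at \<open>w\<^sup>* = 0\<close>.\<close>

lemma zero_step_stays:
  assumes "mirror_map p wstar = 0" "\<omega> \<in> space P" "m < M" "r \<le> R"
  shows "round_dual d M K p 0 F U w0 (\<lambda>r k m. \<xi> r k m \<omega>) r m = 0\<^sub>v d"
  using assms(3,4)
proof (induction r arbitrary: m)
  case 0
  have "gradient d (mirror_map p) (vec d (\<lambda>_. 0)) = vec d (\<lambda>_. 0)"
    unfolding gradient_mirror_map[OF p_gt_2] by (intro eq_vecI) (auto simp: mgrad_def dualv_def)
  then show ?case using start_at_zero(2)[OF assms(1)] by (simp add: zero_vec_def)
next
  case (Suc r)
  have loc: "local_dual d p 0 F (\<lambda>k. \<xi> r k j \<omega>) (0\<^sub>v d) k = 0\<^sub>v d" if "j < M" "k \<le> K" for j k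
    using that(2)
  proof (induction k)
    case (Suc k)
    have "\<xi> r k j \<omega> \<in> space (D j)"
      using xi_measurable[of r k j] assms(2) Suc.prems \<open>Suc r \<le> R\<close> that(1) by (auto dest: measurable_space)
    \<comment> \<open>The gradient is scaled by 0, but it must have dimension \<open>d\<close> for
      the difference to be the zero vector of that dimension.\<close>
    then have "stoch_grad d F (vec d (mgrad d p (\<lambda>_. 0))) (\<xi> r k j \<omega>) \<in> carrier_vec d"
      using gradient_stoch[OF that(1)] by simp
    moreover have "mirror_inv d p (0\<^sub>v d) = vec d (mgrad d p (\<lambda>_. 0))"
      using mirror_inv_vec[OF p_gt_2, of d "\<lambda>_. 0"] by (simp add: zero_vec_def)
    ultimately show ?case using Suc by (intro eq_vecI) auto
  qed simp
  have "(\<Sum>j<M. U $$ (j, m) * local_dual d p 0 F (\<lambda>k. \<xi> r k j \<omega>) (0\<^sub>v d) K $ i) = 0" if "i < d" for i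
    using loc that by (intro sum.neutral) auto
  moreover have "round_dual d M K p 0 F U w0 (\<lambda>r k m. \<xi> r k m \<omega>) r j = 0\<^sub>v d" if "j < M" for j
    using Suc that by simp
  ultimately show ?case by (intro eq_vecI) auto
qed

lemma subopt_zero_step:
  assumes "mirror_map p wstar = 0" "\<omega> \<in> space P" "m < M"
  shows "subopt d M K R p 0 D F U \<xi> w0 wstar m \<omega> = 0"
proof -
  have "mirror_inv d p (0\<^sub>v d) = 0\<^sub>v d"
    using mirror_inv_vec[OF p_gt_2, of d "\<lambda>_. 0"] by (simp add: zero_vec_def mgrad_def[abs_def] dualv_def)
  then have "avg_iterate d M K R p 0 F U w0 (\<lambda>r k m. \<xi> r k m \<omega>) m = 0\<^sub>v d"
    unfolding avg_iterate_def using zero_step_stays[OF assms] by (intro eq_vecI) auto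
  then show ?thesis by (simp add: subopt_def start_at_zero(1)[OF assms(1)])
qed

lemma tuned_step_bound:
  assumes \<eta>: "\<eta> = tuned_step (1 / 864) d K R L \<sigma> (mixing_time M U) (heterogeneity d M p D F wstar) (mirror_map p wstar)"
  shows "(\<forall>m<M. integrable P (subopt d M K R p \<eta> D F U \<xi> w0 wstar m)) \<and>
    expected_gap d M K R p \<eta> D F U P \<xi> w0 wstar \<le> 31104000 *
      (mixing_time M U * L * mirror_map p wstar / real R
        + ((mixing_time M U)\<^sup>2 * L * heterogeneity d M p D F wstar * (mirror_map p wstar)\<^sup>2) powr (1/3) / real R powr (2/3)
        + (mixing_time M U * mirror_map p wstar) powr (1/2) * (ln (real d))\<^sup>2 * \<sigma> / (real R * real K) powr (1/2))"
    (is "?I \<and> ?gap \<le> 31104000 * ?X")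
proof -
  define \<tau> where "\<tau> = mixing_time M U"
  define E where "E = heterogeneity d M p D F wstar"
  define H where "H = mirror_map p wstar"
  have pos: "0 < \<tau>" "0 < L" "0 < real K" "0 < real R" "1 \<le> ln (real d)" "0 \<le> \<sigma>" "0 \<le> E" "0 \<le> H"
    using mixing_time_pos parameters sizes ln_d heterogeneity_nonneg mirror_map_nonneg
    by (auto simp: \<tau>_def E_def H_def)
  have X0: "0 \<le> ?X" using pos unfolding \<tau>_def[symmetric] E_def[symmetric] H_def[symmetric]
    by (intro add_nonneg_nonneg divide_nonneg_nonneg mult_nonneg_nonneg) auto
  note ts = tuned_step_cases[where c = "1 / 864" and d = d and K = K and R = R and L = L and \<sigma> = \<sigma> and \<tau> = \<tau> and E = E and H = H, folded \<eta>[folded \<tau>_def E_def H_def]]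
  \<comment> \<open>At \<open>H = 0\<close> every candidate except the first is 0, so the step is 0
    as soon as one of them takes part in the minimum and positive otherwise.\<close>
  consider "0 < H" | "H = 0" "E = 0" "\<sigma> = 0" | "H = 0" "E \<noteq> 0 \<or> \<sigma> \<noteq> 0" using pos by fastforce
  then show ?thesis
  proof cases
    case 1
    have eta0: "0 < \<eta>" using ts(1) pos 1 by (auto split: if_splits)
    have "?I" and gap: "?gap \<le> 12000 * (H / (real R * real K * \<eta>) + \<tau> * ln (real d) ^ 4 * \<sigma>\<^sup>2 * \<eta> + \<tau>\<^sup>2 * L * (real K)\<^sup>2 * E * \<eta>\<^sup>2)"
      using small_step_bound[OF eta0] ts(2) unfolding \<tau>_def E_def H_def by blast+
    have "H / (real R * real K * \<eta>) + \<tau> * ln (real d) ^ 4 * \<sigma>\<^sup>2 * \<eta> + \<tau>\<^sup>2 * L * (real K)\<^sup>2 * E * \<eta>\<^sup>2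
        \<le> 3 / (1 / 864) * ?X"
      unfolding \<tau>_def[symmetric] E_def[symmetric] H_def[symmetric]
      by (rule tuned_bound[OF pos(1-5) _ _ pos(6,7) 1 ts(1) ts(3,4) eta0]) auto
    then have "12000 * (H / (real R * real K * \<eta>) + \<tau> * ln (real d) ^ 4 * \<sigma>\<^sup>2 * \<eta> + \<tau>\<^sup>2 * L * (real K)\<^sup>2 * E * \<eta>\<^sup>2)
        \<le> 12000 * (3 / (1 / 864) * ?X)" by (rule mult_left_mono) simp
    with gap have "?gap \<le> 12000 * (3 / (1 / 864) * ?X)" by (rule order_trans)
    then show ?thesis using \<open>?I\<close> by simp
  next
    case 2
    have eta: "\<eta> = (1 / 864) / (\<tau> * L * real K)" using ts(1) 2 by simp
    then have "0 < \<eta>" using pos by simp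
    then have "?I \<and> ?gap \<le> 12000 * (H / (real R * real K * \<eta>) + \<tau> * ln (real d) ^ 4 * \<sigma>\<^sup>2 * \<eta> + \<tau>\<^sup>2 * L * (real K)\<^sup>2 * E * \<eta>\<^sup>2)"
      using small_step_bound[of \<eta>] eta unfolding \<tau>_def E_def H_def by simp
    then show ?thesis using 2 X0 by simp
  next
    case 3
    have "\<eta> \<le> 0" using ts(3,4) 3 by auto
    moreover have "0 \<le> \<eta>" using ts(1) 3 pos by (auto split: if_splits)
    ultimately have eta: "\<eta> = 0" by simp
    have zero: "subopt d M K R p \<eta> D F U \<xi> w0 wstar m \<omega> = 0" if "\<omega> \<in> space P" "m < M" for m \<omega>
      unfolding eta using 3 that by (intro subopt_zero_step) (auto simp: H_def)
    have "integrable P (subopt d M K R p \<eta> D F U \<xi> w0 wstar m)" if "m < M" for m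
      using Bochner_Integration.integrable_cong[OF refl zero[OF _ that], of P "\<lambda>\<omega>. \<omega>"] by simp
    moreover have "(\<integral>\<omega>. subopt d M K R p \<eta> D F U \<xi> w0 wstar m \<omega> \<partial>P) = 0" if "m < M" for m
      using Bochner_Integration.integral_cong[OF refl zero[OF _ that], of P "\<lambda>\<omega>. \<omega>"] by simp
    then have "?gap = 0" by (simp add: expected_gap_def)
    ultimately show ?thesis using X0 by simp
  qed
qed

end

theorem theoremB1:
  shows "\<exists>c>0. \<exists>C>0. \<forall>(d::nat) (M::nat) (K::nat) (R::nat) (s::nat)
      (L::real) (\<sigma>::real) (Q::real) (\<mu>::real) (p::real)
      (D :: nat \<Rightarrow> 'x measure) (F :: real vec \<Rightarrow> 'x \<Rightarrow> real) (U :: real mat)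
      (P :: 'w measure) (\<xi> :: nat \<Rightarrow> nat \<Rightarrow> nat \<Rightarrow> 'w \<Rightarrow> 'x) (w0 :: real vec) (wstar :: real vec).
    dfedda_setting d M K R s L \<sigma> Q \<mu> p D F U P \<xi> w0 wstar \<longrightarrow>
    (let \<tau> = mixing_time M U;
         E = heterogeneity d M p D F wstar;
         H = mirror_map p wstar
     in
      (\<forall>\<eta>. 0 < \<eta> \<and> \<eta> \<le> c / (\<tau> * L * real K) \<longrightarrow>
         (\<forall>m<M. integrable P (subopt d M K R p \<eta> D F U \<xi> w0 wstar m)) \<and>
         expected_gap d M K R p \<eta> D F U P \<xi> w0 wstar
           \<le> C * (H / (real R * real K * \<eta>)
                  + \<tau> * (ln (real d)) ^ 4 * \<sigma>\<^sup>2 * \<eta>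
                  + \<tau>\<^sup>2 * L * (real K)\<^sup>2 * E * \<eta>\<^sup>2)) \<and>
      (\<forall>\<eta>. \<eta> = tuned_step c d K R L \<sigma> \<tau> E H \<longrightarrow>
         (\<forall>m<M. integrable P (subopt d M K R p \<eta> D F U \<xi> w0 wstar m)) \<and>
         expected_gap d M K R p \<eta> D F U P \<xi> w0 wstar
           \<le> C * (\<tau> * L * H / real R
                  + (\<tau>\<^sup>2 * L * E * H\<^sup>2) powr (1/3) / real R powr (2/3)
                  + (\<tau> * H) powr (1/2) * (ln (real d))\<^sup>2 * \<sigma> / (real R * real K) powr (1/2))))"
\<comment> \<open>\<open>31104000 = 12000 * 3 * 864\<close> is the constant of the first bound times
  the \<open>3 / c\<close> of \<open>tuned_bound\<close>. One constant has to serve both bounds, so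
  the first is weakened to it.\<close>
proof (rule exI[of _ "1 / 864"], intro conjI, simp, rule exI[of _ 31104000], intro conjI allI impI, simp)
  fix d M K R s :: nat and L \<sigma> Q \<mu> p :: real
    and D :: "nat \<Rightarrow> 'x measure" and F :: "real vec \<Rightarrow> 'x \<Rightarrow> real" and U :: "real mat"
    and P :: "'w measure" and \<xi> :: "nat \<Rightarrow> nat \<Rightarrow> nat \<Rightarrow> 'w \<Rightarrow> 'x" and w0 wstar :: "real vec"
  assume "dfedda_setting d M K R s L \<sigma> Q \<mu> p D F U P \<xi> w0 wstar"
  then interpret dfedda_setting d M K R s L \<sigma> Q \<mu> p D F U P \<xi> w0 wstar .
  let ?B = "\<lambda>\<eta>. mirror_map p wstar / (real R * real K * \<eta>) + mixing_time M U * ln (real d) ^ 4 * \<sigma>\<^sup>2 * \<eta>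
      + (mixing_time M U)\<^sup>2 * L * (real K)\<^sup>2 * heterogeneity d M p D F wstar * \<eta>\<^sup>2"
  have nonneg: "0 \<le> ?B \<eta>" if "0 < \<eta>" for \<eta>
    using that mirror_map_nonneg heterogeneity_nonneg mixing_time_pos parameters ln_d
    by (intro add_nonneg_nonneg divide_nonneg_nonneg mult_nonneg_nonneg) auto
  have first: "(\<forall>m<M. integrable P (subopt d M K R p \<eta> D F U \<xi> w0 wstar m)) \<and>
      expected_gap d M K R p \<eta> D F U P \<xi> w0 wstar \<le> 31104000 * ?B \<eta>"
    if "0 < \<eta> \<and> \<eta> \<le> 1 / 864 / (mixing_time M U * L * real K)" for \<eta>
  proof -
    have "12000 * ?B \<eta> \<le> 31104000 * ?B \<eta>" using nonneg[of \<eta>] that by (intro mult_right_mono) auto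
    then show ?thesis using small_step_bound[of \<eta>] that by (auto intro: order_trans)
  qed
  show "let \<tau> = mixing_time M U;
         E = heterogeneity d M p D F wstar;
         H = mirror_map p wstar
     in
      (\<forall>\<eta>. 0 < \<eta> \<and> \<eta> \<le> 1 / 864 / (\<tau> * L * real K) \<longrightarrow>
         (\<forall>m<M. integrable P (subopt d M K R p \<eta> D F U \<xi> w0 wstar m)) \<and>
         expected_gap d M K R p \<eta> D F U P \<xi> w0 wstar
           \<le> 31104000 * (H / (real R * real K * \<eta>)
                  + \<tau> * (ln (real d)) ^ 4 * \<sigma>\<^sup>2 * \<eta>
                  + \<tau>\<^sup>2 * L * (real K)\<^sup>2 * E * \<eta>\<^sup>2)) \<and>
      (\<forall>\<eta>. \<eta> = tuned_step (1 / 864) d K R L \<sigma> \<tau> E H \<longrightarrow>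
         (\<forall>m<M. integrable P (subopt d M K R p \<eta> D F U \<xi> w0 wstar m)) \<and>
         expected_gap d M K R p \<eta> D F U P \<xi> w0 wstar
           \<le> 31104000 * (\<tau> * L * H / real R
                  + (\<tau>\<^sup>2 * L * E * H\<^sup>2) powr (1/3) / real R powr (2/3)
                  + (\<tau> * H) powr (1/2) * (ln (real d))\<^sup>2 * \<sigma> / (real R * real K) powr (1/2)))"
    unfolding Let_def using first tuned_step_bound by blast
qed

end
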